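(* Let $\Gamma=\mathbb Z$ with the standard order, $b=1$ and $a=2$; that is, let $\mathcal H_n$ be the Hecke algebra of type $B_n$ over $\mathcal A=\mathbb Z[v,v^{-1}]$ with parameters $\mathbf q=v^2$ and $\mathbf Q=v$. Then $$\mathrm{span}_{\mathcal A}\{C_w : w\in W_n,\ w\notin W_b\}=J_n .$$
   Context: $W_n$ is the Coxeter group of type $B_n$: permutations $w$ of $\{\pm1,\dots,\pm n\}$ with $w(-i)=-w(i)$, generated by $s_0=(-1,1)$ and $s_i=(i,i+1)(-i,-i-1)$, $1\le i\le n-1$. $W_b\subseteq W_n$ is the set of $w$ such that no reduced expression of $w$ contains three consecutive factors $s_is_js_i$ with $i\in\{1,\dots,n-1\}$, $j\in\{0,\dots,n-1\}$, $|i-j|=1$ (so $s_1s_0s_1$ is forbidden, $s_0s_1s_0$ is allowed). $\mathcal H_n$ is the $\mathcal A$-algebra on $T_0,\dots,T_{n-1}$ with $T_iT_{i-1}T_i=T_{i-1}T_iT_{i-1}$ ($2\le i\le n-1$), $T_0T_1T_0T_1=T_1T_0T_1T_0$, $T_iT_j=T_jT_i$ ($|i-j|>1$), $(T_i-\mathbf q)(T_i+\mathbf q^{-1})=0$ ($i\ge1$), $(T_0-\mathbf Q)(T_0+\mathbf Q^{-1})=0$. $T_w=T_{i_1}\cdots T_{i_N}$ for a reduced expression $w=s_{i_1}\cdots s_{i_N}$. The bar involution is the ring automorphism with $\overline{T_w}=T_{w^{-1}}^{-1}$, $\overline v=v^{-1}$. $C_w$ is the unique element with $\overline{C_w}=C_w$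 and $C_w-T_w\in\bigoplus_{y\in W_n}v\mathbb Z[v]\,T_y$. One has $C_{s_0}=C_0:=T_0-\mathbf Q$ and $C_{s_i}=C_i:=T_i-\mathbf q$ for $i\ge1$. $J_n$ is the two-sided ideal of $\mathcal H_n$ generated by $C_1C_2C_1-C_1$ and $C_1C_0C_1-[2]_{\mathbf Q/\mathbf q}C_1$, where $[2]_x=x+x^{-1}$ (generators involving an index $\ge n$ are omitted). *)

theory Defs
  imports "HOL-Algebra.QuotRing" "HOL-Combinatorics.Permutations" "HOL-Library.Poly_Mapping"
begin

section \<open>The Coxeter group of type $B_n$\<close>

definition weylB :: "nat \<Rightarrow> (int \<Rightarrow> int) set" where
  "weylB n = {w. w permutes ({- int n .. int n} - {0}) \<and> (\<forall>i. w (- i) = - w i)}"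

fun s_gen :: "nat \<Rightarrow> int \<Rightarrow> int" where
  "s_gen 0 = transpose (- 1) 1"
| "s_gen (Suc i) = transpose (int i + 1) (int i + 2) \<circ> transpose (- int i - 1) (- int i - 2)"

definition word_perm :: "nat list \<Rightarrow> int \<Rightarrow> int" where
  "word_perm is = foldr (\<lambda>i w. s_gen i \<circ> w) is id"

definition reduced_expression :: "nat \<Rightarrow> nat list \<Rightarrow> (int \<Rightarrow> int) \<Rightarrow> bool" where
  "reduced_expression n is w \<longleftrightarrow>
     set is \<subseteq> {..<n} \<and> word_perm is = w \<and>
     (\<forall>js. set js \<subseteq> {..<n} \<longrightarrow> word_perm js = w \<longrightarrow> length is \<le> length js)"

definition weylB_b :: "nat \<Rightarrow> (int \<Rightarrow> int) set" where
  "weylB_b n = {w \<in> weylB n.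
     \<not> (\<exists>us vs i j. 1 \<le> i \<and> i < n \<and> j < n \<and> \<bar>int i - int j\<bar> = 1 \<and>
          reduced_expression n (us @ [i, j, i] @ vs) w)}"

section \<open>The coefficient ring\<close>

text \<open>The group algebra of the integers over the integers is the ring of Laurent polynomials:
  \<^term>\<open>Poly_Mapping.lookup p k\<close> is the coefficient of $v^k$ in \<open>p\<close>.\<close>

type_synonym laurent = "int \<Rightarrow>\<^sub>0 int"

definition vpow :: "int \<Rightarrow> laurent" where
  "vpow k = Poly_Mapping.single k 1"

section \<open>Free associative algebras\<close>

text \<open>The free monoid on the natural numbers, written additively so that the convolution product
  of finitely supported functions on it is the product of the free algebra.\<close>

datatype word = Word (letters: "nat list")

instantiation word :: monoid_add
begin

definition zero_word :: word where
  "zero_word = Word []"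

definition plus_word :: "word \<Rightarrow> word \<Rightarrow> word" where
  "plus_word u w = Word (letters u @ letters w)"

instance
  by standard (simp_all add: zero_word_def plus_word_def)

end

type_synonym free_poly = "word \<Rightarrow>\<^sub>0 laurent"

definition free_algebra :: "nat \<Rightarrow> free_poly ring" where
  "free_algebra n =
     \<lparr>carrier = {p. \<forall>w \<in> Poly_Mapping.keys p. set (letters w) \<subseteq> {..<n}},
      monoid.mult = (*), one = 1, zero = 0, add = (+)\<rparr>"

definition gen :: "nat \<Rightarrow> free_poly" where
  "gen i = Poly_Mapping.single (Word [i]) 1"

definition scalar :: "laurent \<Rightarrow> free_poly" where
  "scalar c = Poly_Mapping.single 0 c"

lemma ring_free_algebra: "ring (free_algebra n)"
proof (rule ringI)
  show "abelian_group (free_algebra n)"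
  proof (rule abelian_groupI)
    fix p assume p: "p \<in> carrier (free_algebra n)"
    then have "- p \<in> carrier (free_algebra n)" by (simp add: free_algebra_def)
    then show "\<exists>q \<in> carrier (free_algebra n).
        q \<oplus>\<^bsub>free_algebra n\<^esub> p = \<zero>\<^bsub>free_algebra n\<^esub>"
      by (intro bexI[of _ "- p"]) (simp_all add: free_algebra_def)
  next
    fix p q assume "p \<in> carrier (free_algebra n)" "q \<in> carrier (free_algebra n)"
    then show "p \<oplus>\<^bsub>free_algebra n\<^esub> q \<in> carrier (free_algebra n)"
      using Poly_Mapping.keys_add[of p q] by (auto simp: free_algebra_def)
  qed (simp_all add: free_algebra_def add.assoc add.commute)
  show "Group.monoid (free_algebra n)"
  proof (rule monoidI)
    fix p q assume "p \<in> carrier (free_algebra n)" "q \<in> carrier (free_algebra n)"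
    then show "p \<otimes>\<^bsub>free_algebra n\<^esub> q \<in> carrier (free_algebra n)"
      using Poly_Mapping.keys_mult[of p q] by (fastforce simp: free_algebra_def plus_word_def)
  next
    show "\<one>\<^bsub>free_algebra n\<^esub> \<in> carrier (free_algebra n)"
      by (simp add: free_algebra_def zero_word_def flip: single_one)
  qed (simp_all add: free_algebra_def mult.assoc)
qed (simp_all add: free_algebra_def distrib_left distrib_right)

section \<open>The Hecke algebra\<close>

text \<open>Parameters: $\mathbf q = v^a$ and $\mathbf Q = v^b$.\<close>

definition param :: "int \<Rightarrow> int \<Rightarrow> nat \<Rightarrow> int" where
  "param a b i = (if i = 0 then b else a)"

definition hecke_relators :: "int \<Rightarrow> int \<Rightarrow> nat \<Rightarrow> free_poly set" where
  "hecke_relators a b n =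
     {gen i * gen (i - 1) * gen i - gen (i - 1) * gen i * gen (i - 1) | i. 2 \<le> i \<and> i < n}
   \<union> (if 2 \<le> n then {gen 0 * gen 1 * gen 0 * gen 1 - gen 1 * gen 0 * gen 1 * gen 0} else {})
   \<union> {gen i * gen j - gen j * gen i | i j. i < n \<and> j < n \<and> \<bar>int i - int j\<bar> > 1}
   \<union> {(gen i - scalar (vpow (param a b i))) * (gen i + scalar (vpow (- param a b i))) | i. i < n}"

definition hecke_ideal :: "int \<Rightarrow> int \<Rightarrow> nat \<Rightarrow> free_poly set" where
  "hecke_ideal a b n = genideal (free_algebra n) (hecke_relators a b n)"

definition hecke :: "int \<Rightarrow> int \<Rightarrow> nat \<Rightarrow> free_poly set ring" where
  "hecke a b n = free_algebra n Quot hecke_ideal a b n"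

definition hecke_scalar :: "int \<Rightarrow> int \<Rightarrow> nat \<Rightarrow> laurent \<Rightarrow> free_poly set" where
  "hecke_scalar a b n c = hecke_ideal a b n +>\<^bsub>free_algebra n\<^esub> scalar c"

definition T_gen :: "int \<Rightarrow> int \<Rightarrow> nat \<Rightarrow> nat \<Rightarrow> free_poly set" where
  "T_gen a b n i = hecke_ideal a b n +>\<^bsub>free_algebra n\<^esub> gen i"

lemma scalar_closed: "scalar c \<in> carrier (free_algebra n)"
  by (simp add: scalar_def free_algebra_def zero_word_def)

lemma gen_closed: "i < n \<Longrightarrow> gen i \<in> carrier (free_algebra n)"
  by (simp add: gen_def free_algebra_def)

lemma hecke_relators_closed: "hecke_relators a b n \<subseteq> carrier (free_algebra n)"
proof -
  interpret F: ring "free_algebra n" by (rule ring_free_algebra)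
  have mult: "p * q \<in> carrier (free_algebra n)"
    and add: "p + q \<in> carrier (free_algebra n)"
    and diff: "p - q \<in> carrier (free_algebra n)"
    if "p \<in> carrier (free_algebra n)" "q \<in> carrier (free_algebra n)" for p q
  proof -
    show "p * q \<in> carrier (free_algebra n)"
      using F.m_closed[OF that] by (simp add: free_algebra_def)
    show "p + q \<in> carrier (free_algebra n)"
      using F.a_closed[OF that] by (simp add: free_algebra_def)
    have "- q \<in> carrier (free_algebra n)" using that by (simp add: free_algebra_def)
    then show "p - q \<in> carrier (free_algebra n)"
      using F.a_closed[OF that(1), of "- q"] by (simp add: free_algebra_def)
  qed
  show ?thesis
    by (auto simp: hecke_relators_def intro!: mult add diff gen_closed scalar_closed)
qed

lemma ideal_hecke_ideal: "ideal (hecke_ideal a b n) (free_algebra n)"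
  unfolding hecke_ideal_def
  by (rule ring.genideal_ideal[OF ring_free_algebra hecke_relators_closed])

lemma ring_hecke: "ring (hecke a b n)"
  unfolding hecke_def by (rule ideal.quotient_is_ring[OF ideal_hecke_ideal])

text \<open>The $\mathcal A$-linear span.  Scalars act by multiplication with their (central) images.\<close>

definition hecke_span :: "int \<Rightarrow> int \<Rightarrow> nat \<Rightarrow> free_poly set set \<Rightarrow> free_poly set set" where
  "hecke_span a b n S =
     {\<Oplus>\<^bsub>hecke a b n\<^esub> x \<in> F. hecke_scalar a b n (c x) \<otimes>\<^bsub>hecke a b n\<^esub> x
       | F c. finite F \<and> F \<subseteq> S}"

definition T_word :: "int \<Rightarrow> int \<Rightarrow> nat \<Rightarrow> nat list \<Rightarrow> free_poly set" where
  "T_word a b n is =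
     foldr (\<lambda>i x. T_gen a b n i \<otimes>\<^bsub>hecke a b n\<^esub> x) is \<one>\<^bsub>hecke a b n\<^esub>"

text \<open>By Matsumoto's theorem the choice of the reduced expression is immaterial.\<close>

definition T_std :: "int \<Rightarrow> int \<Rightarrow> nat \<Rightarrow> (int \<Rightarrow> int) \<Rightarrow> free_poly set" where
  "T_std a b n w = T_word a b n (SOME is. reduced_expression n is w)"

text \<open>Requiring \<^const>\<open>extensional\<close> pins down the values outside the carrier, so that the
  automorphism is unique as a HOL function.\<close>

definition bar_inv :: "int \<Rightarrow> int \<Rightarrow> nat \<Rightarrow> free_poly set \<Rightarrow> free_poly set" where
  "bar_inv a b n = (THE f. f \<in> ring_iso (hecke a b n) (hecke a b n) \<and>
     f \<in> extensional (carrier (hecke a b n)) \<and>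
     f (hecke_scalar a b n (vpow 1)) = hecke_scalar a b n (vpow (- 1)) \<and>
     (\<forall>w \<in> weylB n. f (T_std a b n w) = m_inv (hecke a b n) (T_std a b n (inv_into UNIV w))))"

definition KL_basis :: "int \<Rightarrow> int \<Rightarrow> nat \<Rightarrow> (int \<Rightarrow> int) \<Rightarrow> free_poly set" where
  "KL_basis a b n w = (THE c. c \<in> carrier (hecke a b n) \<and> bar_inv a b n c = c \<and>
     (\<exists>p. (\<forall>y \<in> weylB n. Poly_Mapping.keys (p y) \<subseteq> {0<..}) \<and>
        c \<ominus>\<^bsub>hecke a b n\<^esub> T_std a b n w =
          (\<Oplus>\<^bsub>hecke a b n\<^esub> y \<in> weylB n.
             hecke_scalar a b n (p y) \<otimes>\<^bsub>hecke a b n\<^esub> T_std a b n y)))"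

section \<open>The ideal $J_n$\<close>

definition C_gen :: "int \<Rightarrow> int \<Rightarrow> nat \<Rightarrow> nat \<Rightarrow> free_poly set" where
  "C_gen a b n i =
     T_gen a b n i \<ominus>\<^bsub>hecke a b n\<^esub> hecke_scalar a b n (vpow (param a b i))"

definition J_gens :: "int \<Rightarrow> int \<Rightarrow> nat \<Rightarrow> free_poly set set" where
  "J_gens a b n =
     (if 3 \<le> n then
        {(C_gen a b n 1 \<otimes>\<^bsub>hecke a b n\<^esub> C_gen a b n 2 \<otimes>\<^bsub>hecke a b n\<^esub> C_gen a b n 1)
           \<ominus>\<^bsub>hecke a b n\<^esub> C_gen a b n 1} else {})
   \<union> (if 2 \<le> n then
        {(C_gen a b n 1 \<otimes>\<^bsub>hecke a b n\<^esub> C_gen a b n 0 \<otimes>\<^bsub>hecke a b n\<^esub> C_gen a b n 1)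
           \<ominus>\<^bsub>hecke a b n\<^esub>
         (hecke_scalar a b n (vpow (b - a) + vpow (a - b)) \<otimes>\<^bsub>hecke a b n\<^esub> C_gen a b n 1)} else {})"

definition J_ideal :: "int \<Rightarrow> int \<Rightarrow> nat \<Rightarrow> free_poly set set" where
  "J_ideal a b n = genideal (hecke a b n) (J_gens a b n)"

end

theory Submission
  imports Defs "HOL-Library.Function_Algebras"
begin

text \<open>An element lies in \<open>W\<^sub>b\<close> iff it has no decreasing triple of values at nonzero positions. In the
  quotient of the Hecke algebra by \<open>J\<^sub>n\<close> the relations rewrite every \<open>T\<^sub>w\<close> as a \<open>\<int>[v]\<close>-combination of
  the \<open>T\<^sub>y\<close> with \<open>y \<in> W\<^sub>b\<close>, and as a \<open>v \<int>[v]\<close>-combination if \<open>w \<notin> W\<^sub>b\<close>. These \<open>T\<^sub>y\<close> are linearly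
  independent in the quotient because they are so on the functions on sign vectors, a module
  killed by \<open>J\<^sub>n\<close>. Hence for \<open>w \<notin> W\<^sub>b\<close> the image of \<open>C\<^sub>w\<close> is a bar-invariant \<open>v \<int>[v]\<close>-combination
  of a basis on which the bar involution is unitriangular, so it vanishes. Conversely, the images of
  the \<open>C\<^sub>y\<close> with \<open>y \<in> W\<^sub>b\<close> are unitriangular with respect to this basis, so an element of \<open>J\<^sub>n\<close> only
  involves the \<open>C\<^sub>w\<close> with \<open>w \<notin> W\<^sub>b\<close>.\<close>

section \<open>The Coxeter group of type $B_n$\<close>

text \<open>Solving the quotient relations for T_i T_j T_i gives coefficients in v Z[v], but inside
  a longer word the replacements are in general no longer reduced, and the quadratic relation then
  brings in v^(-2); term by term such losses could pile up. They are bounded by passing to C_i = T_i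
  - q_i, with q_0 = v and q_i = v^2 for i >= 1. In the C_i the relations turn monomials into scalar
  multiples of monomials, the only scalars with negative powers being the loops -(q_i + q_i^(-1))
  and v + v^(-1), and multiplying by a monotone run of C_i, however long, creates at most one loop.
  So a run costs at most v^(-2), which the scalar in T_i = C_i + v^2 repays. The Z[v]-lattice of
  products of descending C-runs is built along W_0, W_1, ..., W_n through minimal coset
  representatives, and decreasing triples arise along the same chain when the new largest value is
  inserted too far to the left. That lattice equals the Z[v]-span of the T_w, so a gain of v in it
  can be iterated. Sign vectors suffice for independence because an avoiding element is the unique
  shortest one in its coset by the stabiliser of a set of n positions.\<close>

declare upt_Suc [simp del] s_gen.simps [simp del]

section \<open>Signed transpositions and the elements of the group\<close>

definition lo :: "nat \<Rightarrow> int" where "lo i = (if i = 0 then - 1 else int i)"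
definition hi :: "nat \<Rightarrow> int" where "hi i = int i + 1"

text \<open>For \<open>i = 0\<close> this compares w(1) with w(-1), so for odd w it says w(1) < 0.
  With \<open>lo\<close> and \<open>hi\<close> the generator \<open>s_gen 0\<close> needs no
  separate treatment.\<close>

definition descent :: "(int \<Rightarrow> int) \<Rightarrow> nat \<Rightarrow> bool" where
  "descent w i \<longleftrightarrow> w (hi i) < w (lo i)"

text \<open>For b = -a the cases collapse to a sign change, so both kinds of reflections of the
  group, and in particular every \<open>s_gen i\<close>, have this form.\<close>

definition refl :: "int \<Rightarrow> int \<Rightarrow> int \<Rightarrow> int" where
  "refl a b x = (if x = a then b else if x = b then a
     else if x = - a then - b else if x = - b then - a else x)"

definition odd_fun :: "(int \<Rightarrow> int) \<Rightarrow> bool" where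
  "odd_fun f \<longleftrightarrow> (\<forall>x. f (- x) = - f x)"

lemma odd_funD: "odd_fun f \<Longrightarrow> f (- x) = - f x"
  by (simp add: odd_fun_def)

lemma odd_fun_zero: "odd_fun f \<Longrightarrow> f 0 = (0 :: int)"
  using odd_funD[of f 0] by simp

lemma odd_fun_comp: "odd_fun f \<Longrightarrow> odd_fun g \<Longrightarrow> odd_fun (f \<circ> g)"
  by (simp add: odd_fun_def)

lemma s_gen_eq_refl: "s_gen i = refl (lo i) (hi i)"
  by (cases i) (auto simp: s_gen.simps fun_eq_iff refl_def lo_def hi_def transpose_def)

lemma s_gen_lo [simp]: "s_gen i (lo i) = hi i"
  and s_gen_hi [simp]: "s_gen i (hi i) = lo i"
  by (auto simp: s_gen_eq_refl refl_def)

lemma lo_less_hi: "lo i < hi i"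
  by (auto simp: lo_def hi_def)

lemma refl_refl: "a \<noteq> 0 \<Longrightarrow> b \<noteq> 0 \<Longrightarrow> refl a b (refl a b x) = x"
  by (auto simp: refl_def)

lemma refl_uminus: "a \<noteq> 0 \<Longrightarrow> b \<noteq> 0 \<Longrightarrow> refl a b (- x) = - refl a b x"
  by (auto simp: refl_def)

lemma lo_neq_0 [simp]: "lo i \<noteq> 0" and hi_neq_0 [simp]: "hi i \<noteq> 0"
  by (auto simp: lo_def hi_def)

lemma s_gen_s_gen [simp]: "s_gen i (s_gen i x) = x"
  by (simp add: s_gen_eq_refl refl_refl lo_neq_0 hi_neq_0)

lemma s_gen_comp_self [simp]: "s_gen i \<circ> s_gen i = id"
  by (simp add: fun_eq_iff)

lemma odd_s_gen: "odd_fun (s_gen i)"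
  by (simp add: odd_fun_def s_gen_eq_refl refl_uminus)

lemma s_gen_uminus [simp]: "s_gen i (- x) = - s_gen i x"
  using odd_s_gen odd_funD by blast

lemma s_gen_int: "s_gen i (int m) = (if i = 0 then (if m = 1 then - 1 else int m)
    else if m = i then int i + 1 else if m = i + 1 then int i else int m)"
  by (auto simp: s_gen_eq_refl refl_def lo_def hi_def)

lemma word_perm_Nil [simp]: "word_perm [] = id"
  and word_perm_Cons [simp]: "word_perm (i # is) = s_gen i \<circ> word_perm is"
  by (simp_all add: word_perm_def)

lemma word_perm_append [simp]: "word_perm (us @ vs) = word_perm us \<circ> word_perm vs"
  by (induction us) (simp_all add: comp_assoc)

lemma odd_word_perm: "odd_fun (word_perm is)"
  by (induction "is") (auto intro: odd_fun_comp odd_s_gen simp: odd_fun_def)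

lemma word_perm_rev_comp: "word_perm (rev is) \<circ> word_perm is = id"
  by (induction "is") (simp_all add: fun_eq_iff)

lemma word_perm_comp_rev: "word_perm is \<circ> word_perm (rev is) = id"
  using word_perm_rev_comp[of "rev is"] by simp

lemma inv_word_perm: "inv_into UNIV (word_perm is) = word_perm (rev is)"
  by (metis word_perm_comp_rev word_perm_rev_comp inv_unique_comp)

lemma weylB_odd: "w \<in> weylB n \<Longrightarrow> odd_fun w"
  by (simp add: weylB_def odd_fun_def)

lemma weylB_bij: "w \<in> weylB n \<Longrightarrow> bij w"
  by (auto simp: weylB_def intro: permutes_bij)

lemma weylB_inj: "w \<in> weylB n \<Longrightarrow> w x = w y \<longleftrightarrow> x = y"
  using weylB_bij by (metis bij_pointE)

lemma weylB_zero: "w \<in> weylB n \<Longrightarrow> w 0 = 0"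
  by (simp add: weylB_odd odd_fun_zero)

lemma weylB_eq_0_iff [simp]: "w \<in> weylB n \<Longrightarrow> w x = 0 \<longleftrightarrow> x = 0"
  using weylB_inj[of w n x 0] by (simp add: weylB_zero)

lemma weylB_uminus: "w \<in> weylB n \<Longrightarrow> w (- x) = - w x"
  by (simp add: weylB_odd odd_funD)

lemma id_weylB: "id \<in> weylB n"
  by (simp add: weylB_def permutes_id)

lemma weylB_comp: "v \<in> weylB n \<Longrightarrow> w \<in> weylB n \<Longrightarrow> v \<circ> w \<in> weylB n"
  by (auto simp: weylB_def intro: permutes_compose)

lemma weylB_inv: "w \<in> weylB n \<Longrightarrow> inv_into UNIV w \<in> weylB n"
  unfolding weylB_def mem_Collect_eq
  by (metis permutes_inv permutes_inverses(1) permutes_inverses(2))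

lemma finite_weylB: "finite (weylB n)"
  by (rule finite_subset[OF _ finite_permutations[of "{- int n..int n} - {0}"]])
     (auto simp: weylB_def)

lemma weylB_fixes: assumes "w \<in> weylB n" "\<bar>x\<bar> > int n" shows "w x = x"
proof -
  have "x \<notin> {- int n..int n} - {0}" using assms(2) by auto
  then show ?thesis using assms(1) by (auto simp: weylB_def permutes_not_in)
qed

lemma weylB_bound: assumes "w \<in> weylB n" shows "\<bar>w x\<bar> \<le> int n \<longleftrightarrow> \<bar>x\<bar> \<le> int n"
proof -
  have p: "w permutes ({- int n..int n} - {0})" using assms by (simp add: weylB_def)
  show ?thesis using permutes_in_image[OF p, of x] weylB_eq_0_iff[OF assms, of x]
    by auto
qed

lemma weylBI:
  assumes "bij w" "odd_fun w" "\<And>x. x > int n \<Longrightarrow> w x = x"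
  shows "w \<in> weylB n"
proof -
  have "w x = x" if "x \<notin> {- int n..int n} - {0}" for x
  proof -
    have "x = 0 \<or> x > int n \<or> - x > int n" using that by (simp; linarith)
    then consider "x = 0" | "x > int n" | "- x > int n" by blast
    then show ?thesis
      using assms(3)[of x] assms(3)[of "- x"] odd_funD[OF assms(2), of x] odd_fun_zero[OF assms(2)]
      by cases auto
  qed
  then show ?thesis using assms(1,2)
    by (auto simp: weylB_def odd_fun_def permutes_def bij_iff)
qed

lemma weylB_mono: "m \<le> n \<Longrightarrow> weylB m \<subseteq> weylB n"
  by (auto intro!: weylBI simp: weylB_bij weylB_odd weylB_fixes)

lemma s_gen_weylB: "i < n \<Longrightarrow> s_gen i \<in> weylB n"
  by (intro weylBI o_bij[OF s_gen_comp_self s_gen_comp_self] odd_s_gen)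
     (auto simp: s_gen_eq_refl refl_def lo_def hi_def)

lemma word_perm_weylB: "set is \<subseteq> {..<n} \<Longrightarrow> word_perm is \<in> weylB n"
  by (induction "is") (auto intro: weylB_comp s_gen_weylB id_weylB)

subsection \<open>Length and reduced words\<close>

lemma word_perm_upt: "1 \<le> k \<Longrightarrow> k \<le> m \<Longrightarrow> word_perm [k..<m] (int m) = int k"
proof (induction m)
  case (Suc m)
  show ?case
  proof (cases "k = Suc m")
    case False
    then have "k \<le> m" using Suc.prems by simp
    moreover have "s_gen m (1 + int m) = int m"
      using s_gen_int[of m "Suc m"] \<open>k \<le> m\<close> Suc.prems by (simp add: add.commute)
    ultimately show ?thesis using Suc by (simp add: upt_Suc)
  qed simp
qed simp

lemma word_perm_upt0: "word_perm [0..<Suc m] (int (Suc m)) = - 1"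
proof -
  have "word_perm [0..<Suc m] = s_gen 0 \<circ> word_perm [1..<Suc m]"
    by (simp add: upt_conv_Cons)
  then show ?thesis using word_perm_upt[of 1 "Suc m"] s_gen_int[of 0 1] by simp
qed

lemma word_perm_rev_eq: "word_perm is x = y \<longleftrightarrow> word_perm (rev is) y = x"
  using word_perm_rev_comp[of "is"] word_perm_comp_rev[of "is"]
  by (metis comp_apply id_apply)

text \<open>Each letter, appended on the right, will raise the length. Phrased through descents, the
  notion is available before any length function.\<close>

fun ascends :: "(int \<Rightarrow> int) \<Rightarrow> nat list \<Rightarrow> bool" where
  "ascends w [] \<longleftrightarrow> True"
| "ascends w (i # is) \<longleftrightarrow> \<not> descent w i \<and> ascends (w \<circ> s_gen i) is"

lemma ascends_append:
  "ascends w (us @ vs) \<longleftrightarrow> ascends w us \<and> ascends (w \<circ> word_perm us) vs"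
  by (induction us arbitrary: w) (auto simp: comp_assoc)

text \<open>The letters s_m, ..., s_(k+1) bring the largest value m+1 to position k+1 =
  \<open>hi k\<close>, so the next letter s_k is an ascent whatever stands at
  \<open>lo k\<close>.\<close>

lemma ascends_down:
  assumes x: "x \<in> weylB m" and k: "k \<le> Suc m"
  shows "ascends x (rev [k..<Suc m])"
  using k
proof (induction k rule: inc_induct)
  case (step k)
  have "word_perm (rev [Suc k..<Suc m]) (hi k) = int (Suc m)"
    using word_perm_upt[of "Suc k" "Suc m"] word_perm_rev_eq[of "[Suc k..<Suc m]" "int (Suc m)" "hi k"] step
    by (simp add: hi_def add.commute)
  then have 1: "(x \<circ> word_perm (rev [Suc k..<Suc m])) (hi k) = int (Suc m)"
    using weylB_fixes[OF x, of "int (Suc m)"] by simp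
  have "x \<circ> word_perm (rev [Suc k..<Suc m]) \<in> weylB (Suc m)"
    using weylB_mono[of m "Suc m"] x by (intro weylB_comp word_perm_weylB) auto
  from weylB_bound[OF this, of "lo k"] weylB_inj[OF this, of "lo k" "hi k"]
  have "\<not> descent (x \<circ> word_perm (rev [Suc k..<Suc m])) k"
    unfolding descent_def 1 using step lo_less_hi[of k] by (auto simp: lo_def hi_def)
  moreover have "rev [k..<Suc m] = rev [Suc k..<Suc m] @ [k]"
    using step by (simp add: upt_conv_Cons)
  ultimately show ?case using step.IH by (simp add: ascends_append)
qed simp

text \<open>After s_0 the value at position 1 is -(m+1), the smallest one, and s_1, s_2, ... move it
  to the right: at each step the minimum stands at \<open>lo k\<close>.\<close>

lemma ascends_up:
  assumes x: "x \<in> weylB m" and k: "1 \<le> k" "k \<le> Suc m"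
  shows "ascends x (rev [0..<Suc m] @ [1..<k])"
  using k
proof (induction k rule: dec_induct)
  case base
  then show ?case using ascends_down[OF x, of 0] by simp
next
  case (step k)
  let ?u = "rev [0..<Suc m] @ [1..<k]"
  have "word_perm (rev [0..<Suc m]) (- 1) = int (Suc m)"
    using word_perm_upt0[of m] word_perm_rev_eq[of "[0..<Suc m]"] by simp
  then have "word_perm ?u (int k) = - int (Suc m)"
    using word_perm_upt[of 1 k] step odd_funD[OF odd_word_perm, of "rev [0..<Suc m]" 1] by simp
  then have 1: "(x \<circ> word_perm ?u) (lo k) = - int (Suc m)"
    using weylB_fixes[OF x, of "- int (Suc m)"] step by (simp add: lo_def)
  have "x \<circ> word_perm ?u \<in> weylB (Suc m)"
    using weylB_mono[of m "Suc m"] x step by (intro weylB_comp word_perm_weylB) auto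
  from weylB_bound[OF this, of "hi k"]
  have "\<not> descent (x \<circ> word_perm ?u) k"
    unfolding descent_def 1 using step by (auto simp: hi_def)
  moreover have "rev [0..<Suc m] @ [1..<Suc k] = ?u @ [k]"
    using step by (simp add: upt_Suc)
  ultimately show ?case using step by (simp add: ascends_append comp_assoc)
qed

text \<open>The cosets are told apart by the position j of the value m+1. The first form covers j =
  k >= 1 and, with k = 0, also j = -1; the second covers j = -k with k >= 2. Only the words of the
  second form contain s_1 s_0 s_1.\<close>

lemma weylB_decomp:
  assumes w: "w \<in> weylB (Suc m)"
  obtains x k where "x \<in> weylB m" "k \<le> Suc m" "w = x \<circ> word_perm (rev [k..<Suc m])"
  | x k where "x \<in> weylB m" "2 \<le> k" "k \<le> Suc m" "w = x \<circ> word_perm (rev [0..<Suc m] @ [1..<k])"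
proof -
  obtain j where j: "w j = int (Suc m)" using weylB_bij[OF w] by (metis bij_pointE)
  have jb: "j \<noteq> 0" "\<bar>j\<bar> \<le> int (Suc m)"
    using j weylB_zero[OF w] weylB_bound[OF w, of j] by auto
  have main: "\<exists>x \<in> weylB m. w = x \<circ> word_perm (rev u)"
    if u: "word_perm u (int (Suc m)) = j" "set u \<subseteq> {..<Suc m}" for u
  proof
    let ?x = "w \<circ> word_perm u"
    have x: "?x \<in> weylB (Suc m)" using w u by (intro weylB_comp word_perm_weylB)
    show "?x \<in> weylB m"
    proof (rule weylBI)
      show "?x y = y" if "y > int m" for y
        using that u j weylB_fixes[OF x, of y] by (cases "y = int (Suc m)") auto
    qed (use x weylB_bij weylB_odd in auto)
    show "w = ?x \<circ> word_perm (rev u)"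
      by (simp add: comp_assoc word_perm_comp_rev)
  qed
  consider (pos) k where "1 \<le> k" "k \<le> Suc m" "j = int k"
    | (one) "j = - 1" | (neg) k where "2 \<le> k" "k \<le> Suc m" "j = - int k"
  proof -
    have "j = int (nat j) \<and> 1 \<le> nat j \<and> nat j \<le> Suc m \<or> j = - 1 \<or>
       j = - int (nat (- j)) \<and> 2 \<le> nat (- j) \<and> nat (- j) \<le> Suc m"
      using jb by auto
    then show ?thesis using that by blast
  qed
  then show ?thesis
  proof cases
    case pos
    then have "word_perm [k..<Suc m] (int (Suc m)) = j" by (simp only: word_perm_upt)
    moreover have "set [k..<Suc m] \<subseteq> {..<Suc m}" by (auto simp: subset_iff)
    ultimately obtain x where "x \<in> weylB m" "w = x \<circ> word_perm (rev [k..<Suc m])"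
      using main[of "[k..<Suc m]"] by blast
    then show ?thesis using that(1) pos by blast
  next
    case one
    then have "word_perm [0..<Suc m] (int (Suc m)) = j" by (simp only: word_perm_upt0)
    moreover have "set [0..<Suc m] \<subseteq> {..<Suc m}" by (auto simp: subset_iff)
    ultimately obtain x where "x \<in> weylB m" "w = x \<circ> word_perm (rev [0..<Suc m])"
      using main[of "[0..<Suc m]"] by blast
    then show ?thesis using that(1) by blast
  next
    case neg
    have "word_perm (rev [1..<k]) 1 = int k"
      using word_perm_upt[of 1 k] word_perm_rev_eq[of "[1..<k]" "int k" 1] neg by simp
    then have "word_perm (rev [1..<k] @ [0..<Suc m]) (int (Suc m)) = j"
      using word_perm_upt0[of m] neg odd_funD[OF odd_word_perm, of "rev [1..<k]" 1] by simp
    moreover have "set (rev [1..<k] @ [0..<Suc m]) \<subseteq> {..<Suc m}" using neg by (auto simp: subset_iff)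
    ultimately obtain x where "x \<in> weylB m" "w = x \<circ> word_perm (rev (rev [1..<k] @ [0..<Suc m]))"
      using main[of "rev [1..<k] @ [0..<Suc m]"] by blast
    then show ?thesis using that(2)[of x k] neg by (metis rev_append rev_rev_ident)
  qed
qed

lemma weylB_word: "w \<in> weylB n \<Longrightarrow> \<exists>is. set is \<subseteq> {..<n} \<and> word_perm is = w"
proof (induction n arbitrary: w)
  case 0
  then have "w x = x" for x using weylB_fixes[of w 0 x] weylB_zero[of w 0] by (cases "x = 0") auto
  then have "w = id" by (simp add: fun_eq_iff)
  then show ?case by (intro exI[of _ "[]"]) simp
next
  case (Suc m)
  have *: "\<exists>is. set is \<subseteq> {..<Suc m} \<and> word_perm is = x \<circ> word_perm u"
    if "x \<in> weylB m" "set u \<subseteq> {..<Suc m}" for x u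
  proof -
    obtain "is" where "set is \<subseteq> {..<m}" "word_perm is = x" using Suc.IH[OF \<open>x \<in> weylB m\<close>] by blast
    then show ?thesis using that by (intro exI[of _ "is @ u"]) auto
  qed
  from Suc.prems show ?case
  proof (cases rule: weylB_decomp)
    case (1 x k)
    have "set (rev [k..<Suc m]) \<subseteq> {..<Suc m}" by auto
    from *[OF 1(1) this] show ?thesis unfolding 1(3) .
  next
    case (2 x k)
    have "set (rev [0..<Suc m] @ [1..<k]) \<subseteq> {..<Suc m}" using 2 by auto
    from *[OF 2(1) this] show ?thesis unfolding 2(4) .
  qed
qed

section \<open>Length and the exchange property\<close>

definition len :: "nat \<Rightarrow> (int \<Rightarrow> int) \<Rightarrow> nat" where
  "len n w = (LEAST k. \<exists>is. set is \<subseteq> {..<n} \<and> word_perm is = w \<and> length is = k)"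

lemma len_le: "set is \<subseteq> {..<n} \<Longrightarrow> len n (word_perm is) \<le> length is"
  unfolding len_def by (rule Least_le) blast

lemma reduced_expression_iff:
  "reduced_expression n is w \<longleftrightarrow> set is \<subseteq> {..<n} \<and> word_perm is = w \<and> length is = len n w"
proof
  assume r: "reduced_expression n is w"
  then have "len n w = length is"
    unfolding len_def reduced_expression_def by (intro Least_equality) auto
  then show "set is \<subseteq> {..<n} \<and> word_perm is = w \<and> length is = len n w"
    using r by (auto simp: reduced_expression_def)
next
  assume "set is \<subseteq> {..<n} \<and> word_perm is = w \<and> length is = len n w"
  then show "reduced_expression n is w"
    unfolding reduced_expression_def by (metis len_le)
qed

lemma ex_reduced_expression:
  assumes "w \<in> weylB n" shows "\<exists>is. reduced_expression n is w"
proof -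
  have "\<exists>is. set is \<subseteq> {..<n} \<and> word_perm is = w \<and> length is = len n w"
    unfolding len_def by (rule LeastI_ex) (use weylB_word[OF assms] in blast)
  then show ?thesis by (simp add: reduced_expression_iff)
qed

lemma len_id [simp]: "len n id = 0"
  using len_le[of "[]" n] by simp

lemma len_comp_word:
  assumes "w \<in> weylB n" "set is \<subseteq> {..<n}"
  shows "len n (w \<circ> word_perm is) \<le> len n w + length is"
proof -
  obtain us where "reduced_expression n us w" using ex_reduced_expression assms by blast
  then show ?thesis using len_le[of "us @ is" n] assms by (auto simp: reduced_expression_iff)
qed

text \<open>Excluding 0 matters for \<open>i = 0\<close>, where the sign change also reverses the
  pairs (-1, 0) and (0, 1).\<close>

lemma s_gen_order_flip:
  assumes "x < y" "s_gen i y < s_gen i x" "x \<noteq> 0" "y \<noteq> 0"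
  shows "x = lo i \<and> y = hi i \<or> x = - hi i \<and> y = - lo i"
  using assms by (auto simp: s_gen_eq_refl refl_def lo_def hi_def split: if_splits)

text \<open>The letter that creates the inversion \<open>(a, b)\<close> may be deleted from the word.\<close>

lemma exchange:
  assumes "set is \<subseteq> {..<n}" "a < b" "a \<noteq> 0" "b \<noteq> 0" "word_perm is b < word_perm is a"
  shows "\<exists>js. set js \<subseteq> {..<n} \<and> word_perm js = word_perm is \<circ> refl a b \<and> length js < length is"
  using assms(1,5)
proof (induction "is")
  case Nil
  then show ?case using assms by simp
next
  case (Cons i us)
  let ?u = "word_perm us"
  have u: "?u \<in> weylB n" using Cons.prems by (intro word_perm_weylB) auto
  show ?case
  proof (cases "?u b < ?u a")
    case True
    then obtain js where js: "set js \<subseteq> {..<n}" "word_perm js = ?u \<circ> refl a b" "length js < length us"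
      using Cons.IH Cons.prems by (meson set_subset_Cons subset_trans)
    have "word_perm (i # js) = word_perm (i # us) \<circ> refl a b"
      unfolding word_perm_Cons js(2) by (rule comp_assoc[symmetric])
    then show ?thesis using Cons.prems js by (intro exI[of _ "i # js"]) simp
  next
    case False
    then have lt: "?u a < ?u b" using weylB_inj[OF u, of a b] assms by linarith
    \<comment> \<open>The pair is in order before the letter i acts and out of order afterwards, so
      it is the pair that s_i exchanges. Hence s_i u = u t with t the reflection in (a, b), and
      dropping the letter i amounts to multiplying by t on the right.\<close>
    have "?u a = lo i \<and> ?u b = hi i \<or> ?u a = - hi i \<and> ?u b = - lo i"
      by (rule s_gen_order_flip[OF lt]) (use Cons.prems u assms in auto)
    then have "s_gen i (?u x) = ?u (refl a b x)" for x
      using weylB_inj[OF u, of x] weylB_uminus[OF u, of a] weylB_uminus[OF u, of b] assms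
      unfolding s_gen_eq_refl refl_def[of "lo i"]
      by (smt (verit) minus_minus refl_def weylB_uminus[OF u])
    then have "s_gen i \<circ> ?u = ?u \<circ> refl a b" by (simp add: fun_eq_iff)
    then have "?u = word_perm (i # us) \<circ> refl a b"
      by (metis comp_assoc s_gen_comp_self id_comp word_perm_Cons)
    moreover have "set us \<subseteq> {..<n}" "length us < length (i # us)" using Cons.prems by auto
    ultimately show ?thesis by blast
  qed
qed

text \<open>The positions a and b need not be adjacent; \<open>minimal_length\<close> applies this
  to arbitrary inversions inside a set of positions.\<close>

lemma len_exchange:
  assumes w: "w \<in> weylB n" and "a < b" "a \<noteq> 0" "b \<noteq> 0" "w b < w a"
  shows "len n (w \<circ> refl a b) < len n w"
proof -
  obtain us where "reduced_expression n us w" using ex_reduced_expression w by blast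
  then have us: "set us \<subseteq> {..<n}" "word_perm us = w" "length us = len n w"
    by (auto simp: reduced_expression_iff)
  then obtain js where "set js \<subseteq> {..<n}" "word_perm js = w \<circ> refl a b" "length js < length us"
    using exchange[of us n a b] assms by auto
  then show ?thesis using len_le[of js n] us by simp
qed

lemma len_descent:
  assumes "w \<in> weylB n" "i < n" "descent w i"
  shows "Suc (len n (w \<circ> s_gen i)) = len n w"
proof -
  have "len n (w \<circ> s_gen i) < len n w"
    using len_exchange[OF assms(1), of "lo i" "hi i"] assms lo_less_hi
    by (simp add: descent_def s_gen_eq_refl)
  moreover have "len n w \<le> Suc (len n (w \<circ> s_gen i))"
    using len_comp_word[of "w \<circ> s_gen i" n "[i]"] assms
    by (simp add: comp_assoc weylB_comp s_gen_weylB)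
  ultimately show ?thesis by simp
qed

lemma descent_s_gen: "w \<in> weylB n \<Longrightarrow> descent (w \<circ> s_gen i) i \<longleftrightarrow> \<not> descent w i"
  using weylB_inj[of w n "lo i" "hi i"] lo_less_hi[of i] by (auto simp: descent_def)

lemma len_ascent:
  assumes "w \<in> weylB n" "i < n" "\<not> descent w i"
  shows "len n (w \<circ> s_gen i) = Suc (len n w)"
  using len_descent[of "w \<circ> s_gen i" n i] assms
  by (simp add: descent_s_gen weylB_comp s_gen_weylB comp_assoc)

lemma len_ascends:
  assumes "w \<in> weylB n" "set is \<subseteq> {..<n}" "ascends w is"
  shows "len n (w \<circ> word_perm is) = len n w + length is"
  using assms
proof (induction "is" arbitrary: w)
  case (Cons i "is")
  have "len n ((w \<circ> s_gen i) \<circ> word_perm is) = len n (w \<circ> s_gen i) + length is"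
  proof (rule Cons.IH)
    show "w \<circ> s_gen i \<in> weylB n" using Cons.prems by (intro weylB_comp s_gen_weylB) auto
    show "set is \<subseteq> {..<n}" "ascends (w \<circ> s_gen i) is"
      using Cons.prems(2,3) by (simp, simp only: ascends.simps)
  qed
  moreover have "len n (w \<circ> s_gen i) = Suc (len n w)" using Cons.prems by (auto intro: len_ascent)
  ultimately show ?case unfolding word_perm_Cons by (simp only: comp_assoc list.size add_Suc add_Suc_right)
qed simp

section \<open>Reduced words and the survival of inversions\<close>

definition reduced :: "nat \<Rightarrow> nat list \<Rightarrow> bool" where
  "reduced n is \<longleftrightarrow> set is \<subseteq> {..<n} \<and> length is = len n (word_perm is)"

lemma reduced_expression_reduced: "reduced_expression n is w \<longleftrightarrow> reduced n is \<and> word_perm is = w"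
  by (auto simp: reduced_expression_iff reduced_def)

lemma reduced_append:
  assumes "reduced n (us @ vs)" shows "reduced n us" "reduced n vs"
proof -
  have s: "set us \<subseteq> {..<n}" "set vs \<subseteq> {..<n}" and l: "length us + length vs = len n (word_perm us \<circ> word_perm vs)"
    using assms by (auto simp: reduced_def)
  have "len n (word_perm us \<circ> word_perm vs) \<le> len n (word_perm us) + length vs"
    using len_comp_word[OF word_perm_weylB[OF s(1)] s(2)] .
  then show "reduced n us" using s l len_le[OF s(1)] by (simp add: reduced_def)
  obtain vs' where "reduced_expression n vs' (word_perm vs)"
    using ex_reduced_expression word_perm_weylB[OF s(2)] by blast
  then have v': "set vs' \<subseteq> {..<n}" "word_perm vs' = word_perm vs" "length vs' = len n (word_perm vs)"
    by (auto simp: reduced_expression_iff)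
  have "len n (word_perm us \<circ> word_perm vs) \<le> length us + len n (word_perm vs)"
    using len_le[of "us @ vs'" n] s v' by simp
  then show "reduced n vs" using s l len_le[OF s(2)] by (simp add: reduced_def)
qed

lemma reduced_snoc:
  assumes "reduced n is" "i < n"
  shows "reduced n (is @ [i]) \<longleftrightarrow> \<not> descent (word_perm is) i"
proof -
  have w: "word_perm is \<in> weylB n" using assms by (auto simp: reduced_def word_perm_weylB)
  show ?thesis
    using len_ascent[OF w assms(2)] len_descent[OF w assms(2)] assms by (auto simp: reduced_def)
qed

lemma reduced_ascends:
  assumes "reduced n us" "set vs \<subseteq> {..<n}" "ascends (word_perm us) vs"
  shows "reduced n (us @ vs)"
proof -
  have "word_perm us \<in> weylB n" using assms by (auto simp: reduced_def word_perm_weylB)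
  from len_ascends[OF this] show ?thesis using assms by (auto simp: reduced_def)
qed

text \<open>If p put the pair back in order, the exchange property would delete one letter from q
  and one from p, and the two reflections would cancel: a shorter word for the same element.\<close>

lemma inversion_persists:
  assumes r: "reduced n (p @ q)" and ab: "a < b" "a \<noteq> 0" "b \<noteq> 0"
    and q: "word_perm q b < word_perm q a"
  shows "word_perm (p @ q) b < word_perm (p @ q) a"
proof (rule ccontr)
  have s: "set p \<subseteq> {..<n}" "set q \<subseteq> {..<n}" using r by (auto simp: reduced_def)
  have qW: "word_perm q \<in> weylB n" and pW: "word_perm p \<in> weylB n"
    using s by (auto simp: word_perm_weylB)
  let ?x = "word_perm q a" let ?y = "word_perm q b"
  assume "\<not> ?thesis"
  then have "word_perm p ?x < word_perm p ?y"
    using weylB_inj[OF pW, of ?x ?y] q by auto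
  then obtain p' where p': "set p' \<subseteq> {..<n}" "word_perm p' = word_perm p \<circ> refl ?y ?x" "length p' < length p"
    using exchange[OF s(1) q] qW ab by auto
  obtain q' where q': "set q' \<subseteq> {..<n}" "word_perm q' = word_perm q \<circ> refl a b" "length q' < length q"
    using exchange[OF s(2) ab q] by auto
  have "refl ?y ?x (word_perm q z) = word_perm q (refl a b z)" for z
    using weylB_inj[OF qW, of z] weylB_uminus[OF qW] unfolding refl_def by (smt (verit))
  then have "refl ?y ?x \<circ> word_perm q = word_perm q \<circ> refl a b" by (simp add: fun_eq_iff)
  then have "word_perm (p' @ q') = word_perm p \<circ> (refl ?y ?x \<circ> refl ?y ?x) \<circ> word_perm q"
    unfolding word_perm_append p'(2) q'(2) by (simp only: comp_assoc)
  also have "refl ?y ?x \<circ> refl ?y ?x = id" using refl_refl[of ?y ?x] qW ab by (simp add: fun_eq_iff)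
  finally have "word_perm (p' @ q') = word_perm (p @ q)" by (simp only: comp_id word_perm_append)
  then show False using len_le[of "p' @ q'" n] p' q' r by (auto simp: reduced_def)
qed

subsection \<open>Matsumoto's theorem\<close>

lemma s_gen_Suc_values:
  assumes "1 \<le> i" shows "s_gen i (int i) = int i + 1" "s_gen i (int i + 1) = int i"
    "s_gen i (int i + 2) = int i + 2" "s_gen (Suc i) (int i) = int i"
    "s_gen (Suc i) (int i + 1) = int i + 2" "s_gen (Suc i) (int i + 2) = int i + 1"
  using assms by (auto simp: s_gen_eq_refl refl_def lo_def hi_def)

lemma s_gen_01_values:
  "s_gen 0 1 = - 1" "s_gen 0 2 = 2" "s_gen (Suc 0) 1 = 2" "s_gen (Suc 0) 2 = 1"
  by (auto simp: s_gen_eq_refl refl_def lo_def hi_def)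

lemma s_gen_far:
  assumes "i + 1 < j"
  shows "s_gen i (lo j) = lo j" "s_gen i (hi j) = hi j" "s_gen j (lo i) = lo i" "s_gen j (hi i) = hi i"
  using assms by (cases i; cases j; simp add: s_gen_eq_refl refl_def lo_def hi_def)+

lemma comp_refl:
  assumes "u \<in> weylB n" shows "u \<circ> refl a b = refl (u a) (u b) \<circ> u"
proof
  fix z
  show "(u \<circ> refl a b) z = (refl (u a) (u b) \<circ> u) z"
    using weylB_inj[OF assms, of z a] weylB_inj[OF assms, of z b]
      weylB_inj[OF assms, of z "- a"] weylB_inj[OF assms, of z "- b"] weylB_uminus[OF assms]
    by (simp add: refl_def)
qed

lemma s_gen_comp_refl: "s_gen i \<circ> refl a b = refl (s_gen i a) (s_gen i b) \<circ> s_gen i"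
  using comp_refl[OF s_gen_weylB[of i "Suc i"]] by simp

lemma s_gen_commute: "i + 1 < j \<Longrightarrow> s_gen i \<circ> s_gen j = s_gen j \<circ> s_gen i"
  by (subst (2 3) s_gen_eq_refl) (simp only: s_gen_comp_refl s_gen_far)

lemma s_gen_conj: "s_gen i \<circ> (s_gen j \<circ> s_gen i) = refl (s_gen i (lo j)) (s_gen i (hi j))"
proof -
  have "s_gen i \<circ> (s_gen j \<circ> s_gen i) = (s_gen i \<circ> s_gen j) \<circ> s_gen i" by (simp only: comp_assoc)
  also have "s_gen i \<circ> s_gen j = refl (s_gen i (lo j)) (s_gen i (hi j)) \<circ> s_gen i"
    by (subst (2) s_gen_eq_refl) (rule s_gen_comp_refl)
  finally show ?thesis by (simp only: comp_assoc s_gen_comp_self comp_id)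
qed

text \<open>Both sides are conjugates of generators, hence reflections, and both are the one in (i,
  i+2).\<close>

lemma s_gen_braid3: "1 \<le> i \<Longrightarrow> word_perm [i, Suc i, i] = word_perm [Suc i, i, Suc i]"
  using s_gen_Suc_values[of i]
  by (simp only: word_perm_Cons word_perm_Nil comp_id s_gen_conj)
     (simp add: lo_def hi_def add.commute[of 2] add.commute[of 1])

text \<open>s_1 s_0 s_1 is the sign change at 2, which commutes with the sign change s_0 at
  1.\<close>

lemma s_gen_braid4: "word_perm [0, 1, 0, 1] = word_perm [1, 0, 1, 0]"
proof -
  have r: "s_gen 1 \<circ> (s_gen 0 \<circ> s_gen 1) = refl (- 2) 2"
    unfolding s_gen_conj using s_gen_01_values s_gen_uminus[of 1 1] by (simp add: lo_def hi_def del: s_gen_uminus)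
  have "s_gen 0 \<circ> refl (- 2) 2 = refl (- 2) 2 \<circ> s_gen 0"
    unfolding s_gen_comp_refl using s_gen_01_values by simp
  then show ?thesis
    unfolding word_perm_Cons word_perm_Nil comp_id using r by (metis comp_assoc)
qed

lemma ascends_braid3:
  assumes "1 \<le> i" "y (int i) < y (int i + 1)" "y (int i + 1) < y (int i + 2)"
  shows "ascends y [i, Suc i, i]" "ascends y [Suc i, i, Suc i]"
  using assms s_gen_Suc_values[OF assms(1)]
  by (simp_all add: descent_def lo_def hi_def add.commute[of 1] add.commute[of 2])

lemma ascends_braid4:
  assumes "odd_fun y" "0 < y 1" "y 1 < y 2"
  shows "ascends y [0, 1, 0, 1]" "ascends y [1, 0, 1, 0]"
  using assms s_gen_01_values odd_funD[OF assms(1), of 1] odd_funD[OF assms(1), of 2]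
  by (simp_all add: descent_def lo_def hi_def)

lemma ascends_commute:
  assumes "\<not> descent y i" "\<not> descent y j" "i + 1 < j"
  shows "ascends y [i, j]" "ascends y [j, i]"
proof -
  show "ascends y [i, j]" "ascends y [j, i]" using assms s_gen_far[OF assms(3)]
    by (simp_all add: descent_def)
qed

text \<open>Two descents of \<open>w\<close> generate a finite dihedral group, whose longest element can be split off
  from \<open>w\<close> on the right.\<close>

lemma dihedral_split:
  assumes w: "w \<in> weylB n" and ij: "i < j" "j < n" and d: "descent w i" "descent w j"
  obtains y A B where "y \<in> weylB n" "ascends y (A @ [i])" "ascends y (B @ [j])"
    "set A \<subseteq> {..<n}" "set B \<subseteq> {..<n}"
    "w = y \<circ> word_perm (A @ [i])" "w = y \<circ> word_perm (B @ [j])"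
    "(A, B) = ([j], [i]) \<and> i + 1 < j \<or> (A, B) = ([i, j], [j, i]) \<and> 1 \<le> i \<and> j = Suc i \<or>
     (A, B) = ([1, 0, 1], [0, 1, 0]) \<and> i = 0 \<and> j = 1"
proof -
  note goal = that
  have *: thesis if A: "word_perm (A @ [i]) = word_perm (B @ [j])" "set A \<subseteq> {..<n}" "set B \<subseteq> {..<n}"
    and y: "ascends (w \<circ> word_perm (rev (A @ [i]))) (A @ [i])"
      "ascends (w \<circ> word_perm (rev (A @ [i]))) (B @ [j])"
    and c: "(A, B) = ([j], [i]) \<and> i + 1 < j \<or> (A, B) = ([i, j], [j, i]) \<and> 1 \<le> i \<and> j = Suc i \<or>
     (A, B) = ([1, 0, 1], [0, 1, 0]) \<and> i = 0 \<and> j = 1" for A B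
  proof (rule goal)
    show "ascends (w \<circ> word_perm (rev (A @ [i]))) (A @ [i])" by (rule y)
    show "ascends (w \<circ> word_perm (rev (A @ [i]))) (B @ [j])" by (rule y)
    show "set A \<subseteq> {..<n}" "set B \<subseteq> {..<n}" by (rule A)+
    show "(A, B) = ([j], [i]) \<and> i + 1 < j \<or> (A, B) = ([i, j], [j, i]) \<and> 1 \<le> i \<and> j = Suc i \<or>
     (A, B) = ([1, 0, 1], [0, 1, 0]) \<and> i = 0 \<and> j = 1" by (rule c)
    show "w \<circ> word_perm (rev (A @ [i])) \<in> weylB n"
      using A ij by (intro weylB_comp[OF w] word_perm_weylB) auto
    show 1: "w = w \<circ> word_perm (rev (A @ [i])) \<circ> word_perm (A @ [i])"
      by (simp only: comp_assoc word_perm_rev_comp comp_id)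
    then show "w = w \<circ> word_perm (rev (A @ [i])) \<circ> word_perm (B @ [j])"
      by (simp only: A)
  qed
  consider "i + 1 < j" | "1 \<le> i" "j = Suc i" | "i = 0" "j = 1" using ij by fastforce
  then show thesis
  proof cases
    case 1
    note v = s_gen_far[OF 1]
    have "\<not> descent (w \<circ> word_perm [i, j]) i" "\<not> descent (w \<circ> word_perm [i, j]) j"
      using d v by (simp_all add: descent_def)
    from ascends_commute[OF this 1] show ?thesis
      using 1 ij s_gen_commute[OF 1] by (intro *[of "[j]" "[i]"]) auto
  next
    case 2
    have d': "w (int i + 1) < w (int i)" "w (int i + 2) < w (int i + 1)"
      using d 2 by (auto simp: descent_def lo_def hi_def add.commute)
    show ?thesis
    proof (rule *[of "[i, j]" "[j, i]"])
      have "(w \<circ> word_perm [i, Suc i, i]) (int i) < (w \<circ> word_perm [i, Suc i, i]) (int i + 1)"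
        "(w \<circ> word_perm [i, Suc i, i]) (int i + 1) < (w \<circ> word_perm [i, Suc i, i]) (int i + 2)"
        using d' s_gen_Suc_values[OF 2(1)] by simp_all
      from ascends_braid3[OF 2(1) this]
      show "ascends (w \<circ> word_perm (rev ([i, j] @ [i]))) ([i, j] @ [i])"
        "ascends (w \<circ> word_perm (rev ([i, j] @ [i]))) ([j, i] @ [j])"
        unfolding 2(2) append.simps rev.simps .
      show "word_perm ([i, j] @ [i]) = word_perm ([j, i] @ [j])"
        unfolding 2(2) append.simps by (rule s_gen_braid3[OF 2(1)])
    qed (use 2 ij in auto)
  next
    case 3
    have d': "w 1 < 0" "w 2 < w 1"
      using d 3 weylB_uminus[OF w, of 1] by (auto simp: descent_def lo_def hi_def)
    have o: "odd_fun (w \<circ> word_perm [0, 1, 0, 1])"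
      by (intro odd_fun_comp weylB_odd[OF w] odd_word_perm)
    show ?thesis
    proof (rule *[of "[1, 0, 1]" "[0, 1, 0]"])
      have "0 < (w \<circ> word_perm [0, 1, 0, 1]) 1" "(w \<circ> word_perm [0, 1, 0, 1]) 1 < (w \<circ> word_perm [0, 1, 0, 1]) 2"
        using d' s_gen_01_values weylB_uminus[OF w] by auto
      note asc = ascends_braid4[OF o this]
      show "ascends (w \<circ> word_perm (rev ([1, 0, 1] @ [i]))) ([1, 0, 1] @ [i])"
        unfolding 3 append.simps rev.simps by (rule asc(2))
      show "ascends (w \<circ> word_perm (rev ([1, 0, 1] @ [i]))) ([0, 1, 0] @ [j])"
        unfolding 3 append.simps rev.simps by (rule asc(1))
      show "word_perm ([1, 0, 1] @ [i]) = word_perm ([0, 1, 0] @ [j])"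
        unfolding 3 append.simps by (rule s_gen_braid4[symmetric])
    qed (use 3 ij in auto)
  qed
qed

text \<open>If two reduced words of one element end in i < j, both letters are descents, and
  \<open>dihedral_split\<close> supplies two further reduced words that end in the two sides of a
  braid relation. Each given word is joined to the one with the same last letter by the induction
  hypothesis, and the relation joins the new words. The target is an arbitrary monoid, so that one
  theorem serves every algebra below.\<close>

theorem matsumoto:
  fixes T :: "nat \<Rightarrow> 'a :: monoid_mult"
  assumes braid3: "\<And>i. 1 \<le> i \<Longrightarrow> Suc i < n \<Longrightarrow> T i * T (Suc i) * T i = T (Suc i) * T i * T (Suc i)"
    and braid4: "2 \<le> n \<Longrightarrow> T 0 * T 1 * T 0 * T 1 = T 1 * T 0 * T 1 * T 0"
    and comm: "\<And>i j. i + 1 < j \<Longrightarrow> j < n \<Longrightarrow> T i * T j = T j * T i"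
    and "reduced n us" "reduced n vs" "word_perm us = word_perm vs"
  shows "prod_list (map T us) = prod_list (map T vs)"
  using assms(4-6)
proof (induction "length us" arbitrary: us vs)
  case 0
  then have "us = []" by simp
  with 0 have "word_perm vs = id" by (simp only: word_perm_Nil)
  then have "length vs = 0" using 0 by (simp only: reduced_def len_id)
  then show ?case using \<open>us = []\<close> by simp
next
  case (Suc l)
  let ?P = "\<lambda>us. prod_list (map T us)"
  have len: "length vs = length us" using Suc.prems by (auto simp: reduced_def)
  have key: "?P (us @ [i]) = ?P (vs @ [j])"
    if ij: "i < j" and r: "reduced n (us @ [i])" "reduced n (vs @ [j])"
      and w: "word_perm (us @ [i]) = word_perm (vs @ [j])" and l: "l = length us" for us vs i j
  proof -
    have n: "j < n" "i < n" using r by (auto simp: reduced_def)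
    have ru: "reduced n us" "reduced n vs" using r reduced_append by blast+
    have uW: "word_perm us \<in> weylB n" "word_perm vs \<in> weylB n"
      using ru by (auto simp: reduced_def intro: word_perm_weylB)
    have lv: "l = length vs" using r w l by (auto simp: reduced_def)
    let ?w = "word_perm (us @ [i])"
    have wi: "?w = word_perm us \<circ> s_gen i" and wj: "?w = word_perm vs \<circ> s_gen j"
      by (simp, simp only: w, simp)
    have W: "?w \<in> weylB n" unfolding wi using uW n by (intro weylB_comp s_gen_weylB)
    have "descent ?w i" "descent ?w j"
      using reduced_snoc[OF ru(1) n(2)] reduced_snoc[OF ru(2) n(1)] r
        descent_s_gen[OF uW(1), of i] descent_s_gen[OF uW(2), of j] unfolding wi[symmetric] wj[symmetric] by auto
    from dihedral_split[OF W ij n(1) this]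
    obtain y A B where y: "y \<in> weylB n" "ascends y (A @ [i])" "ascends y (B @ [j])"
      "set A \<subseteq> {..<n}" "set B \<subseteq> {..<n}" "?w = y \<circ> word_perm (A @ [i])" "?w = y \<circ> word_perm (B @ [j])"
      and c: "(A, B) = ([j], [i]) \<and> i + 1 < j \<or> (A, B) = ([i, j], [j, i]) \<and> 1 \<le> i \<and> j = Suc i \<or>
         (A, B) = ([1, 0, 1], [0, 1, 0]) \<and> i = 0 \<and> j = 1" by blast
    obtain Y where Y: "reduced n Y" "word_perm Y = y"
      using ex_reduced_expression[OF y(1)] by (auto simp: reduced_expression_reduced)
    have "reduced n (Y @ A @ [i])" "reduced n (Y @ B @ [j])"
      using Y y n by (auto intro!: reduced_ascends)
    then have rYA: "reduced n (Y @ A)" "reduced n (Y @ B)"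
      using reduced_append(1)[of n "Y @ A" "[i]"] reduced_append(1)[of n "Y @ B" "[j]"] by auto
    have "word_perm us \<circ> (s_gen i \<circ> s_gen i) = word_perm (Y @ A) \<circ> (s_gen i \<circ> s_gen i)"
      using y(6) wi Y by (simp only: word_perm_append comp_assoc[symmetric] word_perm_Cons word_perm_Nil comp_id)
    then have pA: "word_perm us = word_perm (Y @ A)" by (simp only: s_gen_comp_self comp_id)
    have "word_perm vs \<circ> (s_gen j \<circ> s_gen j) = word_perm (Y @ B) \<circ> (s_gen j \<circ> s_gen j)"
      using y(7) wj Y by (simp only: word_perm_append comp_assoc[symmetric] word_perm_Cons word_perm_Nil comp_id)
    then have pB: "word_perm vs = word_perm (Y @ B)" by (simp only: s_gen_comp_self comp_id)
    have "?P us = ?P (Y @ A)" "?P vs = ?P (Y @ B)"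
      using Suc.hyps(1)[OF l ru(1) rYA(1) pA] Suc.hyps(1)[OF lv ru(2) rYA(2) pB] by auto
    moreover have "?P (A @ [i]) = ?P (B @ [j])"
      using c n comm[of i j] braid3[of i] braid4 by (auto simp: mult.assoc)
    ultimately show ?thesis by (simp add: mult.assoc)
  qed
  obtain us' i where us: "us = us' @ [i]" using Suc.hyps(2) by (cases us rule: rev_cases) auto
  obtain vs' j where vs: "vs = vs' @ [j]" using Suc.hyps(2) len by (cases vs rule: rev_cases) auto
  have l: "l = length us'" "l = length vs'" using us vs len Suc.hyps(2) by auto
  consider "i = j" | "i < j" | "j < i" by linarith
  then show ?case
  proof cases
    case 1
    have "word_perm us' \<circ> (s_gen i \<circ> s_gen i) = word_perm vs' \<circ> (s_gen i \<circ> s_gen i)"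
      using Suc.prems(3) unfolding us vs 1
      by (simp only: word_perm_append comp_assoc[symmetric] word_perm_Cons word_perm_Nil comp_id)
    then have "word_perm us' = word_perm vs'" by (simp only: s_gen_comp_self comp_id)
    then show ?thesis using Suc.hyps(1)[of us' vs'] l Suc.prems reduced_append(1) unfolding us vs 1 by auto
  next
    case 2
    then show ?thesis using key[of i j us' vs'] Suc.prems l unfolding us vs by blast
  next
    case 3
    then show ?thesis using key[of j i vs' us'] Suc.prems l unfolding us vs by metis
  qed
qed

subsection \<open>Avoiding decreasing triples\<close>

text \<open>Negative and positive positions are treated alike, so triples across 0 count. Positions
  beyond n take part in no inversion of an element of W_n, which makes the notion independent of
  n.\<close>

definition avoids :: "(int \<Rightarrow> int) \<Rightarrow> bool" where
  "avoids w \<longleftrightarrow> \<not> (\<exists>a b c. a \<noteq> 0 \<and> b \<noteq> 0 \<and> c \<noteq> 0 \<and> a < b \<and> b < c \<and> w b < w a \<and> w c < w b)"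

text \<open>The factor s_i s_j s_i has a decreasing triple of its own, and inversions of a factor of
  a reduced word survive on both sides. For j = 0 the triple sits at -2, -1, 2, because s_1 s_0 s_1
  only changes the sign of 2. By contrast s_0 s_1 s_0 takes the values 1, 2, -2, -1 at -2, -1, 1, 2
  and has no triple; this is the origin of the asymmetric condition i >= 1.\<close>

lemma braid_word_not_avoids:
  assumes r: "reduced n (us @ [i, j, i] @ vs)" and i: "1 \<le> i" and ij: "\<bar>int i - int j\<bar> = 1"
  shows "\<not> avoids (word_perm (us @ [i, j, i] @ vs))"
proof -
  let ?m = "word_perm [i, j, i]"
  obtain x y z where xyz: "x < y" "y < z" "?m y < ?m x" "?m z < ?m y" "x \<noteq> 0" "y \<noteq> 0" "z \<noteq> 0"
  proof -
    consider "j = Suc i" | "i = Suc j" "1 \<le> j" | "i = 1" "j = 0" using i ij by fastforce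
    then show ?thesis
    proof cases
      case 1
      then show ?thesis using that[of "int i" "int i + 1" "int i + 2"] s_gen_Suc_values[OF i] i by simp
    next
      case 2
      then show ?thesis using that[of "int j" "int j + 1" "int j + 2"] s_gen_Suc_values[OF 2(2)] by simp
    next
      case 3
      have "s_gen 0 (- 2) = - 2" "s_gen 0 (- 1) = 1" "s_gen (Suc 0) (- 1) = - 2" "s_gen (Suc 0) (- 2) = - 1"
        by (auto simp: s_gen_eq_refl refl_def lo_def hi_def)
      then show ?thesis using that[of "- 2" "- 1" "2"] s_gen_01_values 3 by simp
    qed
  qed
  have s: "set vs \<subseteq> {..<n}" using r by (auto simp: reduced_def)
  have rv: "reduced n ([i, j, i] @ vs)" using reduced_append(2)[OF r] .
  define V where "V = word_perm (rev vs)"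
  have V: "V \<in> weylB n" unfolding V_def using s by (intro word_perm_weylB) auto
  have VV: "word_perm vs (V a) = a" for a
    unfolding V_def using word_perm_comp_rev[of vs] by (simp add: fun_eq_iff)
  \<comment> \<open>If the suffix inverted this pair, the inversion would persist through
    \<open>[i, j, i]\<close>, contrary to the assumption that the middle factor reverses the order
    of a and b.\<close>
  have lt: "V a < V b" if "a < b" "?m b < ?m a" "a \<noteq> 0" "b \<noteq> 0" for a b
  proof (rule ccontr)
    assume "\<not> V a < V b"
    then have "V b < V a" using that weylB_inj[OF V, of a b] by linarith
    from inversion_persists[OF rv this] that V VV show False by (auto simp: weylB_inj)
  qed
  have inv: "word_perm (us @ [i, j, i] @ vs) (V b) < word_perm (us @ [i, j, i] @ vs) (V a)"
    if "a < b" "?m b < ?m a" "a \<noteq> 0" "b \<noteq> 0" for a b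
    using inversion_persists[OF r lt[OF that]] that V VV by auto
  show ?thesis unfolding avoids_def not_not
    using lt[of x y] lt[of y z] inv[of x y] inv[of y z] xyz V
    by (intro exI[of _ "V x"] exI[of _ "V y"] exI[of _ "V z"]) auto
qed

text \<open>Closed form of s_m ... s_k for M = m+1 and p = \<open>lo k\<close>. Composing x with it
  inserts M at position p and -M at -p into the signed sequence of x, the entries outside moving
  outward by one.\<close>

definition ins :: "int \<Rightarrow> int \<Rightarrow> int \<Rightarrow> int" where
  "ins M p y = (if y = p then M else if y = - p then - M
     else if \<bar>p\<bar> < y \<and> y \<le> M then y - 1 else if - M \<le> y \<and> y < - \<bar>p\<bar> then y + 1 else y)"

lemma ins_other:
  assumes "\<bar>y\<bar> \<le> M" "y \<noteq> p" "y \<noteq> - p"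
  shows "ins M p y = (if \<bar>p\<bar> < y then y - 1 else if y < - \<bar>p\<bar> then y + 1 else y)"
  using assms by (auto simp: ins_def)

lemma ins_mono:
  assumes "\<bar>a\<bar> \<le> M" "a \<noteq> p" "a \<noteq> - p" "\<bar>b\<bar> \<le> M" "b \<noteq> p" "b \<noteq> - p" "a < b" "p \<noteq> 0"
  shows "ins M p a < ins M p b"
  unfolding ins_other[OF assms(1-3)] ins_other[OF assms(4-6)] using assms(2,3,5-8)
  by (auto split: if_splits)

lemma ins_nonzero:
  assumes "\<bar>a\<bar> \<le> M" "a \<noteq> p" "a \<noteq> - p" "a \<noteq> 0" "p \<noteq> 0"
  shows "ins M p a \<noteq> 0"
  unfolding ins_other[OF assms(1-3)] using assms by (smt (verit))

lemma word_perm_down: "k \<le> Suc m \<Longrightarrow> word_perm (rev [k..<Suc m]) = ins (int (Suc m)) (lo k)"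
proof (induction k rule: inc_induct)
  case base
  show ?case by (auto simp: fun_eq_iff ins_def lo_def)
next
  case (step k)
  have "rev [k..<Suc m] = rev [Suc k..<Suc m] @ [k]"
    using step by (simp add: upt_conv_Cons)
  then have "word_perm (rev [k..<Suc m]) = ins (int (Suc m)) (lo (Suc k)) \<circ> s_gen k"
    using step.IH by (simp only: word_perm_append word_perm_Cons word_perm_Nil comp_id)
  also have "\<dots> = ins (int (Suc m)) (lo k)"
    using step by (auto simp: fun_eq_iff ins_def s_gen_eq_refl refl_def lo_def hi_def)
  finally show ?case .
qed

lemma increasing_above:
  assumes x: "x \<in> weylB m" and nd: "\<And>j. 1 \<le> j \<Longrightarrow> k \<le> j \<Longrightarrow> j < m \<Longrightarrow> \<not> descent x j"
    and yz: "int k \<le> y" "1 \<le> y" "y < z"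
  shows "x y < x z"
  using yz(3)
proof (induction z rule: int_gr_induct)
  case base
  show ?case
  proof (cases "y < int m")
    case True
    have "1 \<le> nat y" "k \<le> nat y" "nat y < m" using True yz by linarith+
    then have "\<not> descent x (nat y)" using nd by blast
    then show ?thesis using weylB_inj[OF x, of y "y + 1"] yz
      by (simp add: descent_def lo_def hi_def)
  next
    case False
    then show ?thesis using weylB_fixes[OF x, of "y + 1"] weylB_bound[OF x, of y] weylB_fixes[OF x, of y]
      by (cases "y = int m") auto
  qed
next
  case (step z)
  have "x z < x (z + 1)"
  proof (cases "z < int m")
    case True
    have "1 \<le> nat z" "k \<le> nat z" "nat z < m" using True yz step by linarith+
    then have "\<not> descent x (nat z)" using nd by blast
    then show ?thesis using weylB_inj[OF x, of z "z + 1"] yz step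
      by (simp add: descent_def lo_def hi_def)
  next
    case False
    then show ?thesis using weylB_fixes[OF x, of "z + 1"] weylB_bound[OF x, of z] weylB_fixes[OF x, of z] yz step
      by (cases "z = int m") auto
  qed
  then show ?case using step by simp
qed

text \<open>In a decreasing triple the largest value M can only come first and -M only last. Right
  of p the new sequence increases, and so by symmetry it does left of -p, hence neither value takes
  part. A triple off p and -p goes back to a triple of x, as \<open>ins\<close> is increasing
  there.\<close>

lemma avoids_insert:
  assumes x: "x \<in> weylB m" "avoids x" and k: "k \<le> Suc m"
    and nd: "\<And>j. 1 \<le> j \<Longrightarrow> k \<le> j \<Longrightarrow> j < m \<Longrightarrow> \<not> descent x j"
  shows "avoids (x \<circ> word_perm (rev [k..<Suc m]))"
  unfolding avoids_def
proof
  let ?M = "int (Suc m)" and ?p = "lo k"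
  let ?w = "x \<circ> word_perm (rev [k..<Suc m])"
  have w: "?w \<in> weylB (Suc m)"
    using x weylB_mono[of m "Suc m"] by (intro weylB_comp word_perm_weylB) auto
  have w_eq: "?w y = x (ins ?M ?p y)" for y using word_perm_down[OF k] by simp
  have p: "?p \<noteq> 0" "\<bar>?p\<bar> \<le> ?M" using k by (auto simp: lo_def)
  have xM: "x ?M = ?M" using weylB_fixes[OF x(1)] by simp
  have wp: "?w ?p = ?M" using xM unfolding w_eq by (simp add: ins_def)
  have inc: "?w y < ?w z" if "?p < y" "y < z" "y \<noteq> 0" for y z
  proof -
    have *: "x u < x v" if "int k \<le> u" "1 \<le> u" "u < v" for u v
      using increasing_above[OF x(1) nd that] .
    show ?thesis
    \<comment> \<open>For k = 0 the value M sits at position -1, so position 1 carries the smallest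
      value -M; this entry does not come from the increasing part of x.\<close>
    proof (cases "k = 0 \<and> y = 1")
      case True
      have "\<bar>?w z\<bar> \<le> ?M \<or> ?w z = z" using weylB_bound[OF w, of z] weylB_fixes[OF w, of z] by linarith
      moreover have "?w 1 = - ?M" using True weylB_uminus[OF x(1), of ?M] xM unfolding w_eq by (simp add: ins_def lo_def)
      ultimately show ?thesis using weylB_inj[OF w, of 1 z] that True by fastforce
    next
      case False
      then have "1 \<le> ins ?M ?p y" "int k \<le> ins ?M ?p y" "ins ?M ?p y < ins ?M ?p z"
        using that k by (auto simp: ins_def lo_def split: if_splits)
      then show ?thesis unfolding w_eq using * by blast
    qed
  qed
  have dec: "?w y < ?w z" if "y < z" "z < - ?p" "z \<noteq> 0" for y z
    using inc[of "- z" "- y"] that weylB_uminus[OF w] by simp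
  assume "\<exists>a b c. a \<noteq> 0 \<and> b \<noteq> 0 \<and> c \<noteq> 0 \<and> a < b \<and> b < c \<and> ?w b < ?w a \<and> ?w c < ?w b"
  then obtain a b c where abc: "a \<noteq> 0" "b \<noteq> 0" "c \<noteq> 0" "a < b" "b < c" "?w b < ?w a" "?w c < ?w b"
    by blast
  have bd: "\<bar>a\<bar> \<le> ?M \<and> \<bar>b\<bar> \<le> ?M" if "a < b" "?w b < ?w a" for a b
    using that weylB_bound[OF w, of a] weylB_bound[OF w, of b] weylB_fixes[OF w, of a] weylB_fixes[OF w, of b]
    by linarith
  have bds: "\<bar>a\<bar> \<le> ?M" "\<bar>b\<bar> \<le> ?M" "\<bar>c\<bar> \<le> ?M" using bd abc by blast+
  have wb: "\<bar>?w a\<bar> \<le> ?M" "\<bar>?w c\<bar> \<le> ?M" using bds weylB_bound[OF w] by blast+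
  have "a \<noteq> ?p" using inc[of b c] abc by auto
  moreover have "c \<noteq> - ?p" using dec[of a b] abc by auto
  moreover have "b \<noteq> ?p" "c \<noteq> ?p" "a \<noteq> - ?p" "b \<noteq> - ?p"
    using wp abc wb weylB_uminus[OF w, of ?p] by auto
  ultimately have mono: "ins ?M ?p a < ins ?M ?p b" "ins ?M ?p b < ins ?M ?p c"
     "ins ?M ?p a \<noteq> 0" "ins ?M ?p b \<noteq> 0" "ins ?M ?p c \<noteq> 0"
    using abc bds p ins_mono ins_nonzero by simp_all
  then show False using x(2) abc unfolding w_eq avoids_def by blast
qed

text \<open>Along the chain of cosets there are three sources of a triple: x has one already; or M
  is inserted at or before a descent j of x; or the coset word contains s_1 s_0 s_1. In the second
  case s_j splits off from x on the right, passes s_m, ..., s_(j+2) and meets s_(j+1) s_j.\<close>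

lemma not_avoids_braid_word:
  assumes "w \<in> weylB m" "m \<le> n" "\<not> avoids w"
  shows "\<exists>us i j vs. 1 \<le> i \<and> i < n \<and> j < n \<and> \<bar>int i - int j\<bar> = 1 \<and>
    reduced n (us @ [i, j, i] @ vs) \<and> word_perm (us @ [i, j, i] @ vs) = w"
  using assms
proof (induction m arbitrary: w)
  case 0
  have "w = id" using weylB_fixes[of w 0] weylB_zero[of w 0] 0(1) by (intro ext) (metis abs_of_nat
      id_apply of_nat_0 zero_less_abs_iff)
  then show ?case using 0 by (auto simp: avoids_def)
next
  case (Suc m)
  have red: "\<exists>us. reduced n (us @ u) \<and> word_perm us = x"
    if x: "x \<in> weylB m" and u: "ascends x u" "set u \<subseteq> {..<Suc m}" for x u
  proof -
    have "x \<in> weylB n" using x weylB_mono[of m n] Suc.prems by auto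
    then obtain us where us: "reduced n us" "word_perm us = x"
      using ex_reduced_expression by (auto simp: reduced_expression_reduced)
    moreover have "reduced n (us @ u)" using us u Suc.prems by (intro reduced_ascends) auto
    ultimately show ?thesis by blast
  qed
  have old: ?case if x: "x \<in> weylB m" "w = x \<circ> word_perm u" and u: "ascends x u" "set u \<subseteq> {..<Suc m}"
    and na: "\<not> avoids x" for x u
  proof -
    obtain us i j vs where b: "1 \<le> i" "i < n" "j < n" "\<bar>int i - int j\<bar> = 1"
      "reduced n (us @ [i, j, i] @ vs)" "word_perm (us @ [i, j, i] @ vs) = x"
      using Suc.IH[OF x(1) Suc_leD[OF Suc.prems(2)] na] by blast
    have "reduced n ((us @ [i, j, i] @ vs) @ u)"
      by (rule reduced_ascends[OF b(5)]) (use b(6) u Suc.prems in auto)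
    moreover have "word_perm ((us @ [i, j, i] @ vs) @ u) = w"
      using b(6) x(2) by (simp only: word_perm_append)
    ultimately show ?thesis using b(1-4) by (metis append.assoc)
  qed
  from Suc.prems(1) show ?case
  proof (cases rule: weylB_decomp)
    case (1 x k)
    let ?u = "rev [k..<Suc m]"
    have u: "ascends x ?u" "set ?u \<subseteq> {..<Suc m}" using ascends_down[OF 1(1,2)] by auto
    show ?thesis
    proof (cases "avoids x")
      case False
      then show ?thesis using old[OF 1(1,3) u] by blast
    next
      case True
      then obtain j where j: "1 \<le> j" "k \<le> j" "j < m" "descent x j"
        using avoids_insert[OF 1(1) True 1(2)] Suc.prems(3) 1(3) by blast
      obtain us where us: "reduced n (us @ ?u)" "word_perm us = x" using red[OF 1(1) u] by blast
      have xn: "x \<in> weylB n" using 1(1) weylB_mono[of m n] Suc.prems by auto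
      have jn: "j < n" using j Suc.prems by simp
      obtain vs where vs: "reduced n vs" "word_perm vs = x \<circ> s_gen j"
        using ex_reduced_expression[OF weylB_comp[OF xn s_gen_weylB[OF jn]]]
        by (auto simp: reduced_expression_reduced)
      have len: "length us = Suc (length vs)"
        using reduced_append(1)[OF us(1)] us(2) vs len_descent[OF xn jn j(4)] by (simp add: reduced_def)
      have split: "?u = rev [Suc (Suc j)..<Suc m] @ Suc j # j # rev [k..<j]"
      proof -
        have "[k..<Suc m] = [k..<j] @ [j..<Suc m]" using j upt_add_eq_append[of k j "Suc m - j"] by simp
        moreover have "[j..<Suc m] = j # Suc j # [Suc (Suc j)..<Suc m]"
          using j by (simp add: upt_conv_Cons)
        ultimately show ?thesis by simp
      qed
      let ?r = "rev [Suc (Suc j)..<Suc m]"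
      have comm: "word_perm (?r @ [j]) = word_perm ([j] @ ?r)"
      proof -
        have "word_perm (rs @ [j]) = word_perm ([j] @ rs)" if "\<forall>r \<in> set rs. j + 1 < r" for rs
          using that
        proof (induction rs)
          case (Cons r rs)
          then have "word_perm (rs @ [j]) = word_perm ([j] @ rs)" by (meson list.set_intros(2))
          then have "word_perm ((r # rs) @ [j]) = s_gen r \<circ> word_perm ([j] @ rs)"
            by (simp only: append_Cons word_perm_Cons)
          also have "\<dots> = (s_gen r \<circ> s_gen j) \<circ> word_perm rs"
            by (simp only: append_Cons word_perm_Cons append_Nil comp_assoc)
          also have "s_gen r \<circ> s_gen j = s_gen j \<circ> s_gen r" using s_gen_commute[of j r] Cons by simp
          finally show ?case by (simp only: append_Cons word_perm_Cons append_Nil comp_assoc)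
        qed simp
        then show ?thesis by auto
      qed
      let ?v = "(vs @ ?r) @ [j, Suc j, j] @ rev [k..<j]"
      have "word_perm ?v = (word_perm vs \<circ> word_perm (?r @ [j])) \<circ> word_perm (Suc j # j # rev [k..<j])"
        by (simp add: comp_assoc)
      also have "\<dots> = x \<circ> (s_gen j \<circ> s_gen j) \<circ> word_perm ?r \<circ> word_perm (Suc j # j # rev [k..<j])"
        unfolding comm vs(2) by (simp only: word_perm_append word_perm_Cons word_perm_Nil comp_id comp_assoc)
      also have "\<dots> = w"
        unfolding 1(3) split by (simp only: word_perm_append s_gen_comp_self comp_id comp_assoc)
      finally have v: "word_perm ?v = w" .
      have "length ?v = length (us @ ?u)" "set ?v \<subseteq> {..<n}"
        using len vs(1) j Suc.prems(2) unfolding split by (auto simp: reduced_def)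
      then have "reduced n ?v"
        using us v 1(3) by (simp add: reduced_def)
      then show ?thesis using v j Suc.prems(2)
        by (intro exI[of _ "vs @ ?r"] exI[of _ j] exI[of _ "Suc j"] exI[of _ "rev [k..<j]"]) auto
    qed
  next
    case (2 x k)
    let ?u = "rev [0..<Suc m] @ [1..<k]"
    have u: "ascends x ?u" "set ?u \<subseteq> {..<Suc m}" using ascends_up[of x m k] 2 by auto
    obtain us where us: "reduced n (us @ ?u)" "word_perm us = x" using red[OF 2(1) u] by blast
    have "[0..<Suc m] = [0, 1] @ [2..<Suc m]" using 2 by (simp add: upt_conv_Cons numeral_2_eq_2)
    moreover have "[1..<k] = 1 # [2..<k]" using 2 by (simp add: upt_conv_Cons numeral_2_eq_2)
    ultimately have split: "?u = rev [2..<Suc m] @ [1, 0, 1] @ [2..<k]" by simp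
    have "reduced n ((us @ rev [2..<Suc m]) @ [1, 0, 1] @ [2..<k])" using us unfolding split by simp
    moreover have "word_perm ((us @ rev [2..<Suc m]) @ [1, 0, 1] @ [2..<k]) = w"
    proof -
      have "word_perm (us @ ?u) = w" using us 2(4) by (simp only: word_perm_append)
      then show ?thesis unfolding split by (simp only: append.assoc)
    qed
    moreover have "1 < n" using 2 Suc.prems by simp
    ultimately show ?thesis by (intro exI[of _ "us @ rev [2..<Suc m]"] exI[of _ 1] exI[of _ 0] exI[of _ "[2..<k]"]) auto
  qed
qed

theorem weylB_b_iff: "w \<in> weylB_b n \<longleftrightarrow> w \<in> weylB n \<and> avoids w"
proof -
  have "avoids w \<longleftrightarrow> \<not> (\<exists>us vs i j. 1 \<le> i \<and> i < n \<and> j < n \<and> \<bar>int i - int j\<bar> = 1 \<and>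
          reduced_expression n (us @ [i, j, i] @ vs) w)" if "w \<in> weylB n"
    using not_avoids_braid_word[OF that order_refl] braid_word_not_avoids[of n]
    unfolding reduced_expression_reduced by metis
  then show ?thesis unfolding weylB_b_def by blast
qed

section \<open>Laurent polynomials\<close>

lemma vpow_add: "vpow j * vpow k = vpow (j + k)"
  by (simp add: vpow_def mult_single)

lemma vpow_0 [simp]: "vpow 0 = 1"
  by (simp add: vpow_def)

lemma vpow_add_cancel [simp]: "vpow j * (vpow k * p) = vpow (j + k) * p"
  by (simp add: vpow_add flip: mult.assoc)

section \<open>The bar involution of the coefficient ring\<close>

definition lbar :: "laurent \<Rightarrow> laurent" where
  "lbar = Poly_Mapping.map_key uminus"

lemma inj_uminus_int: "inj (uminus :: int \<Rightarrow> int)"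
  by (simp add: inj_def)

lemma lookup_lbar: "Poly_Mapping.lookup (lbar p) k = Poly_Mapping.lookup p (- k)"
  by (simp add: lbar_def map_key.rep_eq[OF inj_uminus_int])

lemma lbar_single: "lbar (Poly_Mapping.single k c) = Poly_Mapping.single (- k) c"
  by (rule poly_mapping_eqI) (auto simp: lookup_lbar lookup_single when_def)

lemma lbar_vpow [simp]: "lbar (vpow k) = vpow (- k)"
  by (simp add: vpow_def lbar_single)

lemma lbar_0 [simp]: "lbar 0 = 0"
  by (rule poly_mapping_eqI) (simp add: lookup_lbar)

lemma lbar_1 [simp]: "lbar 1 = 1"
  using lbar_vpow[of 0] by simp

lemma lbar_add [simp]: "lbar (p + q) = lbar p + lbar q"
  by (rule poly_mapping_eqI) (simp add: lookup_lbar lookup_add)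

lemma lbar_uminus [simp]: "lbar (- p) = - lbar p"
  by (rule poly_mapping_eqI) (simp add: lookup_lbar)

lemma lbar_diff [simp]: "lbar (p - q) = lbar p - lbar q"
  by (simp only: diff_conv_add_uminus lbar_add lbar_uminus)

lemma lbar_lbar [simp]: "lbar (lbar p) = p"
  by (rule poly_mapping_eqI) (simp add: lookup_lbar)

lemma poly_mapping_single_induct [case_names zero single add]:
  assumes "P 0" "\<And>k c. P (Poly_Mapping.single k c)" "\<And>p q. P p \<Longrightarrow> P q \<Longrightarrow> P (p + q)"
  shows "P (p :: 'k \<Rightarrow>\<^sub>0 'c :: monoid_add)"
proof (induction p rule: update_induct)
  case const
  show ?case by (rule assms(1))
next
  case (update f a b)
  have "Poly_Mapping.update a b f = f + Poly_Mapping.single a b"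
    using update(1) by (intro poly_mapping_eqI)
      (auto simp: lookup_update lookup_add lookup_single when_def in_keys_iff)
  then show ?case using assms update by simp
qed

lemma lbar_mult [simp]: "lbar (p * q) = lbar p * lbar q"
proof (induction p rule: poly_mapping_single_induct)
  case (single k c)
  show ?case
    by (induction q rule: poly_mapping_single_induct) (simp_all add: mult_single lbar_single distrib_left)
qed (simp_all add: distrib_right)

lemma laurent_induct [case_names vpow minus add]:
  assumes "\<And>k. P (vpow k)" "\<And>p. P p \<Longrightarrow> P (- p)" "\<And>p q. P p \<Longrightarrow> P q \<Longrightarrow> P (p + q)"
  shows "P (p :: laurent)"
proof -
  have P0: "P 0" using assms(3)[OF assms(1)[of 0] assms(2)[OF assms(1)[of 0]]] by simp
  have nat: "P (Poly_Mapping.single k (int c))" for k c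
  proof (induction c)
    case (Suc c)
    have "Poly_Mapping.single k (int (Suc c)) = Poly_Mapping.single k (int c) + vpow k"
      by (simp add: vpow_def flip: single_add) (simp add: add.commute)
    then show ?case using assms(3)[OF Suc assms(1)] by simp
  qed (simp add: P0)
  have "P (Poly_Mapping.single k c)" for k c
    by (cases c rule: int_cases2) (use nat assms(2)[OF nat] in \<open>simp_all add: single_uminus\<close>)
  then show ?thesis using assms P0 by (induction p rule: poly_mapping_single_induct) auto
qed

section \<open>The coefficient domains Z[v] and v Z[v]\<close>

definition lnn :: "laurent set" where "lnn = {p. Poly_Mapping.keys p \<subseteq> {0..}}"
definition lpos :: "laurent set" where "lpos = {p. Poly_Mapping.keys p \<subseteq> {0<..}}"

lemma lnn_vpow: "0 \<le> k \<Longrightarrow> vpow k \<in> lnn"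
  by (simp add: lnn_def vpow_def)

lemma lnn_1: "1 \<in> lnn" using lnn_vpow[of 0] by simp

lemma lnn_add: "p \<in> lnn \<Longrightarrow> q \<in> lnn \<Longrightarrow> p + q \<in> lnn"
  using Poly_Mapping.keys_add[of p q] by (auto simp: lnn_def)

lemma lnn_uminus: "p \<in> lnn \<Longrightarrow> - p \<in> lnn"
  by (simp add: lnn_def)

lemma lnn_mult: "p \<in> lnn \<Longrightarrow> q \<in> lnn \<Longrightarrow> p * q \<in> lnn"
  using keys_mult[of p q] by (fastforce simp: lnn_def)

lemma lookup_vpow_mult: "Poly_Mapping.lookup (vpow k * p) j = Poly_Mapping.lookup p (j - k)"
proof (induction p rule: poly_mapping_single_induct)
  case (single l c)
  then show ?case by (auto simp: vpow_def mult_single lookup_single when_def)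
qed (simp_all add: distrib_left lookup_add)

lemma lpos_iff: "p \<in> lpos \<longleftrightarrow> (\<exists>q \<in> lnn. p = vpow 1 * q)"
proof
  assume p: "p \<in> lpos"
  have "vpow (- 1) * p \<in> lnn"
    using p by (force simp: lnn_def lpos_def in_keys_iff lookup_vpow_mult subset_iff)
  moreover have "p = vpow 1 * (vpow (- 1) * p)" by simp
  ultimately show "\<exists>q \<in> lnn. p = vpow 1 * q" by blast
next
  assume "\<exists>q \<in> lnn. p = vpow 1 * q"
  then show "p \<in> lpos" by (force simp: lnn_def lpos_def in_keys_iff lookup_vpow_mult subset_iff)
qed

lemma lpos_0: "0 \<in> lpos" by (simp add: lpos_def)

lemma lpos_add: "p \<in> lpos \<Longrightarrow> q \<in> lpos \<Longrightarrow> p + q \<in> lpos"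
  using Poly_Mapping.keys_add[of p q] by (auto simp: lpos_def)

lemma lpos_mult: "p \<in> lnn \<Longrightarrow> q \<in> lpos \<Longrightarrow> p * q \<in> lpos"
  unfolding lpos_iff by (metis lnn_mult mult.left_commute)

lemma lpos_lnn: "lpos \<subseteq> lnn"
  by (auto simp: lpos_def lnn_def)

lemma lpos_bar_invariant: assumes "p \<in> lpos" "lbar p = p" shows "p = 0"
proof (rule ccontr)
  assume "p \<noteq> 0"
  then obtain k where k: "k \<in> Poly_Mapping.keys p" by fastforce
  then have "- k \<in> Poly_Mapping.keys p"
    using lookup_lbar[of p "- k"] assms(2) by (simp add: in_keys_iff)
  then have "0 < k" "0 < - k" using k assms(1) unfolding lpos_def by auto
  then show False by simp
qed

text \<open>\<open>h\<close> is the part of \<open>g\<close> in positive degrees; the constant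
  coefficient vanishes because it equals its own negative.\<close>

lemma lbar_anti_invariant:
  assumes "lbar g = - g" obtains h where "h \<in> lpos" "g = h - lbar h"
proof
  define h where "h = Poly_Mapping.mapp (\<lambda>k c. c when 0 < k) g"
  have h: "Poly_Mapping.lookup h k = (Poly_Mapping.lookup g k when 0 < k)" for k
    by (auto simp: h_def lookup_mapp when_def in_keys_iff)
  show "h \<in> lpos" by (auto simp: lpos_def in_keys_iff h when_def split: if_splits)
  have anti: "Poly_Mapping.lookup g (- k) = - Poly_Mapping.lookup g k" for k
    using lookup_lbar[of g k] assms by simp
  have "Poly_Mapping.lookup g 0 = 0" using anti[of 0] by simp
  with anti show "g = h - lbar h"
    by (intro poly_mapping_eqI) (auto simp: lookup_minus lookup_lbar h when_def not_less_iff_gr_or_eq)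
qed

lemma vpow_clears: "\<exists>k \<ge> 0. vpow k * p \<in> lnn"
proof (induction p rule: laurent_induct)
  case (vpow k)
  show ?case by (rule exI[of _ "\<bar>k\<bar>"]) (auto simp: vpow_add intro: lnn_vpow)
next
  case (add p q)
  then obtain j k where "j \<ge> 0" "vpow j * p \<in> lnn" "k \<ge> 0" "vpow k * q \<in> lnn" by blast
  moreover have "vpow (j + k) * (p + q) = vpow k * (vpow j * p) + vpow j * (vpow k * q)"
    by (simp add: distrib_left add.commute)
  ultimately show ?case
    by (intro exI[of _ "j + k"]) (metis add_nonneg_nonneg lnn_add lnn_mult lnn_vpow)
qed (auto intro: lnn_uminus)

lemma sum_in:
  assumes "finite Y" "\<And>y. y \<in> Y \<Longrightarrow> f y \<in> X" "0 \<in> X" "\<And>x y. x \<in> X \<Longrightarrow> y \<in> X \<Longrightarrow> x + y \<in> X"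
  shows "(\<Sum>y \<in> Y. f y) \<in> X"
  using assms by (induction Y rule: finite_induct) auto

section \<open>Rings satisfying the relations of the Hecke algebra\<close>

text \<open>A ring in which the defining relations hold, with \<open>sc\<close> central but not
  assumed injective and the standard elements not assumed independent. The results therefore apply
  to the Hecke algebra and to its quotient alike.\<close>

locale hecke_alg =
  fixes a b :: int and n :: nat and sc :: "laurent \<Rightarrow> 'r :: ring_1" and T :: "nat \<Rightarrow> 'r"
  assumes sc_add: "sc (p + q) = sc p + sc q"
    and sc_mult: "sc (p * q) = sc p * sc q"
    and sc_1 [simp]: "sc 1 = 1"
    and sc_comm: "x * sc p = sc p * x"
    and braid3: "1 \<le> i \<Longrightarrow> Suc i < n \<Longrightarrow> T i * T (Suc i) * T i = T (Suc i) * T i * T (Suc i)"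
    and braid4: "2 \<le> n \<Longrightarrow> T 0 * T 1 * T 0 * T 1 = T 1 * T 0 * T 1 * T 0"
    and comm: "i + 1 < j \<Longrightarrow> j < n \<Longrightarrow> T i * T j = T j * T i"
    and quad: "i < n \<Longrightarrow> T i * T i = 1 + sc (vpow (param a b i) - vpow (- param a b i)) * T i"
begin

abbreviation W where "W \<equiv> weylB n"

lemma sc_0 [simp]: "sc 0 = 0"
  using sc_add[of 0 0] by simp

lemma sc_uminus: "sc (- p) = - sc p"
  using sc_add[of p "- p"] by (simp add: eq_neg_iff_add_eq_0 add.commute)

lemma sc_diff: "sc (p - q) = sc p - sc q"
  using sc_add[of p "- q"] by (simp add: sc_uminus)

lemma sc_comm': "x * (sc p * y) = sc p * (x * y)"
  by (simp add: sc_comm flip: mult.assoc)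

definition Tword :: "nat list \<Rightarrow> 'r" where "Tword is = prod_list (map T is)"

lemma Tword_simps [simp]: "Tword [] = 1" "Tword (i # is) = T i * Tword is"
  "Tword (us @ vs) = Tword us * Tword vs"
  by (simp_all add: Tword_def)

text \<open>The word is chosen exactly as in \<open>T_std\<close>, which makes the translation
  between the two immediate.\<close>

definition Tw :: "(int \<Rightarrow> int) \<Rightarrow> 'r" where
  "Tw w = Tword (SOME is. reduced_expression n is w)"

lemma Tword_reduced: assumes "reduced n is" shows "Tword is = Tw (word_perm is)"
proof -
  have "reduced_expression n is (word_perm is)" using assms by (simp add: reduced_expression_reduced)
  then have "reduced_expression n (SOME is'. reduced_expression n is' (word_perm is)) (word_perm is)"
    by (rule someI)
  then show ?thesis unfolding Tw_def Tword_def
    by (intro matsumoto[OF braid3 braid4 comm assms]) (simp_all add: reduced_expression_reduced)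
qed

lemma Tw_id [simp]: "Tw id = 1"
  using Tword_reduced[of "[]"] by (simp add: reduced_def)

lemma reduced_word:
  assumes "w \<in> W" obtains us where "reduced n us" "word_perm us = w" "Tword us = Tw w" "length us = len n w"
  using ex_reduced_expression[OF assms] Tword_reduced by (auto simp: reduced_expression_reduced reduced_def)

lemma Tw_ascends:
  assumes "w \<in> W" "set is \<subseteq> {..<n}" "ascends w is"
  shows "Tw w * Tword is = Tw (w \<circ> word_perm is)"
proof -
  obtain us where us: "reduced n us" "word_perm us = w" "Tword us = Tw w" "length us = len n w"
    using reduced_word[OF assms(1)] .
  have "reduced n (us @ is)" using reduced_ascends us assms by blast
  from Tword_reduced[OF this] us show ?thesis by simp
qed

lemma Tw_ascent: "w \<in> W \<Longrightarrow> i < n \<Longrightarrow> \<not> descent w i \<Longrightarrow> Tw w * T i = Tw (w \<circ> s_gen i)"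
  using Tw_ascends[of w "[i]"] by simp

lemma Tw_descent_split:
  assumes "w \<in> W" "i < n" "descent w i" shows "Tw w = Tw (w \<circ> s_gen i) * T i"
proof -
  have "Tw (w \<circ> s_gen i) * T i = Tw ((w \<circ> s_gen i) \<circ> s_gen i)"
    using assms descent_s_gen[OF assms(1), of i]
    by (intro Tw_ascent weylB_comp s_gen_weylB) auto
  then show ?thesis by (simp only: comp_assoc s_gen_comp_self comp_id)
qed

abbreviation qd :: "nat \<Rightarrow> laurent" where
  "qd i \<equiv> vpow (param a b i) - vpow (- param a b i)"

lemma Tw_descent:
  assumes "w \<in> W" "i < n" "descent w i" shows "Tw w * T i = Tw (w \<circ> s_gen i) + sc (qd i) * Tw w"
proof -
  have "Tw w * T i = Tw (w \<circ> s_gen i) * (T i * T i)"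
    by (subst Tw_descent_split[OF assms]) (simp add: mult.assoc)
  also have "\<dots> = Tw (w \<circ> s_gen i) + sc (qd i) * (Tw (w \<circ> s_gen i) * T i)"
    by (simp add: quad[OF assms(2)] distrib_left sc_comm')
  finally show ?thesis by (simp only: Tw_descent_split[OF assms, symmetric])
qed

subsection \<open>Linear combinations of the standard basis\<close>

definition comb :: "((int \<Rightarrow> int) \<Rightarrow> laurent) \<Rightarrow> 'r" where
  "comb c = (\<Sum>w \<in> W. sc (c w) * Tw w)"

text \<open>S is the domain of the coefficients and P restricts the support. Coefficients need not
  be unique: in the quotient the \<open>Tw\<close> become dependent as soon as some element has a
  decreasing triple.\<close>

definition lspan :: "laurent set \<Rightarrow> ((int \<Rightarrow> int) \<Rightarrow> bool) \<Rightarrow> 'r set" where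
  "lspan S P = {comb c | c. \<forall>w \<in> W. c w \<in> S \<and> (\<not> P w \<longrightarrow> c w = 0)}"

lemma comb_add: "comb c + comb d = comb (\<lambda>w. c w + d w)"
  by (simp add: comb_def sc_add distrib_right sum.distrib)

lemma comb_scale: "sc p * comb c = comb (\<lambda>w. p * c w)"
  by (simp add: comb_def sc_mult sum_distrib_left mult.assoc)

lemma comb_diff: "comb c - comb d = comb (\<lambda>w. c w - d w)"
  by (simp add: comb_def sc_diff left_diff_distrib sum_subtractf)

lemma sc_if_mult: "sc (if B then p else 0) * x = (if B then sc p * x else 0)"
  by simp

lemma comb_single: "w \<in> W \<Longrightarrow> comb (\<lambda>z. if z = w then p else 0) = sc p * Tw w"
  by (simp add: comb_def sc_if_mult finite_weylB)

lemma lspan_add: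
  assumes "\<And>p q. p \<in> S \<Longrightarrow> q \<in> S \<Longrightarrow> p + q \<in> S" and x: "x \<in> lspan S P" and y: "y \<in> lspan S P"
  shows "x + y \<in> lspan S P"
proof -
  obtain c where c: "x = comb c" "\<forall>w \<in> W. c w \<in> S \<and> (\<not> P w \<longrightarrow> c w = 0)"
    using x unfolding lspan_def by blast
  obtain d where d: "y = comb d" "\<forall>w \<in> W. d w \<in> S \<and> (\<not> P w \<longrightarrow> d w = 0)"
    using y unfolding lspan_def by blast
  show ?thesis unfolding lspan_def mem_Collect_eq
    by (rule exI[of _ "\<lambda>w. c w + d w"]) (use c d assms(1) in \<open>auto simp: comb_add\<close>)
qed

lemma lspan_scale:
  assumes "\<And>q. q \<in> S \<Longrightarrow> p * q \<in> S'" and x: "x \<in> lspan S P"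
  shows "sc p * x \<in> lspan S' P"
proof -
  obtain c where c: "x = comb c" "\<forall>w \<in> W. c w \<in> S \<and> (\<not> P w \<longrightarrow> c w = 0)"
    using x unfolding lspan_def by blast
  show ?thesis unfolding lspan_def mem_Collect_eq
    by (rule exI[of _ "\<lambda>w. p * c w"]) (use c assms(1) in \<open>auto simp: comb_scale\<close>)
qed

lemma lspan_0: "0 \<in> S \<Longrightarrow> 0 \<in> lspan S P"
  unfolding lspan_def mem_Collect_eq by (rule exI[of _ "\<lambda>_. 0"]) (simp add: comb_def)

lemma lspan_scaled_Tw: "0 \<in> S \<Longrightarrow> p \<in> S \<Longrightarrow> w \<in> W \<Longrightarrow> P w \<Longrightarrow> sc p * Tw w \<in> lspan S P"
  unfolding lspan_def mem_Collect_eq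
  by (rule exI[of _ "\<lambda>z. if z = w then p else 0"]) (simp add: comb_single)

lemma lspan_Tw: "0 \<in> S \<Longrightarrow> 1 \<in> S \<Longrightarrow> w \<in> W \<Longrightarrow> P w \<Longrightarrow> Tw w \<in> lspan S P"
  using lspan_scaled_Tw[of S 1 w P] by simp

lemma lspan_mono: "S \<subseteq> S' \<Longrightarrow> (\<And>w. w \<in> W \<Longrightarrow> P w \<Longrightarrow> P' w) \<Longrightarrow> lspan S P \<subseteq> lspan S' P'"
  unfolding lspan_def by blast

lemma lspan_subset:
  assumes x: "x \<in> lspan S P" and 0: "0 \<in> X" and add: "\<And>x y. x \<in> X \<Longrightarrow> y \<in> X \<Longrightarrow> x + y \<in> X"
    and Tw: "\<And>w p. w \<in> W \<Longrightarrow> P w \<Longrightarrow> p \<in> S \<Longrightarrow> sc p * Tw w \<in> X"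
  shows "x \<in> X"
proof -
  obtain c where c: "x = comb c" "\<forall>w \<in> W. c w \<in> S \<and> (\<not> P w \<longrightarrow> c w = 0)"
    using x unfolding lspan_def by blast
  have "(\<Sum>w \<in> V. sc (c w) * Tw w) \<in> X" if "finite V" "V \<subseteq> W" for V
    using that
  proof (induction V)
    case (insert w V)
    have "sc (c w) * Tw w \<in> X" using insert c(2) 0 Tw by (cases "P w") auto
    then show ?case using insert by (simp add: add)
  qed (simp add: 0)
  then show ?thesis unfolding c(1) comb_def using finite_weylB by blast
qed

abbreviation aspan where "aspan \<equiv> lspan UNIV"

lemma aspan_add: "x \<in> aspan P \<Longrightarrow> y \<in> aspan P \<Longrightarrow> x + y \<in> aspan P"
  by (rule lspan_add) auto

lemma aspan_scale: "x \<in> aspan P \<Longrightarrow> sc p * x \<in> aspan P"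
  by (rule lspan_scale) auto

lemma aspan_uminus: "x \<in> aspan P \<Longrightarrow> - x \<in> aspan P"
  using aspan_scale[of x P "- 1"] by (simp add: sc_uminus)

lemma aspan_diff: "x \<in> aspan P \<Longrightarrow> y \<in> aspan P \<Longrightarrow> x - y \<in> aspan P"
  using aspan_add[of x P "- y"] aspan_uminus[of y P] by simp

lemma aspan_0: "0 \<in> aspan P"
  by (rule lspan_0) simp

lemma aspan_Tw: "w \<in> W \<Longrightarrow> P w \<Longrightarrow> Tw w \<in> aspan P"
  by (rule lspan_Tw) auto

lemma aspan_induct:
  assumes "x \<in> aspan P" "0 \<in> X" "\<And>x y. x \<in> X \<Longrightarrow> y \<in> X \<Longrightarrow> x + y \<in> X"
    "\<And>x p. x \<in> X \<Longrightarrow> sc p * x \<in> X" "\<And>w. w \<in> W \<Longrightarrow> P w \<Longrightarrow> Tw w \<in> X"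
  shows "x \<in> X"
  using assms by (intro lspan_subset[OF assms(1)]) auto

lemma aspan_mono: "x \<in> aspan P \<Longrightarrow> (\<And>w. w \<in> W \<Longrightarrow> P w \<Longrightarrow> P' w) \<Longrightarrow> x \<in> aspan P'"
  using lspan_mono[of UNIV UNIV P P'] by blast

lemma aspan_le_mult_T:
  assumes "x \<in> aspan (\<lambda>w. len n w \<le> k)" "i < n"
  shows "x * T i \<in> aspan (\<lambda>w. len n w \<le> Suc k)"
proof -
  have "x \<in> {x. x * T i \<in> aspan (\<lambda>w. len n w \<le> Suc k)}"
    using assms(1)
  proof (rule aspan_induct)
    fix w assume w: "w \<in> W" "len n w \<le> k"
    have ws: "w \<circ> s_gen i \<in> W" using w assms(2) by (intro weylB_comp s_gen_weylB)
    have "len n (w \<circ> s_gen i) \<le> Suc k"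
      using len_ascent[OF w(1) assms(2)] len_descent[OF w(1) assms(2)] w(2) by (cases "descent w i") auto
    then have "Tw (w \<circ> s_gen i) \<in> aspan (\<lambda>w. len n w \<le> Suc k)" "Tw w \<in> aspan (\<lambda>w. len n w \<le> Suc k)"
      using w ws by (auto intro: aspan_Tw)
    then show "Tw w \<in> {x. x * T i \<in> aspan (\<lambda>w. len n w \<le> Suc k)}"
      using Tw_ascent[OF w(1) assms(2)] Tw_descent[OF w(1) assms(2)]
      by (cases "descent w i") (auto intro: aspan_add aspan_scale)
  qed (auto simp: distrib_right mult.assoc intro: aspan_add aspan_scale aspan_0)
  then show ?thesis by simp
qed

lemma Tword_aspan: "set is \<subseteq> {..<n} \<Longrightarrow> Tword is \<in> aspan (\<lambda>w. len n w \<le> length is)"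
proof (induction "is" rule: rev_induct)
  case Nil
  then show ?case using aspan_Tw[OF id_weylB] by fastforce
next
  case (snoc i "is")
  then show ?case using aspan_le_mult_T[of "Tword is" "length is" i] by simp
qed

subsection \<open>Unitriangular families\<close>

definition independent :: "((int \<Rightarrow> int) \<Rightarrow> bool) \<Rightarrow> bool" where
  "independent P \<longleftrightarrow> (\<forall>c. comb c = 0 \<longrightarrow> (\<forall>w \<in> W. \<not> P w \<longrightarrow> c w = 0) \<longrightarrow> (\<forall>w \<in> W. c w = 0))"

lemma aspan_lower_coeff:
  assumes "x \<in> aspan (\<lambda>z. P z \<and> len n z < k)"
  obtains c where "x = comb c" "\<And>w. w \<in> W \<Longrightarrow> \<not> (P w \<and> len n w < k) \<Longrightarrow> c w = 0"
  using assms unfolding lspan_def by blast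

lemma aspan_sum: "finite Y \<Longrightarrow> (\<And>y. y \<in> Y \<Longrightarrow> f y \<in> aspan P) \<Longrightarrow> (\<Sum>y \<in> Y. f y) \<in> aspan P"
  by (rule sum_in) (auto intro: aspan_0 aspan_add)

text \<open>Among the y with \<open>g y\<close> nonzero take one, u, of maximal length. All lower
  terms have smaller length, so the coefficient of T_u in the sum is \<open>g u\<close>.\<close>

lemma triangular_independent:
  assumes ind: "independent P" and Y: "Y \<subseteq> W" "\<And>y. y \<in> Y \<Longrightarrow> P y"
    and C: "\<And>y. y \<in> Y \<Longrightarrow> C y - Tw y \<in> aspan (\<lambda>z. P z \<and> len n z < len n y)"
    and sum: "(\<Sum>y \<in> Y. sc (g y) * C y) = 0" and y: "y \<in> Y"
  shows "g y = 0"
proof (rule ccontr)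
  assume "g y \<noteq> 0"
  have fin: "finite Y" using finite_subset[OF Y(1) finite_weylB] .
  define Z where "Z = {y \<in> Y. g y \<noteq> 0}"
  have Z: "finite Z" "y \<in> Z" "Z \<subseteq> W" using fin y \<open>g y \<noteq> 0\<close> Y by (auto simp: Z_def)
  define k where "k = Max (len n ` Z)"
  have "Max (len n ` Z) \<in> len n ` Z" using Z by (intro Max_in) auto
  then obtain u where u: "u \<in> Z" "len n u = k" by (auto simp: k_def)
  have le: "len n z \<le> k" if "z \<in> Z" for z unfolding k_def using Z that by (intro Max_ge) auto
  have "(\<Sum>y \<in> Z. sc (g y) * (C y - Tw y)) \<in> aspan (\<lambda>z. P z \<and> len n z < k)"
  proof (rule aspan_sum[OF Z(1)])
    fix z assume z: "z \<in> Z"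
    then have "C z - Tw z \<in> aspan (\<lambda>z. P z \<and> len n z < k)"
      using C[of z] le[of z] by (intro aspan_mono[OF C]) (auto simp: Z_def)
    then show "sc (g z) * (C z - Tw z) \<in> aspan (\<lambda>z. P z \<and> len n z < k)" by (rule aspan_scale)
  qed
  then obtain c where c: "(\<Sum>y \<in> Z. sc (g y) * (C y - Tw y)) = comb c"
    "\<And>w. w \<in> W \<Longrightarrow> \<not> (P w \<and> len n w < k) \<Longrightarrow> c w = 0" using aspan_lower_coeff by blast
  define d where "d w = (if w \<in> Z then g w else 0)" for w
  have "comb d = (\<Sum>w \<in> Z. sc (g w) * Tw w)"
    unfolding comb_def d_def using Z(1,3)
    by (simp add: sc_if_mult sum.If_cases[OF finite_weylB] Int_absorb1)
  then have "comb d + comb c = (\<Sum>y \<in> Z. sc (g y) * C y)"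
    unfolding c(1)[symmetric] by (simp add: right_diff_distrib sum_subtractf)
  also have "\<dots> = (\<Sum>y \<in> Y. sc (g y) * C y)"
    by (rule sum.mono_neutral_left) (use fin in \<open>auto simp: Z_def\<close>)
  finally have "comb (\<lambda>w. d w + c w) = 0" by (simp add: comb_add sum)
  moreover have "\<forall>w \<in> W. \<not> P w \<longrightarrow> d w + c w = 0" using c(2) Y by (auto simp: d_def Z_def)
  ultimately have "d u + c u = 0" using ind u Z unfolding independent_def by blast
  moreover have "c u = 0" using c(2) u Z by auto
  ultimately show False using u by (simp add: d_def Z_def)
qed

end

text \<open>The prescribed value at \<open>T i\<close> is the inverse of \<open>T i\<close>, written
  without inversion by means of the quadratic relation.\<close>

locale hecke_bar = hecke_alg a b n sc T for a b n and sc :: "laurent \<Rightarrow> 'r :: ring_1" and T +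
  fixes bar :: "'r \<Rightarrow> 'r"
  assumes bar_add: "bar (x + y) = bar x + bar y"
    and bar_mult: "bar (x * y) = bar x * bar y"
    and bar_sc: "bar (sc p) = sc (lbar p)"
    and bar_T: "i < n \<Longrightarrow> bar (T i) = T i - sc (vpow (param a b i) - vpow (- param a b i))"
begin

lemma bar_0: "bar 0 = 0"
  using bar_add[of 0 0] by simp

lemma bar_1: "bar 1 = 1"
  using bar_sc[of 1] by simp

lemma bar_uminus: "bar (- x) = - bar x"
  using bar_add[of x "- x"] by (simp add: bar_0 eq_neg_iff_add_eq_0 add.commute)

lemma bar_diff: "bar (x - y) = bar x - bar y"
  using bar_add[of x "- y"] by (simp add: bar_uminus)

lemma bar_sum: "bar (\<Sum>y \<in> Y. f y) = (\<Sum>y \<in> Y. bar (f y))"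
  by (induction Y rule: infinite_finite_induct) (simp_all add: bar_0 bar_add)

lemma bar_Tword:
  "set is \<subseteq> {..<n} \<Longrightarrow> bar (Tword is) - Tword is \<in> aspan (\<lambda>w. len n w < length is)"
proof (induction "is" rule: rev_induct)
  case Nil
  then show ?case by (simp add: bar_1 aspan_0)
next
  case (snoc i "is")
  let ?P = "\<lambda>w. len n w < Suc (length is)"
  have s: "set is \<subseteq> {..<n}" "i < n" using snoc.prems by auto
  define y where "y = bar (Tword is) - Tword is"
  have y: "y \<in> aspan (\<lambda>w. len n w < length is)" unfolding y_def using snoc.IH[OF s(1)] .
  have yT: "y * T i \<in> aspan ?P"
  proof (cases "length is")
    case 0
    then have "y = 0" using y by (auto simp: lspan_def comb_def)
    then show ?thesis by (simp add: aspan_0)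
  next
    case (Suc l)
    then show ?thesis using aspan_le_mult_T[of y l i] y s(2) by (simp add: less_Suc_eq_le)
  qed
  have t: "Tword is \<in> aspan ?P" using Tword_aspan[OF s(1)] by (simp add: less_Suc_eq_le)
  have "y \<in> aspan ?P" using y by (rule aspan_mono) simp
  then have "y * T i - sc (qd i) * y - sc (qd i) * Tword is \<in> aspan ?P"
    using yT t by (intro aspan_diff aspan_scale)
  moreover have "bar (Tword (is @ [i])) - Tword (is @ [i]) = y * T i - sc (qd i) * y - sc (qd i) * Tword is"
    using bar_T[OF s(2)] by (simp add: bar_mult bar_1 y_def left_diff_distrib right_diff_distrib sc_comm)
  ultimately show ?case by simp
qed

lemma bar_Tw: "w \<in> W \<Longrightarrow> bar (Tw w) - Tw w \<in> aspan (\<lambda>z. len n z < len n w)"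
proof -
  assume "w \<in> W"
  then obtain us where us: "reduced n us" "Tword us = Tw w" "length us = len n w"
    using reduced_word by blast
  then show ?thesis using bar_Tword[of us] by (simp add: reduced_def)
qed

text \<open>At an element of maximal length in the support the coefficient equals its own bar image
  and lies in v Z[v], so it is 0. With P always true this gives the uniqueness of C_w in the Hecke
  algebra, with P = \<open>avoids\<close> the vanishing of an image of C_w in the quotient.\<close>

lemma bar_invariant_lpos:
  assumes ind: "independent P"
    and tri: "\<And>y. y \<in> W \<Longrightarrow> P y \<Longrightarrow> bar (Tw y) - Tw y \<in> aspan (\<lambda>z. P z \<and> len n z < len n y)"
    and x: "x \<in> lspan lpos P" "bar x = x"
  shows "x = 0"
proof -
  obtain c where c: "x = comb c" "\<And>w. w \<in> W \<Longrightarrow> c w \<in> lpos" "\<And>w. w \<in> W \<Longrightarrow> \<not> P w \<Longrightarrow> c w = 0"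
    using x(1) unfolding lspan_def by blast
  have "c w = 0" if w: "w \<in> W" for w
  proof (rule ccontr)
    assume "c w \<noteq> 0"
    define Z where "Z = {y \<in> W. c y \<noteq> 0}"
    have Z: "finite Z" "w \<in> Z" "Z \<subseteq> W" using finite_weylB[of n] w \<open>c w \<noteq> 0\<close> by (auto simp: Z_def)
    define k where "k = Max (len n ` Z)"
    have "Max (len n ` Z) \<in> len n ` Z" using Z by (intro Max_in) auto
    then obtain u where u: "u \<in> Z" "len n u = k" by (auto simp: k_def)
    have le: "len n z \<le> k" if "z \<in> Z" for z unfolding k_def using Z that by (intro Max_ge) auto
    have "(\<Sum>y \<in> Z. sc (lbar (c y)) * (bar (Tw y) - Tw y)) \<in> aspan (\<lambda>z. P z \<and> len n z < k)"
    proof (rule aspan_sum[OF Z(1)])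
      fix z assume z: "z \<in> Z"
      then have "bar (Tw z) - Tw z \<in> aspan (\<lambda>z. P z \<and> len n z < len n z)
         \<or> bar (Tw z) - Tw z \<in> aspan (\<lambda>y. P y \<and> len n y < len n z)"
        using tri[of z] c(3)[of z] by (auto simp: Z_def)
      then have "bar (Tw z) - Tw z \<in> aspan (\<lambda>y. P y \<and> len n y < len n z)"
        using aspan_mono by (elim disjE) auto
      then have "bar (Tw z) - Tw z \<in> aspan (\<lambda>y. P y \<and> len n y < k)"
        by (rule aspan_mono) (use le[OF z] in auto)
      then show "sc (lbar (c z)) * (bar (Tw z) - Tw z) \<in> aspan (\<lambda>z. P z \<and> len n z < k)" by (rule aspan_scale)
    qed
    then obtain d where d: "(\<Sum>y \<in> Z. sc (lbar (c y)) * (bar (Tw y) - Tw y)) = comb d"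
      "\<And>w. w \<in> W \<Longrightarrow> \<not> (P w \<and> len n w < k) \<Longrightarrow> d w = 0" using aspan_lower_coeff by blast
    have "x = (\<Sum>y \<in> Z. sc (c y) * Tw y)" unfolding c(1) comb_def
      by (rule sum.mono_neutral_right) (auto simp: Z_def finite_weylB)
    then have "bar x = (\<Sum>y \<in> Z. sc (lbar (c y)) * (bar (Tw y) - Tw y)) + (\<Sum>y \<in> Z. sc (lbar (c y)) * Tw y)"
      by (simp add: bar_sum bar_mult bar_sc right_diff_distrib sum_subtractf)
    also have "(\<Sum>y \<in> Z. sc (lbar (c y)) * Tw y) = comb (\<lambda>y. lbar (c y))" unfolding comb_def
      by (rule sum.mono_neutral_left) (auto simp: Z_def finite_weylB)
    finally have "comb (\<lambda>y. d y + lbar (c y) - c y) = 0"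
      using x(2) unfolding d(1) by (simp add: c(1) flip: comb_add comb_diff)
    moreover have "\<forall>y \<in> W. \<not> P y \<longrightarrow> d y + lbar (c y) - c y = 0" using d(2) c(3) by auto
    ultimately have "d u + lbar (c u) - c u = 0" using ind u Z unfolding independent_def by blast
    moreover have "d u = 0" using d(2) u Z by auto
    ultimately have "lbar (c u) = c u" by simp
    then have "c u = 0" using lpos_bar_invariant c(2) u Z by blast
    then show False using u by (simp add: Z_def)
  qed
  then show ?thesis unfolding c(1) by (simp add: comb_def)
qed

text \<open>The difference of bar(T_w) and T_w is a combination of the C_y of shorter y with
  coefficients g_y. Applying bar once more and comparing coefficients gives bar(g_y) = -g_y; with
  g_y = h_y - bar(h_y) the element T_w + sum h_y C_y is invariant.\<close>

lemma KL_exists: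
  assumes ind: "independent (\<lambda>_. True)" and "w \<in> W"
  shows "\<exists>c. bar c = c \<and> c - Tw w \<in> lspan lpos (\<lambda>z. len n z < len n w)"
  using assms(2)
proof (induction "len n w" arbitrary: w rule: less_induct)
  case less
  define Y where "Y = {y \<in> W. len n y < len n w}"
  have Y: "Y \<subseteq> W" "finite Y" using finite_weylB[of n] by (auto simp: Y_def)
  have "\<forall>y \<in> Y. \<exists>c. bar c = c \<and> c - Tw y \<in> lspan lpos (\<lambda>z. len n z < len n y)"
    using less.hyps by (auto simp: Y_def)
  then obtain C where C: "\<And>y. y \<in> Y \<Longrightarrow> bar (C y) = C y"
    "\<And>y. y \<in> Y \<Longrightarrow> C y - Tw y \<in> lspan lpos (\<lambda>z. len n z < len n y)" by metis
  have C': "C y - Tw y \<in> aspan (\<lambda>z. len n z < len n y)" if "y \<in> Y" for y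
    using C(2)[OF that] lspan_mono[of lpos UNIV] by blast
  define X where "X = {(\<Sum>y \<in> Y. sc (g y) * C y) | g. True}"
  have X0: "0 \<in> X" unfolding X_def mem_Collect_eq by (rule exI[of _ "\<lambda>_. 0"]) simp
  have Xadd: "x + y \<in> X" if xy: "x \<in> X" "y \<in> X" for x y
  proof -
    obtain g h where "x = (\<Sum>y \<in> Y. sc (g y) * C y)" "y = (\<Sum>y \<in> Y. sc (h y) * C y)"
      using xy unfolding X_def by blast
    then show ?thesis unfolding X_def mem_Collect_eq
      by (intro exI[of _ "\<lambda>y. g y + h y"]) (simp add: sc_add distrib_right sum.distrib)
  qed
  have Xsc: "sc p * x \<in> X" if x: "x \<in> X" for p x
  proof -
    obtain g where "x = (\<Sum>y \<in> Y. sc (g y) * C y)" using x unfolding X_def by blast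
    then show ?thesis unfolding X_def mem_Collect_eq
      by (intro exI[of _ "\<lambda>y. p * g y"]) (simp add: sc_mult sum_distrib_left mult.assoc)
  qed
  have CX: "C y \<in> X" if "y \<in> Y" for y unfolding X_def mem_Collect_eq
    using that Y by (intro exI[of _ "\<lambda>z. if z = y then 1 else 0"])
      (simp add: sc_if_mult)
  have TX: "Tw y \<in> X" if "y \<in> Y" for y
    using that
  proof (induction "len n y" arbitrary: y rule: less_induct)
    case less
    have "C y - Tw y \<in> X"
    proof (rule aspan_induct[OF C'[OF less.prems] X0 Xadd Xsc])
      fix z assume "z \<in> W" "len n z < len n y"
      then show "Tw z \<in> X" using less by (auto simp: Y_def)
    qed
    then have "C y + sc (- 1) * (C y - Tw y) \<in> X" using CX less.prems Xadd Xsc by blast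
    then show ?case by (simp add: sc_uminus)
  qed
  have "bar (Tw w) - Tw w \<in> X"
    by (rule aspan_induct[OF bar_Tw[OF less.prems] X0 Xadd Xsc]) (use TX in \<open>auto simp: Y_def\<close>)
  then obtain g where g: "bar (Tw w) - Tw w = (\<Sum>y \<in> Y. sc (g y) * C y)" unfolding X_def by blast
  have bb: "bar (bar (Tw w)) = Tw w"
  proof -
    have "bar (bar (Tword is)) = Tword is" if "set is \<subseteq> {..<n}" for "is"
      using that by (induction "is") (auto simp: bar_1 bar_mult bar_diff bar_sc bar_T sc_uminus sc_diff)
    moreover obtain us where "reduced n us" "Tword us = Tw w" using reduced_word[OF less.prems] .
    ultimately show ?thesis by (metis reduced_def)
  qed
  have g': "Tw w - bar (Tw w) = (\<Sum>y \<in> Y. sc (lbar (g y)) * C y)"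
    using arg_cong[OF g, of bar] C(1) by (simp add: bar_diff bb bar_sum bar_mult bar_sc)
  have "(\<Sum>y \<in> Y. sc (g y + lbar (g y)) * C y) = 0"
    by (simp add: sc_add distrib_right sum.distrib flip: g g')
  from triangular_independent[OF ind Y(1) _ _ this]
  have "\<forall>y \<in> Y. g y + lbar (g y) = 0" using C' by auto
  then have "\<forall>y \<in> Y. \<exists>h. h \<in> lpos \<and> g y = h - lbar h"
    using lbar_anti_invariant by (metis add.inverse_inverse add_eq_0_iff)
  then obtain h where h: "\<And>y. y \<in> Y \<Longrightarrow> h y \<in> lpos" "\<And>y. y \<in> Y \<Longrightarrow> g y = h y - lbar (h y)" by metis
  define c where "c = Tw w + (\<Sum>y \<in> Y. sc (h y) * C y)"
  have "bar c = Tw w + (\<Sum>y \<in> Y. sc (g y) * C y) + (\<Sum>y \<in> Y. sc (lbar (h y)) * C y)"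
    unfolding c_def using C(1) g by (simp add: bar_add bar_sum bar_mult bar_sc algebra_simps)
  also have "\<dots> = c"
    unfolding c_def add.assoc sum.distrib[symmetric] using h(2) by (simp add: sc_diff flip: distrib_right)
  finally have "bar c = c" .
  moreover have "c - Tw w \<in> lspan lpos (\<lambda>z. len n z < len n w)"
  proof -
    have add: "x + y \<in> lspan lpos P" if "x \<in> lspan lpos P" "y \<in> lspan lpos P" for x y P
      using that by (intro lspan_add) (auto intro: lpos_add)
    have "sc (h y) * C y \<in> lspan lpos (\<lambda>z. len n z < len n w)" if y: "y \<in> Y" for y
    proof -
      have "sc (h y) * (C y - Tw y) \<in> lspan lpos (\<lambda>z. len n z < len n y)"
        using C(2)[OF y] h(1)[OF y] lpos_lnn by (intro lspan_scale[where S = lpos]) (auto intro: lpos_mult)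
      then have "sc (h y) * (C y - Tw y) \<in> lspan lpos (\<lambda>z. len n z < len n w)"
        using lspan_mono[of lpos lpos "\<lambda>z. len n z < len n y" "\<lambda>z. len n z < len n w"] y
        by (auto simp: Y_def)
      moreover have "sc (h y) * Tw y \<in> lspan lpos (\<lambda>z. len n z < len n w)"
        using y h(1) by (intro lspan_scaled_Tw) (auto simp: Y_def lpos_0)
      ultimately show ?thesis using add by (force simp: right_diff_distrib)
    qed
    then have "(\<Sum>y \<in> Y. sc (h y) * C y) \<in> lspan lpos (\<lambda>z. len n z < len n w)"
      using Y(2) by (intro sum_in) (auto intro: add lspan_0 lpos_0)
    then show ?thesis unfolding c_def by simp
  qed
  ultimately show ?case by blast
qed

end

section \<open>The quotient by $J_n$\<close>

text \<open>For t = T_i and s = T_j the right-hand side is symmetric in s and t except for t s t,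
  and the braid relation makes that term symmetric too. So the Temperley-Lieb relations for (i, j)
  and (j, i) are equivalent.\<close>

lemma TL_identity:
  fixes t s q q' :: "'a :: ring_1"
  assumes "q * q' = 1" "t * q = q * t" "s * q = q * s" "t * t = 1 + (q - q') * t"
  shows "(t - q) * (s - q) * (t - q) - (t - q) = t * s * t - q * (t * s + s * t) + q * q * (t + s) - q * q * q"
proof -
  have c: "t * (q * x) = q * (t * x)" "s * (q * x) = q * (s * x)" "q * (q' * x) = x"
    "t * (t * x) = x + (q - q') * (t * x)" for x
    using assms by (metis mult.assoc, metis mult.assoc, metis mult.assoc mult_1,
      metis mult.assoc distrib_right mult_1)
  show ?thesis by (simp add: algebra_simps assms c)
qed

text \<open>The instance is c = C_1, d = C_0, g = v, h = v^(-1). The term h c of the relation for c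
  d c cancels against the one from g c c, so that no negative power remains on the right.\<close>

lemma T101_identity:
  fixes c d g h :: "'a :: ring_1"
  assumes "g * h = 1" "c * g = g * c" "d * g = g * d"
    "c * c = - (g * g + h * h) * c" "c * d * c = (g + h) * c"
  shows "(c + g * g) * (d + g) * (c + g * g) =
    (g + g * g * g) * c + g * g * (c * d + d * c) + g * g * g * g * d + g * g * g * g * g"
proof -
  have c: "c * (g * x) = g * (c * x)" "d * (g * x) = g * (d * x)" "g * (h * x) = x" for x
    using assms by (metis mult.assoc, metis mult.assoc, metis mult.assoc mult_1)
  have *: "c * (d * c) = g * c + h * c" "c * c = - (g * (g * c)) - h * (h * c)"
    using assms(4,5) by (simp_all add: mult.assoc distrib_right left_diff_distrib)
  show ?thesis by (simp add: algebra_simps c assms(1-3) *)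
qed

locale blob_alg = hecke_alg 2 1 n sc T for n and sc :: "laurent \<Rightarrow> 'r :: ring_1" and T +
  assumes rel_TL: "3 \<le> n \<Longrightarrow> (T 1 - sc (vpow 2)) * (T 2 - sc (vpow 2)) * (T 1 - sc (vpow 2)) = T 1 - sc (vpow 2)"
    and rel_blob: "2 \<le> n \<Longrightarrow> (T 1 - sc (vpow 2)) * (T 0 - sc (vpow 1)) * (T 1 - sc (vpow 2)) =
      sc (vpow (- 1) + vpow 1) * (T 1 - sc (vpow 2))"
begin

abbreviation V :: "int \<Rightarrow> 'r" where "V k \<equiv> sc (vpow k)"

lemma V_mult: "V j * V k = V (j + k)" "V j * (V k * x) = V (j + k) * x"
  by (simp_all add: vpow_add flip: sc_mult mult.assoc)

definition pr :: "nat \<Rightarrow> int" where "pr i = param 2 1 i"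

lemma pr_simps [simp]: "pr 0 = 1" "0 < i \<Longrightarrow> pr i = 2" "pr (Suc i) = 2"
  by (simp_all add: pr_def param_def)

definition C :: "nat \<Rightarrow> 'r" where "C i = T i - V (pr i)"

lemma T_eq_C: "T i = C i + V (pr i)"
  by (simp add: C_def)

lemma T_square: "i < n \<Longrightarrow> T i * T i = 1 + (V (pr i) - V (- pr i)) * T i"
  using quad[of i] by (simp add: pr_def sc_diff)

lemma C_square: "i < n \<Longrightarrow> C i * C i = - (V (pr i) + V (- pr i)) * C i"
  using T_square[of i] sc_comm[of "T i" "vpow (pr i)"]
  by (simp add: C_def algebra_simps V_mult)

lemma C_comm: "i + 1 < j \<Longrightarrow> j < n \<Longrightarrow> C i * C j = C j * C i"
  using comm[of i j] sc_comm[of "T i" "vpow (pr j)"] sc_comm[of "T j" "vpow (pr i)"]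
    sc_comm[of "V (pr i)" "vpow (pr j)"]
  by (simp add: C_def left_diff_distrib right_diff_distrib)

lemma C_blob: "2 \<le> n \<Longrightarrow> C 1 * C 0 * C 1 = (V 1 + V (- 1)) * C 1"
  using rel_blob by (simp add: C_def sc_add add.commute)

lemma TL_expand:
  assumes "i < n" "j < n" "1 \<le> i" "1 \<le> j"
  shows "C i * C j * C i - C i =
    T i * T j * T i - V 2 * (T i * T j + T j * T i) + V 4 * (T i + T j) - V 6"
  using TL_identity[of "V 2" "V (- 2)" "T i" "T j"] assms T_square[of i]
    sc_comm[of "T i" "vpow 2"] sc_comm[of "T j" "vpow 2"]
  by (simp add: C_def V_mult)

lemma T_inverse: "i < n \<Longrightarrow> T i * (T i - (V (pr i) - V (- pr i))) = 1"
  using T_square[of i] sc_comm[of "T i" "vpow (pr i)"] sc_comm[of "T i" "vpow (- pr i)"]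
  by (simp add: algebra_simps)

lemma T_cancel: assumes "i < n" "x * T i = y * T i" shows "x = y"
  using arg_cong[OF assms(2), of "\<lambda>z. z * (T i - (V (pr i) - V (- pr i)))"]
  by (simp only: mult.assoc T_inverse[OF assms(1)] mult_1_right)

text \<open>The element \<open>T\<^sub>i T\<^sub>i\<^sub>+\<^sub>1 T\<^sub>i\<^sub>+\<^sub>2\<close> conjugates \<open>(T\<^sub>i, T\<^sub>i\<^sub>+\<^sub>1)\<close> to \<open>(T\<^sub>i\<^sub>+\<^sub>1, T\<^sub>i\<^sub>+\<^sub>2)\<close>.\<close>

lemma TL_step: "1 \<le> i \<Longrightarrow> Suc i < n \<Longrightarrow> C i * C (Suc i) * C i = C i"
proof (induction i rule: dec_induct)
  case base
  then show ?case using rel_TL by (simp add: C_def numeral_2_eq_2)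
next
  case (step i)
  let ?s = "T i" and ?t = "T (Suc i)" and ?u = "T (Suc (Suc i))"
  define g where "g = ?s * ?t * ?u"
  have b: "?s * ?t * ?s = ?t * ?s * ?t" "?t * ?u * ?t = ?u * ?t * ?u" "?s * ?u = ?u * ?s"
    using braid3[of i] braid3[of "Suc i"] comm[of i "Suc (Suc i)"] step by auto
  have gs: "g * ?s = ?t * g"
  proof -
    have "g * ?s = ?s * ?t * ?s * ?u" using b(3) by (simp add: g_def mult.assoc)
    also have "\<dots> = ?t * g" unfolding b(1) by (simp add: g_def mult.assoc)
    finally show ?thesis .
  qed
  have gt: "g * ?t = ?u * g"
  proof -
    have "g * ?t = ?s * (?t * ?u * ?t)" by (simp add: g_def mult.assoc)
    also have "\<dots> = ?s * ?u * (?t * ?u)" unfolding b(2) by (simp add: mult.assoc)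
    also have "\<dots> = ?u * g" unfolding b(3) by (simp add: g_def mult.assoc)
    finally show ?thesis .
  qed
  have Cg: "g * C i = C (Suc i) * g" "g * C (Suc i) = C (Suc (Suc i)) * g"
    using gs gt sc_comm[of g "vpow 2"] step by (simp_all add: C_def left_diff_distrib right_diff_distrib)
  have "g * (C i * C (Suc i) * C i) = C (Suc i) * C (Suc (Suc i)) * C (Suc i) * g"
    using Cg by (metis mult.assoc)
  moreover have "C i * C (Suc i) * C i = C i" using step by simp
  ultimately have "C (Suc i) * C (Suc (Suc i)) * C (Suc i) * g = C (Suc i) * g"
    using Cg by simp
  then have "C (Suc i) * C (Suc (Suc i)) * C (Suc i) * ?s * ?t * ?u = C (Suc i) * ?s * ?t * ?u"
    by (simp add: g_def mult.assoc)
  then show ?case using T_cancel step by (meson Suc_lessD)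
qed

lemma TL: assumes "1 \<le> i" "1 \<le> j" "i < n" "j < n" "j = Suc i \<or> i = Suc j" shows "C i * C j * C i = C i"
  using assms(5)
proof
  assume j: "i = Suc j"
  have "C i * C j * C i - C i = C j * C i * C j - C j"
    using TL_expand[of i j] TL_expand[of j i] braid3[of j] assms j by (simp add: add.commute)
  then show ?thesis using TL_step[of j] assms j by simp
qed (use TL_step assms in simp)

lemma T101:
  assumes "2 \<le> n"
  shows "T 1 * T 0 * T 1 = (V 1 + V 3) * C 1 + V 2 * (C 1 * C 0 + C 0 * C 1) + V 4 * C 0 + V 5"
  using T101_identity[of "V 1" "V (- 1)" "C 1" "C 0"] C_square[of 1] C_blob sc_comm[of "C 1" "vpow 1"]
    sc_comm[of "C 0" "vpow 1"] assms
  by (simp add: T_eq_C V_mult mult.assoc)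

text \<open>The Temperley-Lieb relation solved for the triple product in such a way that v^2 factors
  out, leaving a product of two T's and a product of two C's; \<open>L_critical\<close> depends on
  this shape.\<close>

lemma T_triple:
  assumes "1 \<le> i" "1 \<le> j" "i < n" "j < n" "j = Suc i \<or> i = Suc j"
  shows "T i * T j * T i = V 2 * (T j * T i + C i * C j)"
proof -
  have CC: "C i * C j = T i * T j - V 2 * T i - V 2 * T j + V 4"
    using assms sc_comm[of "T i" "vpow 2"] by (simp add: C_def algebra_simps V_mult)
  have TTT: "T i * T j * T i = V 2 * (T i * T j + T j * T i) - V 4 * (T i + T j) + V 6"
    using TL_expand[of i j] TL[OF assms] assms by (simp add: diff_add_eq add.commute diff_eq_eq eq_diff_eq)
  show ?thesis unfolding CC TTT by (simp add: algebra_simps V_mult)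
qed

subsection \<open>Runs of generators\<close>

definition Cword :: "nat list \<Rightarrow> 'r" where "Cword is = prod_list (map C is)"

lemma Cword_simps [simp]: "Cword [] = 1" "Cword (i # is) = C i * Cword is"
  "Cword (us @ vs) = Cword us * Cword vs"
  by (simp_all add: Cword_def)

text \<open>Runs have half-open bounds: C_(m-1) ... C_k for \<open>Cd m k\<close> and C_k ...
  C_(m-1) for \<open>Cu k m\<close>. They are 1 for m <= k, so the trivial coset needs no case of
  its own.\<close>

definition Cd where "Cd m k = Cword (rev [k..<m])"
definition Cu where "Cu k m = Cword [k..<m]"
definition Td where "Td m k = Tword (rev [k..<m])"
definition Tu where "Tu k m = Tword [k..<m]"

lemma upt_split: "k \<le> j \<Longrightarrow> j \<le> m \<Longrightarrow> [k..<m] = [k..<j] @ [j..<m]"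
  using upt_add_eq_append[of k j "m - j"] by simp

lemma Cd_refl [simp]: "m \<le> k \<Longrightarrow> Cd m k = 1"
  and Cu_refl [simp]: "m \<le> k \<Longrightarrow> Cu k m = 1"
  and Td_refl [simp]: "m \<le> k \<Longrightarrow> Td m k = 1"
  and Tu_refl [simp]: "m \<le> k \<Longrightarrow> Tu k m = 1"
  by (simp_all add: Cd_def Cu_def Td_def Tu_def)

lemma Cd_split: "k \<le> j \<Longrightarrow> j \<le> m \<Longrightarrow> Cd m k = Cd m j * Cd j k"
  and Cu_split: "k \<le> j \<Longrightarrow> j \<le> m \<Longrightarrow> Cu k m = Cu k j * Cu j m"
  and Td_split: "k \<le> j \<Longrightarrow> j \<le> m \<Longrightarrow> Td m k = Td m j * Td j k"
  and Tu_split: "k \<le> j \<Longrightarrow> j \<le> m \<Longrightarrow> Tu k m = Tu k j * Tu j m"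
  by (simp_all add: Cd_def Cu_def Td_def Tu_def upt_split[of k j m])

lemma Cd_Suc [simp]: "Cd (Suc k) k = C k" and Cu_Suc [simp]: "Cu k (Suc k) = C k"
  and Td_Suc [simp]: "Td (Suc k) k = T k" and Tu_Suc [simp]: "Tu k (Suc k) = T k"
  by (simp_all add: Cd_def Cu_def Td_def Tu_def upt_conv_Cons)

lemma Cd_right: "k < m \<Longrightarrow> Cd m k = Cd m (Suc k) * C k"
  using Cd_split[of k "Suc k" m] by simp

lemma Cd_left: "k \<le> m \<Longrightarrow> Cd (Suc m) k = C m * Cd m k"
  using Cd_split[of k m "Suc m"] by simp

lemma Td_right: "k < m \<Longrightarrow> Td m k = Td m (Suc k) * T k"
  using Td_split[of k "Suc k" m] by simp

lemma Td_left: "k \<le> m \<Longrightarrow> Td (Suc m) k = T m * Td m k"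
  using Td_split[of k m "Suc m"] by simp

lemma Cu_left: "k < m \<Longrightarrow> Cu k m = C k * Cu (Suc k) m"
  using Cu_split[of k "Suc k" m] by simp

lemma Cu_right: "k \<le> m \<Longrightarrow> Cu k (Suc m) = Cu k m * C m"
  using Cu_split[of k m "Suc m"] by simp

lemma Tu_left: "k < m \<Longrightarrow> Tu k m = T k * Tu (Suc k) m"
  using Tu_split[of k "Suc k" m] by simp

lemma commute_prod:
  assumes "\<And>x. x \<in> set xs \<Longrightarrow> y * x = x * (y :: 'r)"
  shows "y * prod_list xs = prod_list xs * y"
  using assms by (induction xs) (simp_all, metis mult.assoc)

lemma commute_prods:
  assumes "\<And>x y. x \<in> set xs \<Longrightarrow> y \<in> set ys \<Longrightarrow> y * x = x * (y :: 'r)"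
  shows "prod_list ys * prod_list xs = prod_list xs * prod_list ys"
  by (rule commute_prod) (metis assms commute_prod)

lemma CT_comm: "i + 1 < j \<Longrightarrow> j < n \<Longrightarrow> C i * T j = T j * C i" "i + 1 < j \<Longrightarrow> j < n \<Longrightarrow> T i * C j = C j * T i"
  using C_comm[of i j] comm[of i j] sc_comm[of "C i" "vpow (pr j)"] sc_comm[of "C j" "vpow (pr i)"]
  by (simp_all add: T_eq_C distrib_left distrib_right)

lemma Cd_Cd_comm: "a < k \<Longrightarrow> m \<le> n \<Longrightarrow> Cd a b * Cd m k = Cd m k * Cd a b"
  unfolding Cd_def Cword_def by (rule commute_prods) (auto intro!: C_comm)

lemma Cd_Td_comm: "a < k \<Longrightarrow> m \<le> n \<Longrightarrow> Cd a b * Td m k = Td m k * Cd a b"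
  unfolding Cd_def Cword_def Td_def Tword_def by (rule commute_prods) (auto intro!: CT_comm)

lemma Td_Td_comm: "a < k \<Longrightarrow> m \<le> n \<Longrightarrow> Td a b * Td m k = Td m k * Td a b"
  unfolding Td_def Tword_def by (rule commute_prods) (auto intro!: comm)

lemma Td_Cd_comm: "a < k \<Longrightarrow> m \<le> n \<Longrightarrow> Td a b * Cd m k = Cd m k * Td a b"
  unfolding Cd_def Cword_def Td_def Tword_def by (rule commute_prods) (auto intro!: CT_comm)

lemma Cu_Cd_comm: "b < k \<Longrightarrow> m \<le> n \<Longrightarrow> Cu a b * Cd m k = Cd m k * Cu a b"
  unfolding Cd_def Cu_def Cword_def by (rule commute_prods) (auto intro!: C_comm)

text \<open>C_i moves left to the factors C_i C_(i-1) of the run, and C_i C_(i-1) C_i = C_i removes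
  C_(i-1), which cuts the run into two commuting pieces. The excluded case k = 0, i = 1 yields a
  scalar factor instead, see \<open>Cd_blob\<close>.\<close>

lemma Cd_absorb:
  assumes "k < i" "i < m" "m \<le> n" "1 \<le> k \<or> 2 \<le> i"
  shows "Cd m k * C i = Cd (i - 1) k * Cd m i"
proof -
  obtain j where j: "i = Suc j" using assms by (cases i) auto
  have "Cd m k = Cd m (Suc i) * (C i * C j) * Cd j k"
    using Cd_split[of k i m] Cd_right[of i m] Cd_left[of k j] assms j by (simp add: mult.assoc)
  moreover have "Cd j k * C i = C i * Cd j k"
    using Cd_Cd_comm[of j i "Suc i" k] assms j by simp
  ultimately have "Cd m k * C i = Cd m (Suc i) * (C i * C j * C i) * Cd j k"
    by (simp add: mult.assoc)
  also have "C i * C j * C i = C i" using TL[of i j] assms j by auto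
  also have "Cd m (Suc i) * C i * Cd j k = Cd m i * Cd j k" using Cd_right[of i m] assms by simp
  also have "\<dots> = Cd j k * Cd m i" using Cd_Cd_comm[of j i m k] assms j by simp
  finally show ?thesis using j by simp
qed

lemma Cd_blob:
  assumes "2 \<le> m" "m \<le> n" shows "Cd m 0 * C 1 = (V 1 + V (- 1)) * Cd m 1"
proof -
  have "Cd m 0 = Cd m 2 * C 1 * C 0"
    using Cd_right[of 0 m] Cd_right[of 1 m] assms by (simp add: numeral_2_eq_2)
  then have "Cd m 0 * C 1 = Cd m 2 * (C 1 * C 0 * C 1)" by (simp add: mult.assoc)
  also have "\<dots> = (V 1 + V (- 1)) * (Cd m 2 * C 1)"
    using C_blob assms by (simp add: distrib_left distrib_right sc_comm')
  finally show ?thesis using Cd_right[of 1 m] assms by (simp add: numeral_2_eq_2)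
qed

lemma Cd_Cu:
  assumes "1 \<le> k" "k < h" "h \<le> m" "m \<le> n"
  shows "Cd m k * Cu (Suc k) h = Cd m (h - 1)"
  using Suc_leI[OF assms(2)] assms(3)
proof (induction h rule: dec_induct)
  case (step h)
  have "Cd m k * Cu (Suc k) (Suc h) = Cd m (h - 1) * C h"
    using step Cu_right[of "Suc k" h] by (simp add: mult.assoc flip: mult.assoc)
  also have "\<dots> = Cd (h - 1) (h - 1) * Cd m h"
    using Cd_absorb[of "h - 1" h m] step assms by simp
  finally show ?case by simp
qed simp

lemma Cd1_Cu2:
  assumes "2 \<le> c" "c \<le> n" "2 \<le> h" "h \<le> n"
  shows "Cd c 1 * Cu 2 h = (if h \<le> c then Cd c (h - 1) else Cu (c - 1) h)"
proof (cases "h \<le> c")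
  case True
  then show ?thesis using Cd_Cu[of 1 h c] assms by (simp add: numeral_2_eq_2)
next
  case False
  have "Cd c 1 * Cu 2 h = Cd c 1 * Cu (Suc 1) c * Cu c h"
    using Cu_split[of 2 c h] False assms by (simp add: mult.assoc numeral_2_eq_2)
  also have "\<dots> = Cd c (c - 1) * Cu c h" using Cd_Cu[of 1 c c] assms by simp
  also have "\<dots> = Cu (c - 1) h" using Cu_left[of "c - 1" h] Cd_right[of "c - 1" c] False assms by simp
  finally show ?thesis using False by simp
qed

subsection \<open>The lattice spanned by monomials\<close>

text \<open>Z[v]-combinations of products R_1 ... R_m with R_j a descending run
  \<open>Cd j k\<close>, one for each step of the chain of groups. Only coset words of the first
  kind have a counterpart among these monomials; those of the second kind enter the lattice through
  \<open>T101\<close>.\<close>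

inductive lat :: "nat \<Rightarrow> 'r \<Rightarrow> bool" where
  lat_base: "p \<in> lnn \<Longrightarrow> lat 0 (sc p)"
| lat_step: "lat m x \<Longrightarrow> k \<le> Suc m \<Longrightarrow> lat (Suc m) (x * Cd (Suc m) k)"
| lat_add: "lat m x \<Longrightarrow> lat m y \<Longrightarrow> lat m (x + y)"

lemma lat_scale: "lat m x \<Longrightarrow> p \<in> lnn \<Longrightarrow> lat m (sc p * x)"
proof (induction rule: lat.induct)
  case (lat_base q)
  then show ?case by (simp add: lat.lat_base lnn_mult flip: sc_mult)
next
  case (lat_step m x k)
  then show ?case using lat.lat_step[of m "sc p * x" k] by (simp add: mult.assoc)
next
  case (lat_add m x y)
  then show ?case by (simp add: distrib_left lat.lat_add)
qed

text \<open>This is v^e times the lattice; the exponent keeps the account of powers of v gained and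
  lost.\<close>

definition L :: "int \<Rightarrow> nat \<Rightarrow> 'r set" where "L e m = {x. lat m (V (- e) * x)}"

lemma L_scale: "x \<in> L e m \<Longrightarrow> p \<in> lnn \<Longrightarrow> sc p * x \<in> L e m"
  using lat_scale[of m "V (- e) * x" p] sc_comm'[of "V (- e)" p x] by (simp add: L_def)

lemma L_V: "x \<in> L e m \<Longrightarrow> V k * x \<in> L (e + k) m"
  by (simp add: L_def V_mult)

lemma L_mono: assumes "x \<in> L e m" "e' \<le> e" shows "x \<in> L e' m"
  using L_scale[OF L_V[OF assms(1), of "e' - e"], of "vpow (e - e')"] assms(2)
  by (simp add: lnn_vpow V_mult)

lemma L_V': "x \<in> L e m \<Longrightarrow> e' \<le> e + k \<Longrightarrow> V k * x \<in> L e' m"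
  using L_V L_mono by blast

lemma L_add: "x \<in> L e m \<Longrightarrow> y \<in> L e m \<Longrightarrow> x + y \<in> L e m"
  by (simp add: L_def distrib_left lat_add)

lemma L_uminus: "x \<in> L e m \<Longrightarrow> - x \<in> L e m"
  using L_scale[of x e m "- 1"] lnn_uminus[OF lnn_1] by (simp add: sc_uminus)

lemma L_diff: "x \<in> L e m \<Longrightarrow> y \<in> L e m \<Longrightarrow> x - y \<in> L e m"
  using L_add[of x e m "- y"] L_uminus by simp

lemma L_step: "x \<in> L e m \<Longrightarrow> k \<le> Suc m \<Longrightarrow> x * Cd (Suc m) k \<in> L e (Suc m)"
  by (simp add: L_def lat_step flip: mult.assoc)

lemma lat_L: "lat m x \<longleftrightarrow> x \<in> L 0 m"
  by (simp add: L_def)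

lemma L_mult_from_lat:
  assumes "\<And>x. lat m x \<Longrightarrow> x * y \<in> L d m'" and "x \<in> L e m"
  shows "x * y \<in> L (e + d) m'"
proof -
  have "(V (- e) * x) * y \<in> L d m'" using assms by (simp add: L_def)
  from L_V[OF this, of e] show ?thesis by (simp add: V_mult mult.assoc add.commute)
qed

lemma L_loop: "x \<in> L e m \<Longrightarrow> (V 1 + V (- 1)) * x \<in> L (e - 1) m"
  by (auto simp: distrib_right intro!: L_add L_V')

lemma L_C_square: "x \<in> L e m \<Longrightarrow> - (V (pr i) + V (- pr i)) * x \<in> L (e - pr i) m"
  by (cases i) (auto simp: distrib_right left_diff_distrib intro!: L_diff L_V' L_uminus)

text \<open>The bound is uniform in the length of the run. Against the last factor
  \<open>Cd (Suc m) k\<close> the new run commutes, concatenates, meets an equal letter, or is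
  absorbed. When it commutes or is absorbed, at most one run is passed on to the smaller x; a scalar
  factor ends the recursion, so at most one occurs, and the worst is v^2 + v^(-2).\<close>

lemma lat_Cd:
  assumes "lat m x" "a \<le> m" "m \<le> n" shows "x * Cd a b \<in> L (- 2) m"
  using assms
proof (induction arbitrary: a b rule: lat.induct)
  case (lat_base p)
  then show ?case using L_mono[of "sc p" 0 0 "- 2"] lat.lat_base by (simp add: lat_L)
next
  case (lat_add m x y)
  then show ?case by (simp add: distrib_right L_add)
next
  case (lat_step m x k)
  have x: "x \<in> L 0 m" using lat_step by (simp add: lat_L)
  note step = L_step[OF x]
  have IH: "x * Cd a' b' \<in> L (- 2) m" if "a' \<le> m" for a' b'
    using lat_step.IH[OF that] lat_step.prems by simp
  consider "a \<le> b" | "b < a" "a < k" | "b < a" "a = k" | "b < a" "a = Suc k" | "b < a" "Suc k < a" by linarith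
  then show ?case
  proof cases
    case 1
    then show ?thesis using step[OF lat_step.hyps(2)] by (auto intro: L_mono)
  next
    case 2
    then have "x * Cd (Suc m) k * Cd a b = x * Cd a b * Cd (Suc m) k"
      using Cd_Cd_comm[of a k "Suc m" b] lat_step.prems by (simp add: mult.assoc)
    then show ?thesis using L_step[OF IH[of a b] lat_step.hyps(2)] 2 lat_step.hyps(2) by simp
  next
    case 3
    then have "x * Cd (Suc m) k * Cd a b = x * Cd (Suc m) b"
      using Cd_split[of b k "Suc m"] lat_step.hyps(2) by (simp add: mult.assoc)
    then show ?thesis using step[of b] 3 lat_step by (auto intro: L_mono)
  next
    case 4
    have k: "k < Suc m" "k < n" using 4 lat_step.prems by auto
    have "x * Cd (Suc m) k * Cd a b = x * Cd (Suc m) (Suc k) * (C k * C k) * Cd k b"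
      using Cd_left[of b k] Cd_right[of k "Suc m"] 4 k by (simp add: mult.assoc)
    also have "\<dots> = - (V (pr k) + V (- pr k)) * (x * Cd (Suc m) (Suc k) * C k * Cd k b)"
      unfolding C_square[OF k(2)] by (simp add: distrib_left distrib_right sc_comm' mult.assoc left_diff_distrib right_diff_distrib)
    also have "x * Cd (Suc m) (Suc k) * C k * Cd k b = x * Cd (Suc m) b"
      using Cd_split[of b k "Suc m"] Cd_right[of k "Suc m"] 4 k by (simp add: mult.assoc)
    finally show ?thesis using L_C_square[OF step[of b], of k] 4 k by (cases k) (auto intro: L_mono)
  next
    case 5
    then obtain i where i: "a = Suc i" by (cases a) auto
    have i': "k < i" "i \<le> m" "b \<le> i" using 5 i lat_step.prems by auto
    show ?thesis
    proof (cases "1 \<le> k \<or> 2 \<le> i")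
      case True
      have "x * Cd (Suc m) k * Cd a b = x * (Cd (Suc m) k * C i) * Cd i b"
        using Cd_left[of b i] i i' by (simp add: mult.assoc)
      also have "\<dots> = x * Cd (i - 1) k * Cd (Suc m) b"
        using Cd_absorb[of k i "Suc m"] i' True lat_step.prems Cd_split[of b i "Suc m"] by (simp add: mult.assoc)
      finally show ?thesis using L_step[OF IH[of "i - 1" k], of b] i' by simp
    next
      case False
      then have ki: "k = 0" "i = 1" using i' by auto
      have "x * Cd (Suc m) k * Cd a b = x * (Cd (Suc m) 0 * C 1) * Cd 1 b"
        using Cd_left[of b 1] i i' ki by (simp add: mult.assoc)
      also have "\<dots> = (V 1 + V (- 1)) * (x * Cd (Suc m) b)"
        using Cd_blob[of "Suc m"] i' ki lat_step.prems Cd_split[of b 1 "Suc m"]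
        by (simp add: mult.assoc distrib_left distrib_right sc_comm')
      finally show ?thesis using L_loop[OF step[of b]] i' by (auto intro: L_mono)
    qed
  qed
qed

lemma L_Cd: "x \<in> L e m \<Longrightarrow> a \<le> m \<Longrightarrow> m \<le> n \<Longrightarrow> e' \<le> e - 2 \<Longrightarrow> x * Cd a b \<in> L e' m"
  using L_mult_from_lat[of m "Cd a b" "- 2" m x e] lat_Cd by (auto intro: L_mono)

text \<open>The square of C_0 only costs v^(-1), and C_0 commutes with the runs that end above 1.
  The sharper bound is essential in \<open>L_Td0_Tu\<close>, where there is no room for a loss of
  v^2.\<close>

lemma lat_C0:
  assumes "lat m x" "1 \<le> m" "m \<le> n" shows "x * C 0 \<in> L (- 1) m"
  using assms
proof (induction rule: lat.induct)
  case (lat_add m x y)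
  then show ?case by (simp add: distrib_right L_add)
next
  case (lat_step m x k)
  have x: "x \<in> L 0 m" using lat_step by (simp add: lat_L)
  consider "k = 0" | "k = 1" | "2 \<le> k" by linarith
  then show ?case
  proof cases
    case 1
    have "x * Cd (Suc m) k * C 0 = x * Cd (Suc m) 1 * (C 0 * C 0)"
      using Cd_right[of 0 "Suc m"] 1 by (simp add: mult.assoc)
    also have "\<dots> = - (V (pr 0) + V (- pr 0)) * (x * Cd (Suc m) 0)"
      using C_square[of 0] Cd_right[of 0 "Suc m"] lat_step.prems
      by (simp add: distrib_left distrib_right sc_comm' mult.assoc left_diff_distrib right_diff_distrib)
    finally show ?thesis using L_C_square[OF L_step[OF x, of 0], of 0] by simp
  next
    case 2
    have "x * Cd (Suc m) k * C 0 = x * Cd (Suc m) 0"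
      using Cd_right[of 0 "Suc m"] 2 by (simp add: mult.assoc)
    then show ?thesis using L_step[OF x, of 0] by (auto intro: L_mono)
  next
    case 3
    have "x * Cd (Suc m) k * C 0 = x * C 0 * Cd (Suc m) k"
      using Cd_Cd_comm[of 1 k "Suc m" 0] 3 lat_step.prems by (simp add: mult.assoc)
    moreover have "x * C 0 \<in> L (- 1) m" using lat_step 3 by simp
    ultimately show ?thesis using L_step lat_step.hyps(2) by simp
  qed
qed simp

lemma L_C0: "x \<in> L e m \<Longrightarrow> 1 \<le> m \<Longrightarrow> m \<le> n \<Longrightarrow> x * C 0 \<in> L (e - 1) m"
  using L_mult_from_lat[of m "C 0" "- 1" m x e] lat_C0 by auto

text \<open>An ascending run that meets a descending one collapses with it to a single descending
  run (\<open>Cd_Cu\<close>), so again at most one scalar factor arises.\<close>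

lemma lat_Cu:
  assumes "lat m x" "1 \<le> a" "b \<le> m" "m \<le> n" shows "x * Cu a b \<in> L (- 2) m"
  using assms
proof (induction arbitrary: a b rule: lat.induct)
  case (lat_base p)
  then show ?case using L_mono[of "sc p" 0 0 "- 2"] lat.lat_base by (simp add: lat_L)
next
  case (lat_add m x y)
  then show ?case by (simp add: distrib_right L_add)
next
  case (lat_step m x k)
  have x: "x \<in> L 0 m" using lat_step by (simp add: lat_L)
  note step = L_step[OF x]
  have IH: "x * Cu a' b' \<in> L (- 2) m" if "1 \<le> a'" "b' \<le> m" for a' b'
    using lat_step.IH[OF that] lat_step.prems by simp
  have dn: "x * Cd a' b' \<in> L (- 2) m" if "a' \<le> m" for a' b'
    using L_Cd[OF x that] lat_step.prems by simp
  have abs: "Cd (Suc m) c * Cu (Suc c) b = Cd (Suc m) (b - 1)" if "1 \<le> c" "c < b" for c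
    using Cd_Cu[of c b "Suc m"] that lat_step.prems by simp
  consider "b \<le> a" | "a < b" "b < k" | "a < b" "a < k" "k \<le> b" | "a < b" "a = k" | "a < b" "k < a" by linarith
  then show ?case
  proof cases
    case 1
    then show ?thesis using step[OF lat_step.hyps(2)] by (auto intro: L_mono)
  next
    case 2
    then have "x * Cd (Suc m) k * Cu a b = x * Cu a b * Cd (Suc m) k"
      using Cu_Cd_comm[of b k "Suc m" a] lat_step.prems by (simp add: mult.assoc)
    then show ?thesis using L_step[OF IH[of a b] lat_step.hyps(2)] 2 lat_step.hyps lat_step.prems by simp
  next
    case 3
    \<comment> \<open>When k lies in the ascending range, the letters below k-1 pass the descending
      run, C_(k-1) prolongs it downwards, and the remaining letters collapse into it.\<close>
    define c where "c = k - 1"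
    have c: "k = Suc c" "1 \<le> c" "a \<le> c" "c < b" using 3 lat_step.prems by (auto simp: c_def)
    have "Cu a b = Cu a c * (C c * Cu (Suc c) b)"
      using Cu_split[of a c b] Cu_left[of c b] c by simp
    then have "x * Cd (Suc m) k * Cu a b = x * (Cd (Suc m) k * Cu a c) * C c * Cu (Suc c) b"
      by (simp add: mult.assoc)
    also have "Cd (Suc m) k * Cu a c = Cu a c * Cd (Suc m) k"
      using Cu_Cd_comm[of c k "Suc m" a] c lat_step.prems by simp
    also have "x * (Cu a c * Cd (Suc m) k) * C c * Cu (Suc c) b = x * Cu a c * (Cd (Suc m) c * Cu (Suc c) b)"
      using Cd_right[of c "Suc m"] c lat_step.prems by (simp add: mult.assoc)
    finally show ?thesis using L_step[OF IH[of a c], of "b - 1"] abs[OF c(2,4)] c lat_step.hyps lat_step.prems by simp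
  next
    case 4
    have k: "k < Suc m" "k < n" "1 \<le> k" using 4 lat_step.prems by auto
    have "x * Cd (Suc m) k * Cu a b = x * Cd (Suc m) (Suc k) * (C k * C k) * Cu (Suc k) b"
      using Cu_left[of k b] Cd_right[of k "Suc m"] 4 k by (simp add: mult.assoc)
    also have "\<dots> = - (V (pr k) + V (- pr k)) * (x * (Cd (Suc m) (Suc k) * C k * Cu (Suc k) b))"
      unfolding C_square[OF k(2)] by (simp add: distrib_left distrib_right sc_comm' mult.assoc left_diff_distrib right_diff_distrib)
    also have "Cd (Suc m) (Suc k) * C k * Cu (Suc k) b = Cd (Suc m) (b - 1)"
      using abs[of k] Cd_right[of k "Suc m"] 4 k by simp
    finally show ?thesis using L_C_square[OF step[of "b - 1"], of k] k lat_step.prems by auto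
  next
    case 5
    show ?thesis
    proof (cases "1 \<le> k \<or> 2 \<le> a")
      case True
      have "x * Cd (Suc m) k * Cu a b = x * (Cd (Suc m) k * C a) * Cu (Suc a) b"
        using Cu_left[of a b] 5 by (simp add: mult.assoc)
      also have "Cd (Suc m) k * C a = Cd (a - 1) k * Cd (Suc m) a"
        using Cd_absorb[of k a "Suc m"] 5 True lat_step.prems by simp
      also have "x * (Cd (a - 1) k * Cd (Suc m) a) * Cu (Suc a) b = x * Cd (a - 1) k * Cd (Suc m) (b - 1)"
        using abs[of a] 5 lat_step.prems by (simp add: mult.assoc)
      finally show ?thesis using L_step[OF dn[of "a - 1" k], of "b - 1"] 5 lat_step.prems by simp
    next
      case False
      then have ki: "k = 0" "a = 1" using 5 lat_step.prems by auto
      have "x * Cd (Suc m) k * Cu a b = x * (Cd (Suc m) 0 * C 1) * Cu (Suc 1) b"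
        using Cu_left[of 1 b] 5 ki by (simp add: mult.assoc)
      also have "\<dots> = (V 1 + V (- 1)) * (x * (Cd (Suc m) 1 * Cu (Suc 1) b))"
        using Cd_blob[of "Suc m"] 5 ki lat_step.prems
        by (simp add: mult.assoc distrib_left distrib_right sc_comm')
      finally show ?thesis
        using L_mono[OF L_loop[OF step[of "b - 1"]], of "- 2"] abs[of 1] 5 ki lat_step.prems by simp
    qed
  qed
qed

lemma L_Cu: "x \<in> L e m \<Longrightarrow> 1 \<le> a \<Longrightarrow> b \<le> m \<Longrightarrow> m \<le> n \<Longrightarrow> e' \<le> e - 2 \<Longrightarrow> x * Cu a b \<in> L e' m"
  using L_mult_from_lat[of m "Cu a b" "- 2" m x e] lat_Cu by (auto intro: L_mono)

subsection \<open>Multiplying the lattice by products of standard generators\<close>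

text \<open>The claim is proved for mixed products, a C-run followed by a T-run. Splitting the first
  T_c as C_c + q_c either prolongs the C-run or breaks the product there. After a break with c >= 1
  the factor q_c = v^2 pays for the C-run already multiplied; for c = 0 the remaining run is empty.
  Hence the total loss stays v^2.\<close>

lemma L_Td:
  assumes "x \<in> L e m" "a \<le> m" "m \<le> n" shows "x * Td a b \<in> L (e - 2) m"
proof -
  have "x * Cd a c * Td c b \<in> L (e - 2) m" if "x \<in> L e m" "c \<le> a" "a \<le> m" "b \<le> c" for x a c e
    using that
  proof (induction c arbitrary: x a e)
    case 0
    then show ?case using L_Cd assms by simp
  next
    case (Suc c)
    show ?case
    proof (cases "b = Suc c")
      case True
      then show ?thesis using Suc L_Cd assms by simp
    next
      case False
      have "x * Cd a (Suc c) * Td (Suc c) b = x * (Cd a (Suc c) * C c) * Td c b + V (pr c) * (x * Cd a (Suc c) * Td c b)"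
        using Td_left[of b c] False Suc.prems
        by (simp add: T_eq_C distrib_left distrib_right mult.assoc sc_comm')
      also have "Cd a (Suc c) * C c = Cd a c" using Cd_right[of c a] Suc.prems by simp
      finally have eq: "x * Cd a (Suc c) * Td (Suc c) b = x * Cd a c * Td c b + V (pr c) * (x * Cd a (Suc c) * Td c b)" .
      have 1: "x * Cd a c * Td c b \<in> L (e - 2) m" using Suc False by simp
      have xC: "x * Cd a (Suc c) \<in> L (e - 2) m" using L_Cd Suc.prems assms by simp
      have "V (pr c) * (x * Cd a (Suc c) * Td c b) \<in> L (e - 2) m"
      proof (cases "c = 0")
        case True
        then show ?thesis using xC by (auto intro: L_V')
      next
        case c: False
        have "(x * Cd a (Suc c)) * Cd c c * Td c b \<in> L (e - 2 - 2) m"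
          using Suc.IH[OF xC, of c] Suc.prems False by simp
        then show ?thesis using c by (auto intro: L_V')
      qed
      then show ?thesis unfolding eq using 1 L_add by blast
    qed
  qed
  from this[of x e a a] assms show ?thesis by (cases "b \<le> a") (auto intro: L_mono)
qed

lemma L_Tu:
  assumes "x \<in> L e m" "1 \<le> a" "b \<le> m" "m \<le> n" shows "x * Tu a b \<in> L (e - 2) m"
proof -
  have "x * Cu a c * Tu c b \<in> L (e - 2) m" if "c \<le> b" "x \<in> L e m" "1 \<le> a" "a \<le> c" for x a c e
    using that
  proof (induction c arbitrary: x a e rule: inc_induct)
    case base
    then show ?case using L_Cu assms by simp
  next
    case (step c)
    have "x * Cu a c * Tu c b = x * (Cu a c * C c) * Tu (Suc c) b + V (pr c) * (x * Cu a c * Tu (Suc c) b)"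
      using Tu_left[of c b] step
      by (simp add: T_eq_C distrib_left distrib_right mult.assoc sc_comm')
    also have "Cu a c * C c = Cu a (Suc c)" using Cu_right[of a c] step by simp
    finally have eq: "x * Cu a c * Tu c b = x * Cu a (Suc c) * Tu (Suc c) b + V (pr c) * (x * Cu a c * Tu (Suc c) b)" .
    have 1: "x * Cu a (Suc c) * Tu (Suc c) b \<in> L (e - 2) m" using step by simp
    have "x * Cu a c \<in> L (e - 2) m" using L_Cu step assms by simp
    from step.IH[OF this, of "Suc c"] have "x * Cu a c * Tu (Suc c) b \<in> L (e - 2 - 2) m" by simp
    then have "V (pr c) * (x * Cu a c * Tu (Suc c) b) \<in> L (e - 2) m"
      using step by (auto intro!: L_V')
    then show ?case unfolding eq using 1 L_add by blast
  qed
  from this[of a x e a] assms show ?thesis by (cases "a \<le> b") (auto intro: L_mono)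
qed

text \<open>A run that starts at the new index m costs nothing: its C-part becomes the next factor
  of the monomials, and where the run breaks, q_c outweighs the loss caused by the T-run that is
  left over.\<close>

lemma L_Td_new:
  assumes "x \<in> L e m" "b \<le> Suc m" "Suc m \<le> n" shows "x * Td (Suc m) b \<in> L e (Suc m)"
proof -
  have "x * Cd (Suc m) c * Td c b \<in> L e (Suc m)" if "c \<le> Suc m" "b \<le> c" for c
    using that
  proof (induction c)
    case 0
    then show ?case using L_step assms by simp
  next
    case (Suc c)
    show ?case
    proof (cases "b = Suc c")
      case True
      then show ?thesis using Suc L_step assms by simp
    next
      case False
      have "x * Cd (Suc m) (Suc c) * Td (Suc c) b = x * (Cd (Suc m) (Suc c) * C c) * Td c b + V (pr c) * (x * Cd (Suc m) (Suc c) * Td c b)"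
        using Td_left[of b c] False Suc.prems
        by (simp add: T_eq_C distrib_left distrib_right mult.assoc sc_comm')
      also have "Cd (Suc m) (Suc c) * C c = Cd (Suc m) c" using Cd_right[of c "Suc m"] Suc.prems by simp
      finally have eq: "x * Cd (Suc m) (Suc c) * Td (Suc c) b = x * Cd (Suc m) c * Td c b + V (pr c) * (x * Cd (Suc m) (Suc c) * Td c b)" .
      have 1: "x * Cd (Suc m) c * Td c b \<in> L e (Suc m)" using Suc False by simp
      have xC: "x * Cd (Suc m) (Suc c) \<in> L e (Suc m)" using L_step Suc.prems assms by simp
      have "V (pr c) * (x * Cd (Suc m) (Suc c) * Td c b) \<in> L e (Suc m)"
      proof (cases "c = 0")
        case True
        then show ?thesis using xC by (auto intro: L_V')
      next
        case c: False
        have "x * Cd (Suc m) (Suc c) * Td c b \<in> L (e - 2) (Suc m)"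
          using L_Td[OF xC, of c b] Suc.prems assms by simp
        then show ?thesis using c by (auto intro: L_V')
      qed
      then show ?thesis unfolding eq using 1 L_add by blast
    qed
  qed
  from this[of "Suc m"] assms show ?thesis by simp
qed

lemma L_Td_Cd:
  assumes x: "x \<in> L e m" and "c \<le> Suc m" "d \<le> c" "Suc m \<le> n"
  shows "x * Td (Suc m) c * Cd c d \<in> L e (Suc m)"
  using assms(2,3)
proof (induction c rule: inc_induct)
  case base
  then show ?case using L_step[OF x] by simp
next
  case (step c)
  have "Td (Suc m) c * Cd c d = Td (Suc m) (Suc c) * Cd (Suc c) d + V (pr c) * (Td (Suc m) (Suc c) * Cd c d)"
    using Td_right[of c "Suc m"] Cd_left[of d c] step
    by (simp add: T_eq_C distrib_left distrib_right mult.assoc sc_comm')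
  then have eq: "x * Td (Suc m) c * Cd c d =
      x * Td (Suc m) (Suc c) * Cd (Suc c) d + V (pr c) * (x * Td (Suc m) (Suc c) * Cd c d)"
    by (simp add: distrib_left mult.assoc sc_comm')
  have t: "x * Td (Suc m) (Suc c) \<in> L e (Suc m)" using L_Td_new[OF x] step assms by simp
  have "V (pr c) * (x * Td (Suc m) (Suc c) * Cd c d) \<in> L e (Suc m)"
  proof (cases "c = 0")
    case True
    then show ?thesis using t by (auto intro: L_V')
  next
    case False
    have "x * Td (Suc m) (Suc c) * Cd c d \<in> L (e - 2) (Suc m)"
      using L_Cd[OF t, of c] step assms by simp
    then show ?thesis using False by (auto intro!: L_V')
  qed
  then show ?case unfolding eq using step L_add by simp
qed

text \<open>These are the terms of T_1 T_0 T_1 with a factor C_1, placed between a descending and an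
  ascending run. Through C_1 the two runs merge (\<open>Cd1_Cu2\<close>), and for this reason
  nothing is lost.\<close>

lemma L_Td_C1_Cu:
  assumes x: "x \<in> L e m" and m: "1 \<le> m" "Suc m \<le> n" and h: "2 \<le> h" "h \<le> Suc m"
  shows "x * Td (Suc m) 2 * Cu 1 h \<in> L e (Suc m)"
proof -
  have "x * Td (Suc m) c * (Cd c 1 * Cu 2 h) \<in> L e (Suc m)" if "c \<le> Suc m" "2 \<le> c" for c
    using that
  proof (induction c rule: inc_induct)
    case base
    then show ?case using L_step[OF x, of "h - 1"] Cd1_Cu2[of "Suc m" h] m h by simp
  next
    case (step c)
    have c: "Td (Suc m) c = Td (Suc m) (Suc c) * T c" "Cd (Suc c) 1 = C c * Cd c 1"
      using Td_right[of c "Suc m"] Cd_left[of 1 c] step by auto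
    have eq: "x * Td (Suc m) c * (Cd c 1 * Cu 2 h) =
        x * Td (Suc m) (Suc c) * (Cd (Suc c) 1 * Cu 2 h) + V (pr c) * (x * Td (Suc m) (Suc c) * (Cd c 1 * Cu 2 h))"
      unfolding c by (simp add: T_eq_C distrib_left distrib_right mult.assoc sc_comm')
    have t: "x * Td (Suc m) (Suc c) \<in> L e (Suc m)" using L_Td_new[OF x] step m by simp
    have "x * Td (Suc m) (Suc c) * (Cd c 1 * Cu 2 h) \<in> L (e - 2) (Suc m)"
      unfolding Cd1_Cu2[of c h] using Cd1_Cu2[of c h] L_Cd[OF t, of c] L_Cu[OF t, of "c - 1" h] step m h by simp
    then have "V (pr c) * (x * Td (Suc m) (Suc c) * (Cd c 1 * Cu 2 h)) \<in> L e (Suc m)"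
      using step by (auto intro!: L_V')
    then show ?case unfolding eq using step L_add by simp
  qed
  from this[of 2] show ?thesis using m Cu_left[of 1 h] Cd_right[of 1 2] h by (simp add: numeral_2_eq_2)
qed

lemma L_Td_C1_Tu:
  assumes x: "x \<in> L e m" and m: "1 \<le> m" "Suc m \<le> n" and l: "2 \<le> l" "l \<le> Suc m"
  shows "x * Td (Suc m) 2 * C 1 * Tu 2 l \<in> L e (Suc m)"
proof -
  have "x * Td (Suc m) 2 * Cu 1 c * Tu c l \<in> L e (Suc m)" if "c \<le> l" "2 \<le> c" for c
    using that
  proof (induction c rule: inc_induct)
    case base
    then show ?case using L_Td_C1_Cu[OF x m l] by simp
  next
    case (step c)
    have c: "Tu c l = T c * Tu (Suc c) l" "Cu 1 (Suc c) = Cu 1 c * C c"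
      using Tu_left[of c l] Cu_right[of 1 c] step by auto
    have eq: "x * Td (Suc m) 2 * Cu 1 c * Tu c l =
        x * Td (Suc m) 2 * Cu 1 (Suc c) * Tu (Suc c) l + V (pr c) * (x * Td (Suc m) 2 * Cu 1 c * Tu (Suc c) l)"
      unfolding c by (simp add: T_eq_C distrib_left distrib_right mult.assoc sc_comm')
    have t: "x * Td (Suc m) 2 * Cu 1 c \<in> L e (Suc m)" using L_Td_C1_Cu[OF x m, of c] step l by simp
    have "V (pr c) * (x * Td (Suc m) 2 * Cu 1 c * Tu (Suc c) l) \<in> L e (Suc m)"
      using L_Tu[OF t, of "Suc c" l] step m l by (auto intro!: L_V')
    then show ?case unfolding eq using step L_add by simp
  qed
  from this[of 2] show ?thesis using l by (simp add: numeral_2_eq_2)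
qed

lemma Td_C0_comm: "2 \<le> k \<Longrightarrow> m \<le> n \<Longrightarrow> C 0 * Td m k = Td m k * C 0"
  using Cd_Td_comm[of 1 k m 0] by simp

lemma Tu_C0_comm: "2 \<le> k \<Longrightarrow> m \<le> n \<Longrightarrow> C 0 * Tu k m = Tu k m * C 0"
  unfolding Tu_def Tword_def by (rule commute_prod) (auto intro!: CT_comm)

text \<open>A coset word of the second kind contains T_1 T_0 T_1, expanded by \<open>T101\<close>.
  The five terms carry at least v, v^2, v^2, v^4, v^5 against losses of 0, 1, 1, 3, 2 in the
  exponent: C_0 costs 1, and the ascending T-run costs 2 when no C_1 precedes it. A gain of at least
  v remains in each.\<close>

lemma L_Td0_Tu:
  assumes x: "x \<in> L e m" and m: "1 \<le> m" "Suc m \<le> n" and l: "2 \<le> l" "l \<le> Suc m"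
  shows "x * Td (Suc m) 0 * Tu 1 l \<in> L (e + 1) (Suc m)"
proof -
  let ?D = "Td (Suc m) 2" and ?U = "Tu 2 l"
  have "x * Td (Suc m) 0 * Tu 1 l = x * ?D * (T 1 * T 0 * T 1) * ?U"
    using Td_split[of 0 2 "Suc m"] Td_right[of 0 2] Tu_left[of 1 l] m l
    by (simp add: mult.assoc numeral_2_eq_2)
  also have "\<dots> = (V 1 + V 3) * (x * ?D * C 1 * ?U) + V 2 * (x * ?D * C 1 * (C 0 * ?U))
      + V 2 * (x * (?D * C 0) * C 1 * ?U) + V 4 * (x * (?D * C 0) * ?U) + V 5 * (x * ?D * ?U)"
    using T101 m by (simp add: distrib_left distrib_right mult.assoc sc_comm' add.assoc)
  also have "C 0 * ?U = ?U * C 0" using Tu_C0_comm m l by simp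
  also have "?D * C 0 = C 0 * ?D" using Td_C0_comm m by simp
  finally have eq: "x * Td (Suc m) 0 * Tu 1 l = (V 1 + V 3) * (x * ?D * C 1 * ?U) + V 2 * (x * ?D * C 1 * ?U * C 0)
      + V 2 * (x * C 0 * ?D * C 1 * ?U) + V 4 * (x * C 0 * ?D * ?U) + V 5 * (x * ?D * ?U)"
    by (simp add: mult.assoc)
  have x0: "x * C 0 \<in> L (e - 1) m" using L_C0[OF x] m by simp
  have A: "x * ?D * C 1 * ?U \<in> L e (Suc m)" using L_Td_C1_Tu[OF x m l] .
  have "(V 1 + V 3) * (x * ?D * C 1 * ?U) \<in> L (e + 1) (Suc m)"
    unfolding distrib_right using A by (auto intro!: L_add L_V')
  moreover have "V 2 * (x * ?D * C 1 * ?U * C 0) \<in> L (e + 1) (Suc m)"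
    using L_C0[OF A] m by (auto intro!: L_V')
  moreover have "V 2 * (x * C 0 * ?D * C 1 * ?U) \<in> L (e + 1) (Suc m)"
    using L_Td_C1_Tu[OF x0 m l] by (auto intro!: L_V')
  moreover have "V 4 * (x * C 0 * ?D * ?U) \<in> L (e + 1) (Suc m)"
    using L_Tu[OF L_Td_new[OF x0, of 2], of 2 l] m l by (auto intro!: L_V')
  moreover have "V 5 * (x * ?D * ?U) \<in> L (e + 1) (Suc m)"
    using L_Tu[OF L_Td_new[OF x, of 2], of 2 l] m l by (auto intro!: L_V')
  ultimately show ?thesis unfolding eq by (intro L_add)
qed

subsection \<open>Standard basis elements in the lattice\<close>

lemma Tw_Td:
  assumes "x \<in> weylB m" "k \<le> Suc m" "Suc m \<le> n"
  shows "Tw (x \<circ> word_perm (rev [k..<Suc m])) = Tw x * Td (Suc m) k"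
proof -
  have "x \<in> W" using weylB_mono[of m n] assms by auto
  moreover have "set (rev [k..<Suc m]) \<subseteq> {..<n}" using assms by (auto simp: subset_iff)
  ultimately show ?thesis using Tw_ascends[OF _ _ ascends_down[OF assms(1,2)]] by (simp only: Td_def)
qed

lemma Tw_Td_Tu:
  assumes "x \<in> weylB m" "1 \<le> k" "k \<le> Suc m" "Suc m \<le> n"
  shows "Tw (x \<circ> word_perm (rev [0..<Suc m] @ [1..<k])) = Tw x * Td (Suc m) 0 * Tu 1 k"
proof -
  have "x \<in> W" using weylB_mono[of m n] assms by auto
  moreover have "set (rev [0..<Suc m] @ [1..<k]) \<subseteq> {..<n}" using assms by auto
  ultimately show ?thesis using Tw_ascends[OF _ _ ascends_up[OF assms(1-3)]]
    by (simp only: Tword_simps Td_def Tu_def mult.assoc)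
qed

text \<open>The letters s_(j-1), ..., s_k carry the value at j to the left past smaller values, each
  step being an ascent.\<close>

lemma Tw_Td_increasing:
  assumes x: "x \<in> weylB m" "m \<le> n" and kj: "1 \<le> k" "k \<le> j" "j \<le> m"
    and nd: "\<And>i. k \<le> i \<Longrightarrow> i < j \<Longrightarrow> \<not> descent x i"
  shows "\<exists>z \<in> weylB m. Tw x * Td j k = Tw z"
proof -
  have xW: "x \<in> W" using weylB_mono[of m n] x by auto
  have le: "x (int i) < x (int j)" if "k \<le> i" "i < j" for i
  proof -
    have "Suc i \<le> j" using that by simp
    then show ?thesis
    proof (induction j rule: dec_induct)
      fix l assume l: "Suc i \<le> l" "l < j" "x (int i) < x (int l)"
      have "x (int l) < x (int (Suc l))"
        using nd[of l] weylB_inj[OF x(1), of "int l" "int (Suc l)"] l that kj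
        by (simp add: descent_def lo_def hi_def add.commute)
      then show "x (int i) < x (int (Suc l))" using l by simp
    next
      show "x (int i) < x (int (Suc i))"
        using nd[of i] weylB_inj[OF x(1), of "int i" "int (Suc i)"] that kj
        by (simp add: descent_def lo_def hi_def add.commute)
    qed
  qed
  have "ascends x (rev [i..<j])" if "i \<le> j" "k \<le> i" for i
    using that
  proof (induction i rule: inc_induct)
    case (step i)
    have 1: "word_perm (rev [Suc i..<j]) (hi i) = int j"
      using word_perm_upt[of "Suc i" j] word_perm_rev_eq[of "[Suc i..<j]" "int j" "hi i"] step kj
      by (simp add: hi_def add.commute)
    have "word_perm (rev us) (int i) = int i" if "\<forall>l \<in> set us. i < l" for us
      using that step kj by (induction us rule: rev_induct) (auto simp: s_gen_int)
    then have "word_perm (rev [Suc i..<j]) (lo i) = int i" using step kj by (simp add: lo_def)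
    then have "\<not> descent (x \<circ> word_perm (rev [Suc i..<j])) i"
      using 1 le[of i] step by (simp add: descent_def)
    moreover have "rev [i..<j] = rev [Suc i..<j] @ [i]" using step by (simp add: upt_conv_Cons)
    ultimately show ?case using step by (simp add: ascends_append)
  qed simp
  then have "ascends x (rev [k..<j])" using kj by simp
  then have "Tw x * Td j k = Tw (x \<circ> word_perm (rev [k..<j]))"
    unfolding Td_def using kj x(2) by (intro Tw_ascends[OF xW]) auto
  moreover have "x \<circ> word_perm (rev [k..<j]) \<in> weylB m"
    using kj by (intro weylB_comp[OF x(1)] word_perm_weylB) auto
  ultimately show ?thesis by blast
qed

text \<open>The critical case: a descent of \<open>x\<close> beyond the position of the inserted value. The relation
  for \<open>T\<^sub>j T\<^sub>j\<^sub>+\<^sub>1 T\<^sub>j\<close> leaves a factor \<open>T\<^sub>x\<^sub>s C\<^sub>j = T\<^sub>x - v\<^sup>2 T\<^sub>x\<^sub>s\<close>, and taking the first such descent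
  keeps \<open>T\<^sub>x T\<^sub>j\<^sub>-\<^sub>1 \<cdots> T\<^sub>k\<close> a standard basis element up to a final factor \<open>T\<^sub>0\<close>.\<close>

lemma L_critical:
  assumes IH: "\<And>z. z \<in> weylB m \<Longrightarrow> Tw z \<in> L 0 m"
    and x: "x \<in> weylB m" and m: "Suc m \<le> n"
    and j: "1 \<le> j" "k \<le> j" "j < m" "descent x j"
    and nd: "\<And>i. 1 \<le> i \<Longrightarrow> k \<le> i \<Longrightarrow> i < j \<Longrightarrow> \<not> descent x i"
  shows "Tw x * Td (Suc m) k \<in> L 1 (Suc m)"
proof -
  have xW: "x \<in> W" using weylB_mono[of m n] x m by auto
  define y where "y = x \<circ> s_gen j"
  have y: "y \<in> weylB m" unfolding y_def using x j by (intro weylB_comp s_gen_weylB)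
  have Txy: "Tw x = Tw y * T j" unfolding y_def using Tw_descent_split[OF xW _ j(4)] j m by simp
  let ?D = "Td (Suc m) (Suc (Suc j))" and ?E = "Td j k"
  have split: "Td (Suc m) k = ?D * T (Suc j) * T j * ?E"
    using Td_split[of k j "Suc m"] Td_right[of j "Suc m"] Td_right[of "Suc j" "Suc m"] j by simp
  have Dj: "T j * ?D = ?D * T j" "C j * ?D = ?D * C j"
    using Td_Td_comm[of "Suc j" "Suc (Suc j)" "Suc m" j] Cd_Td_comm[of "Suc j" "Suc (Suc j)" "Suc m" j] m by auto
  have ED: "?E * ?D = ?D * ?E" using Td_Td_comm[of j "Suc (Suc j)" "Suc m" k] m by simp
  have EC: "?E * C (Suc j) = C (Suc j) * ?E"
    using Td_Cd_comm[of j "Suc j" "Suc (Suc j)" k] j m by simp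
  have "Tw x * Td (Suc m) k = Tw y * (T j * ?D) * T (Suc j) * T j * ?E"
    unfolding Txy split by (simp add: mult.assoc)
  also have "\<dots> = Tw y * ?D * (T j * T (Suc j) * T j) * ?E"
    unfolding Dj by (simp add: mult.assoc)
  also have "T j * T (Suc j) * T j = V 2 * (T (Suc j) * T j + C j * C (Suc j))"
    using T_triple[of j "Suc j"] j m by simp
  also have "Tw y * ?D * (V 2 * (T (Suc j) * T j + C j * C (Suc j))) * ?E =
      V 2 * (Tw y * (?D * T (Suc j) * T j * ?E) + Tw y * (?D * C j) * (C (Suc j) * ?E))"
    by (simp add: distrib_left distrib_right mult.assoc sc_comm')
  also have "Tw y * (?D * C j) * (C (Suc j) * ?E) = (Tw y * C j * ?E) * ?D * C (Suc j)"
    unfolding Dj(2)[symmetric] EC[symmetric] using ED by (metis mult.assoc)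
  also have "Tw y * C j = Tw x - V 2 * Tw y"
    using j by (simp add: Txy C_def right_diff_distrib sc_comm)
  finally have eq: "Tw x * Td (Suc m) k =
      V 2 * (Tw y * Td (Suc m) k + (Tw x - V 2 * Tw y) * ?E * ?D * C (Suc j))"
    unfolding split .
  \<comment> \<open>Both terms of the bracket need only lie in v^(-1) times the lattice, as the
    factor v^2 in front lifts them to v.\<close>
  have "Tw y * Td (Suc m) k \<in> L (- 1) (Suc m)"
    using L_mono[OF L_Td_new[OF IH[OF y], of k]] j m by simp
  moreover have "(Tw x - V 2 * Tw y) * ?E \<in> L (- 1) m"
  proof -
    have "V 2 * (Tw y * ?E) \<in> L (- 1) m"
      using L_Td[OF IH[OF y], of j k] j m by (auto intro!: L_V')
    moreover have "Tw x * ?E \<in> L (- 1) m"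
    \<comment> \<open>For k = 0 ascents are known only from index 1 on, so the final letter T_0 =
      C_0 + v is split off; C_0 costs v^(-1), just what is allowed.\<close>
    proof (cases "k = 0")
      case False
      then obtain z where "z \<in> weylB m" "Tw x * ?E = Tw z"
        using Tw_Td_increasing[OF x, of k j] nd j m by auto
      then show ?thesis using L_mono[OF IH[of z], of "- 1"] by simp
    next
      case True
      then obtain z where z: "z \<in> weylB m" "Tw x * Td j 1 = Tw z"
        using Tw_Td_increasing[OF x, of 1 j] nd j m by auto
      have "Tw x * ?E = Tw z * C 0 + V 1 * Tw z"
        using Td_right[of 0 j] True j
        by (simp add: T_eq_C distrib_left sc_comm' sc_comm mult.assoc flip: z(2))
      then show ?thesis using L_C0[OF IH[OF z(1)]] L_V'[OF IH[OF z(1)], of "- 1" 1] j m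
        by (auto intro!: L_add)
    qed
    ultimately show ?thesis by (simp add: left_diff_distrib mult.assoc L_diff)
  qed
  then have "(Tw x - V 2 * Tw y) * ?E * ?D * C (Suc j) \<in> L (- 1) (Suc m)"
    using L_Td_Cd[of "(Tw x - V 2 * Tw y) * ?E" "- 1" m "Suc (Suc j)" "Suc j"] j m by simp
  ultimately have "V 2 * (Tw y * Td (Suc m) k + (Tw x - V 2 * Tw y) * ?E * ?D * C (Suc j)) \<in> L (- 1 + 2) (Suc m)"
    by (intro L_V L_add)
  then show ?thesis unfolding eq by simp
qed

text \<open>For the first kind of coset nothing is lost, and the factor v is inherited from x or
  comes from its first descent at or after the insertion point. For the second kind it comes from
  T_1 T_0 T_1.\<close>

theorem Tw_L:
  "w \<in> weylB m \<Longrightarrow> m \<le> n \<Longrightarrow> Tw w \<in> L 0 m" "w \<in> weylB m \<Longrightarrow> m \<le> n \<Longrightarrow> \<not> avoids w \<Longrightarrow> Tw w \<in> L 1 m"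
proof -
  have "Tw w \<in> L 0 m \<and> (\<not> avoids w \<longrightarrow> Tw w \<in> L 1 m)" if "w \<in> weylB m" "m \<le> n"
    using that
  proof (induction m arbitrary: w)
    case 0
    have "w = id" using weylB_fixes[of w 0] weylB_zero[of w 0] 0(1) by (intro ext) (metis abs_of_nat
      id_apply of_nat_0 zero_less_abs_iff)
    moreover have "(1 :: 'r) \<in> L 0 0" using lat_base[OF lnn_1] by (simp add: L_def)
    moreover have "avoids id" by (auto simp: avoids_def)
    ultimately show ?case by (simp only: Tw_id not_True_eq_False simp_thms)
  next
    case (Suc m)
    have IH: "Tw x \<in> L 0 m" "\<not> avoids x \<Longrightarrow> Tw x \<in> L 1 m" if "x \<in> weylB m" for x
      using Suc.IH[OF that] Suc.prems by auto
    from Suc.prems(1) show ?case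
    proof (cases rule: weylB_decomp)
      case (1 x k)
      have eq: "Tw w = Tw x * Td (Suc m) k" using Tw_Td[OF 1(1,2)] 1(3) Suc.prems by simp
      have "Tw w \<in> L 1 (Suc m)" if na: "\<not> avoids w"
      proof (cases "avoids x")
        case False
        then show ?thesis using L_Td_new[OF IH(2)[OF 1(1)], of k] 1 Suc.prems eq by simp
      next
        case True
        define j where "j = (LEAST j. 1 \<le> j \<and> k \<le> j \<and> j < m \<and> descent x j)"
        have "\<exists>j. 1 \<le> j \<and> k \<le> j \<and> j < m \<and> descent x j"
          using avoids_insert[OF 1(1) True 1(2)] na 1(3) by blast
        from LeastI_ex[OF this] have j: "1 \<le> j" "k \<le> j" "j < m" "descent x j"
          unfolding j_def by blast+
        have nd: "\<not> descent x i" if i: "1 \<le> i" "k \<le> i" "i < j" for i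
          using not_less_Least[OF i(3)[unfolded j_def]] i j by auto
        show ?thesis unfolding eq
          by (rule L_critical[OF IH(1) 1(1) Suc.prems(2) j nd])
      qed
      moreover have "Tw w \<in> L 0 (Suc m)"
        unfolding eq using L_Td_new[OF IH(1)[OF 1(1)]] 1 Suc.prems by simp
      ultimately show ?thesis by blast
    next
      case (2 x k)
      have eq: "Tw w = Tw x * Td (Suc m) 0 * Tu 1 k" using Tw_Td_Tu[OF 2(1) _ 2(3)] 2 Suc.prems by simp
      have "Tw w \<in> L 1 (Suc m)"
        unfolding eq using L_Td0_Tu[OF IH(1)[OF 2(1)]] 2 Suc.prems by simp
      then show ?thesis using L_mono[of "Tw w" 1 "Suc m" 0] by simp
    qed
  qed
  then show "w \<in> weylB m \<Longrightarrow> m \<le> n \<Longrightarrow> Tw w \<in> L 0 m"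
    "w \<in> weylB m \<Longrightarrow> m \<le> n \<Longrightarrow> \<not> avoids w \<Longrightarrow> Tw w \<in> L 1 m" by blast+
qed

abbreviation zspan :: "nat \<Rightarrow> 'r set" where "zspan m \<equiv> lspan lnn (\<lambda>w. w \<in> weylB m)"

lemma zspan_add: "x \<in> lspan lnn P \<Longrightarrow> y \<in> lspan lnn P \<Longrightarrow> x + y \<in> lspan lnn P"
  by (rule lspan_add) (auto intro: lnn_add)

lemma zspan_scale: "x \<in> lspan lnn P \<Longrightarrow> p \<in> lnn \<Longrightarrow> sc p * x \<in> lspan lnn P"
  by (rule lspan_scale) (auto intro: lnn_mult)

lemma lnn_0: "0 \<in> lnn" by (simp add: lnn_def)

lemma zspan_Tw: "w \<in> weylB m \<Longrightarrow> m \<le> n \<Longrightarrow> Tw w \<in> zspan m"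
  using weylB_mono[of m n] by (intro lspan_Tw) (auto intro: lnn_0 lnn_1)

lemma zspan_Td:
  assumes "x \<in> zspan m" "Suc m \<le> n" "k \<le> Suc m" shows "x * Td (Suc m) k \<in> zspan (Suc m)"
proof -
  have "x \<in> {x. x * Td (Suc m) k \<in> zspan (Suc m)}"
  proof (rule lspan_subset[OF assms(1)])
    fix w and p :: laurent assume w: "w \<in> W" "w \<in> weylB m" "p \<in> lnn"
    have "w \<circ> word_perm (rev [k..<Suc m]) \<in> weylB (Suc m)"
      using weylB_mono[of m "Suc m"] w by (intro weylB_comp word_perm_weylB) auto
    from zspan_scale[OF zspan_Tw[OF this assms(2)] w(3)]
    show "sc p * Tw w \<in> {x. x * Td (Suc m) k \<in> zspan (Suc m)}"
      unfolding Tw_Td[OF w(2) assms(3,2)] by (simp add: mult.assoc)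
  qed (auto simp: distrib_right intro: zspan_add lspan_0 lnn_0)
  then show ?thesis by simp
qed

lemma zspan_lat: "x \<in> zspan m \<Longrightarrow> m \<le> n \<Longrightarrow> lat m x"
proof -
  assume x: "x \<in> zspan m" and m: "m \<le> n"
  have 0: "0 \<in> L 0 m" using L_scale[OF Tw_L(1)[OF id_weylB m], of 0] lnn_0 by simp
  have "x \<in> L 0 m"
    by (rule lspan_subset[OF x 0 L_add]) (auto intro: L_scale Tw_L(1) m)
  then show ?thesis by (simp add: lat_L)
qed

text \<open>That the T_w lie in the lattice is \<open>Tw_L\<close>. Conversely C_c = T_c - q_c is
  expanded along the last run; in the correction the unfinished C-run moves to the left of the
  T-run, where q_c = v^2 covers the loss in \<open>L_Cd\<close> and the induction hypothesis for m
  applies. The equality is what turns an element of \<open>L 1\<close> back into v times a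
  combination of standard elements.\<close>

theorem lat_iff_zspan: "m \<le> n \<Longrightarrow> lat m x \<longleftrightarrow> x \<in> zspan m"
proof (rule iffI)
  show "x \<in> zspan m" if "lat m x" "m \<le> n"
    using that
  proof (induction m arbitrary: x)
    case 0
    have "x \<in> zspan 0" if "lat m x" "m = 0" for m
      using that
    proof (induction rule: lat.induct)
      case (lat_base p)
      then show ?case using zspan_scale[OF zspan_Tw[OF id_weylB[of 0]] lat_base(1)] by simp
    qed (auto intro: zspan_add)
    then show ?case using 0 by blast
  next
    case (Suc m)
    have L_zspan: "V (- e) * y \<in> zspan m" if "y \<in> L e m" for y e
      using that Suc by (simp add: L_def)
    have step: "y * Cd (Suc m) k \<in> zspan (Suc m)" if y: "lat m y" and k: "k \<le> Suc m" for y k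
    proof -
      have "y * Td (Suc m) c * Cd c k \<in> zspan (Suc m)" if "k \<le> c" "c \<le> Suc m" for c
        using that
      proof (induction c rule: dec_induct)
        case base
        then show ?case using zspan_Td[of y m k] Suc y by simp
      next
        case (step c)
        have T: "C c = T c - V (pr c)" by (simp add: C_def)
        have "Td (Suc m) (Suc c) * Cd (Suc c) k = Td (Suc m) c * Cd c k - V (pr c) * (Td (Suc m) (Suc c) * Cd c k)"
          using Td_right[of c "Suc m"] Cd_left[of k c] step
          by (simp add: T left_diff_distrib right_diff_distrib mult.assoc sc_comm')
        also have "Td (Suc m) (Suc c) * Cd c k = Cd c k * Td (Suc m) (Suc c)"
          using Cd_Td_comm[of c "Suc c" "Suc m" k] Suc.prems by simp
        finally have eq: "y * Td (Suc m) (Suc c) * Cd (Suc c) k =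
            y * Td (Suc m) c * Cd c k - (V (pr c) * (y * Cd c k)) * Td (Suc m) (Suc c)"
          by (simp add: right_diff_distrib mult.assoc sc_comm')
        have "V (pr c) * (y * Cd c k) \<in> zspan m"
        proof (cases "c = 0")
          case True
          then show ?thesis using Suc y by (auto intro!: zspan_scale lnn_vpow)
        next
          case False
          then show ?thesis using L_zspan[OF L_Cd[of y 0 m c "- 2" k]] y step Suc.prems by (simp add: lat_L)
        qed
        then have "(V (pr c) * (y * Cd c k)) * Td (Suc m) (Suc c) \<in> zspan (Suc m)"
          using zspan_Td step Suc.prems by simp
        from zspan_add[OF _ zspan_scale[OF this lnn_uminus[OF lnn_1]]] show ?case
          unfolding eq using step by (simp add: sc_uminus)
      qed
      from this[of "Suc m"] k show ?thesis by simp
    qed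
    have "x \<in> zspan (Suc m)" if "lat m' x" "m' = Suc m" for m'
      using that by (induction rule: lat.induct) (auto intro: zspan_add step)
    then show ?case using Suc by blast
  qed
qed (rule zspan_lat)

subsection \<open>The standard basis elements avoiding decreasing triples\<close>

lemma Tword_shorter: "set is \<subseteq> {..<n} \<Longrightarrow> length is < k \<Longrightarrow> Tword is \<in> aspan (\<lambda>w. len n w < k)"
  using Tword_aspan[of "is"] by (rule aspan_mono) auto

lemma T101_words:
  assumes "2 \<le> n"
  shows "T 1 * T 0 * T 1 = V 2 * (T 1 * T 0) + V 2 * (T 0 * T 1) + (V 1 - V 3) * T 1 - V 4 * T 0 + (V 5 - V 3)"
  unfolding T101[OF assms] using sc_comm[of "T 0" "vpow 2"] sc_comm[of "T 1" "vpow 1"]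
  by (simp add: C_def algebra_simps V_mult)

text \<open>Coefficients are arbitrary Laurent polynomials here, since the shorter words may fail to
  be reduced. This provides spanning by avoiding elements; integrality is a separate matter, settled
  in \<open>Tw_zspan_avoids\<close>.\<close>

lemma braid_word_lower:
  assumes "1 \<le> i" "i < n" "j < n" "\<bar>int i - int j\<bar> = 1" "set us \<subseteq> {..<n}" "set vs \<subseteq> {..<n}"
  shows "Tword (us @ [i, j, i] @ vs) \<in> aspan (\<lambda>w. len n w < length us + 3 + length vs)"
proof -
  let ?P = "\<lambda>w. len n w < length us + 3 + length vs"
  have w: "sc p * (Tword us * Tword is * Tword vs) \<in> aspan ?P" if "set is \<subseteq> {..<n}" "length is < 3" for p "is"
    using Tword_shorter[of "us @ is @ vs"] that assms by (intro aspan_scale) (simp add: mult.assoc)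
  show ?thesis
  proof (cases "j = 0")
    case True
    then have i: "i = 1" using assms by linarith
    have "Tword (us @ [i, j, i] @ vs) = Tword us * (T 1 * T 0 * T 1) * Tword vs"
      using i True by (simp add: mult.assoc)
    also have "\<dots> = sc (vpow 2) * (Tword us * Tword [1, 0] * Tword vs) + sc (vpow 2) * (Tword us * Tword [0, 1] * Tword vs)
       + sc (vpow 1 - vpow 3) * (Tword us * Tword [1] * Tword vs) + sc (- vpow 4) * (Tword us * Tword [0] * Tword vs)
       + sc (vpow 5 - vpow 3) * (Tword us * Tword [] * Tword vs)"
      using T101_words assms i
      by (simp add: distrib_left distrib_right left_diff_distrib right_diff_distrib sc_comm' sc_comm sc_diff sc_uminus mult.assoc)
    also have "\<dots> \<in> aspan ?P" using i assms True by (intro aspan_add w) auto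
    finally show ?thesis .
  next
    case False
    then have ij: "1 \<le> j" "j = Suc i \<or> i = Suc j" using assms by auto
    have t: "T i * T j * T i = V 2 * (T i * T j) + V 2 * (T j * T i) - V 4 * T i - V 4 * T j + V 6"
      using TL_expand[of i j] TL[of i j] assms ij by (simp add: algebra_simps)
    have "Tword (us @ [i, j, i] @ vs) = Tword us * (T i * T j * T i) * Tword vs"
      by (simp add: mult.assoc)
    also have "\<dots> = sc (vpow 2) * (Tword us * Tword [i, j] * Tword vs) + sc (vpow 2) * (Tword us * Tword [j, i] * Tword vs)
       + sc (- vpow 4) * (Tword us * Tword [i] * Tword vs) + sc (- vpow 4) * (Tword us * Tword [j] * Tword vs)
       + sc (vpow 6) * (Tword us * Tword [] * Tword vs)"
      unfolding t
      by (simp add: distrib_left distrib_right left_diff_distrib right_diff_distrib sc_comm' sc_comm sc_uminus mult.assoc)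
    also have "\<dots> \<in> aspan ?P" using assms by (intro aspan_add w) auto
    finally show ?thesis .
  qed
qed

lemma Tw_lower:
  assumes "w \<in> W" "\<not> avoids w" shows "Tw w \<in> aspan (\<lambda>z. len n z < len n w)"
proof -
  obtain us i j vs where b: "1 \<le> i" "i < n" "j < n" "\<bar>int i - int j\<bar> = 1"
    "reduced n (us @ [i, j, i] @ vs)" "word_perm (us @ [i, j, i] @ vs) = w"
    using not_avoids_braid_word[OF assms(1) order_refl assms(2)] by blast
  have "Tword (us @ [i, j, i] @ vs) = Tw w" using Tword_reduced[OF b(5)] unfolding b(6) .
  moreover have "len n w = length us + 3 + length vs" "set us \<subseteq> {..<n}" "set vs \<subseteq> {..<n}"
    using b(5) unfolding reduced_def b(6) by auto
  ultimately show ?thesis using braid_word_lower[OF b(1-4), of us vs] by simp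
qed

lemma aspan_avoids: "x \<in> aspan (\<lambda>z. len n z < k) \<Longrightarrow> x \<in> aspan (\<lambda>z. avoids z \<and> len n z < k)"
proof (induction k arbitrary: x rule: less_induct)
  case (less k)
  show ?case
  proof (rule aspan_induct[OF less.prems aspan_0 aspan_add aspan_scale])
    fix w assume w: "w \<in> W" "len n w < k"
    show "Tw w \<in> aspan (\<lambda>z. avoids z \<and> len n z < k)"
    proof (cases "avoids w")
      case True
      then show ?thesis using w by (auto intro: aspan_Tw)
    next
      case False
      show ?thesis
        by (rule aspan_mono[OF less.IH[OF w(2) Tw_lower[OF w(1) False]]]) (use w in auto)
    qed
  qed
qed

lemma aspan_avoids_all: "x \<in> aspan P \<Longrightarrow> x \<in> aspan avoids"
proof (rule aspan_induct[OF _ aspan_0 aspan_add aspan_scale])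
  fix w assume "w \<in> W"
  then have "Tw w \<in> aspan (\<lambda>z. avoids z \<and> len n z < Suc (len n w))"
    by (intro aspan_avoids aspan_Tw) auto
  then show "Tw w \<in> aspan avoids" by (rule aspan_mono) auto
qed

text \<open>Every \<open>T\<^sub>w\<close> lies in \<open>M + v M'\<close> where \<open>M\<close> is the \<open>\<int>[v]\<close>-span of the \<open>T\<^sub>y\<close> with \<open>y\<close> avoiding
  and \<open>M'\<close> the \<open>\<int>[v]\<close>-span of all \<open>T\<^sub>w\<close>; iterate until the powers of \<open>v\<close> clear all denominators.\<close>

theorem Tw_zspan_avoids: assumes "w \<in> W" shows "Tw w \<in> lspan lnn avoids"
proof -
  let ?M = "lspan lnn avoids"
  have Madd: "x + y \<in> ?M" if "x \<in> ?M" "y \<in> ?M" for x y using zspan_add that .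
  have clear: "\<exists>k \<ge> 0. V k * x \<in> ?M" if "x \<in> aspan avoids" for x
  proof -
    have "x \<in> {x. \<exists>k \<ge> 0. V k * x \<in> ?M}" using that
    proof (rule aspan_induct)
      show "0 \<in> {x. \<exists>k \<ge> 0. V k * x \<in> ?M}" using lspan_0[OF lnn_0] by auto
    next
      fix x y assume "x \<in> {x. \<exists>k \<ge> 0. V k * x \<in> ?M}" "y \<in> {x. \<exists>k \<ge> 0. V k * x \<in> ?M}"
      then obtain j k where jk: "j \<ge> 0" "V j * x \<in> ?M" "k \<ge> 0" "V k * y \<in> ?M" by blast
      have "V (j + k) * (x + y) = V k * (V j * x) + V j * (V k * y)"
        by (simp add: V_mult distrib_left add.commute)
      also have "\<dots> \<in> ?M" by (intro Madd zspan_scale[OF jk(2)] zspan_scale[OF jk(4)] lnn_vpow jk)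
      finally have "V (j + k) * (x + y) \<in> ?M" .
      moreover have "0 \<le> j + k" using jk by simp
      ultimately show "x + y \<in> {x. \<exists>k \<ge> 0. V k * x \<in> ?M}" by blast
    next
      fix x p assume "x \<in> {x. \<exists>k \<ge> 0. V k * x \<in> ?M}"
      then obtain j where j: "j \<ge> 0" "V j * x \<in> ?M" by blast
      obtain k where k: "k \<ge> 0" "vpow k * p \<in> lnn" using vpow_clears by blast
      have "vpow (j + k) * p = (vpow k * p) * vpow j" by (simp only: vpow_add[symmetric] ac_simps)
      then have "V (j + k) * sc p = sc (vpow k * p) * V j" by (simp only: flip: sc_mult)
      then have "V (j + k) * (sc p * x) = sc (vpow k * p) * (V j * x)" by (metis mult.assoc)
      also have "\<dots> \<in> ?M" by (intro zspan_scale[OF j(2)] k)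
      finally have "V (j + k) * (sc p * x) \<in> ?M" .
      moreover have "0 \<le> j + k" using j k by simp
      ultimately show "sc p * x \<in> {x. \<exists>k \<ge> 0. V k * x \<in> ?M}" by blast
    next
      fix w assume "w \<in> W" "avoids w"
      then show "Tw w \<in> {x. \<exists>k \<ge> 0. V k * x \<in> ?M}"
        by (auto intro!: exI[of _ 0] lspan_Tw lnn_0 lnn_1)
    qed
    then show ?thesis by simp
  qed
  have "\<forall>w \<in> W. \<exists>k \<ge> 0. V k * Tw w \<in> ?M"
    using clear aspan_avoids_all aspan_Tw[of _ "\<lambda>_. True"] by blast
  then obtain d where d: "\<And>w. w \<in> W \<Longrightarrow> d w \<ge> 0" "\<And>w. w \<in> W \<Longrightarrow> V (d w) * Tw w \<in> ?M" by metis
  \<comment> \<open>A single exponent that clears the denominators of all T_w; it exists because the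
    group is finite.\<close>
  define K where "K = nat (Max (d ` W))"
  have K: "V (int K) * Tw w \<in> ?M" if w: "w \<in> W" for w
  proof -
    have "d w \<le> Max (d ` W)" using w finite_weylB by (intro Max_ge) auto
    then have "d w \<le> int K" unfolding K_def by linarith
    then have "V (int K) * Tw w = V (int K - d w) * (V (d w) * Tw w)" by (simp add: V_mult)
    also have "\<dots> \<in> ?M" using \<open>d w \<le> int K\<close> by (intro zspan_scale[OF d(2)[OF w]] lnn_vpow) auto
    finally show ?thesis .
  qed
  have "\<exists>y z. Tw w = y + V (int k) * z \<and> y \<in> ?M \<and> z \<in> zspan n" if "w \<in> W" for w k
    using that
  proof (induction k arbitrary: w)
    case 0
    then show ?case using zspan_Tw[of w n] lspan_0[OF lnn_0] by (intro exI[of _ 0] exI[of _ "Tw w"]) simp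
  next
    case (Suc k)
    let ?X = "{x. \<exists>y z. x = y + V (int k) * z \<and> y \<in> ?M \<and> z \<in> zspan n}"
    have X0: "0 \<in> ?X" using lspan_0[OF lnn_0] by (intro CollectI exI[of _ 0]) simp
    have Xadd: "x + x' \<in> ?X" if xx: "x \<in> ?X" "x' \<in> ?X" for x x'
    proof -
      obtain y z where "x = y + V (int k) * z" "y \<in> ?M" "z \<in> zspan n" using xx(1) by blast
      moreover obtain y' z' where "x' = y' + V (int k) * z'" "y' \<in> ?M" "z' \<in> zspan n" using xx(2) by blast
      ultimately show ?thesis
        by (intro CollectI exI[of _ "y + y'"] exI[of _ "z + z'"]) (simp add: distrib_left zspan_add)
    qed
    have Xsc: "sc p * x \<in> ?X" if xp: "x \<in> ?X" "p \<in> lnn" for p x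
    proof -
      obtain y z where "x = y + V (int k) * z" "y \<in> ?M" "z \<in> zspan n" using xp(1) by blast
      then show ?thesis using xp(2) sc_comm'[of "V (int k)" p z]
        by (intro CollectI exI[of _ "sc p * y"] exI[of _ "sc p * z"]) (simp add: distrib_left zspan_scale)
    qed
    show ?case
    proof (cases "avoids w")
      case True
      then show ?thesis using Suc.prems lspan_0[OF lnn_0]
        by (intro exI[of _ "Tw w"] exI[of _ 0]) (auto intro: lspan_Tw lnn_0 lnn_1)
    next
      case False
      then have "lat n (V (- 1) * Tw w)" using Tw_L(2)[OF Suc.prems] by (simp add: L_def)
      then have u: "V (- 1) * Tw w \<in> zspan n" using lat_iff_zspan by blast
      have "V (- 1) * Tw w \<in> ?X"
        by (rule lspan_subset[OF u X0 Xadd Xsc]) (use Suc.IH in blast)+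
      then obtain y z where yz: "V (- 1) * Tw w = y + V (int k) * z" "y \<in> ?M" "z \<in> zspan n" by blast
      have "Tw w = V 1 * (V (- 1) * Tw w)" by (simp add: V_mult)
      also have "\<dots> = V 1 * y + V (int (Suc k)) * z" unfolding yz(1) by (simp add: distrib_left V_mult)
      finally show ?thesis using yz zspan_scale[OF yz(2) lnn_vpow[of 1]]
        by (intro exI[of _ "V 1 * y"] exI[of _ z]) simp
    qed
  qed
  from this[OF assms, of K] obtain y z where yz: "Tw w = y + V (int K) * z" "y \<in> ?M" "z \<in> zspan n" by blast
  have "V (int K) * z \<in> ?M"
  proof -
    have "z \<in> {z. V (int K) * z \<in> ?M}"
    proof (rule lspan_subset[OF yz(3)])
      fix w and p :: laurent assume "w \<in> W" "p \<in> lnn"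
      then show "sc p * Tw w \<in> {z. V (int K) * z \<in> ?M}"
        using zspan_scale[OF K, of w p] sc_comm'[of "V (int K)" p "Tw w"] by simp
    qed (auto simp: distrib_left intro: zspan_add lspan_0 lnn_0)
    then show ?thesis by simp
  qed
  then show ?thesis unfolding yz(1) using yz(2) Madd by blast
qed

theorem Tw_lpos_avoids: assumes "w \<in> W" "\<not> avoids w" shows "Tw w \<in> lspan lpos avoids"
proof -
  have "lat n (V (- 1) * Tw w)" using Tw_L(2)[OF assms(1) order_refl assms(2)] by (simp add: L_def)
  then have u: "V (- 1) * Tw w \<in> zspan n" using lat_iff_zspan by blast
  have "V (- 1) * Tw w \<in> lspan lnn avoids"
    by (rule lspan_subset[OF u]) (auto intro: zspan_add zspan_scale Tw_zspan_avoids lspan_0 lnn_0)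
  then have "V 1 * (V (- 1) * Tw w) \<in> lspan lpos avoids"
    by (rule lspan_scale[rotated]) (auto simp: lpos_iff)
  then show ?thesis by (simp add: V_mult)
qed

end

section \<open>Evaluation of free polynomials\<close>

text \<open>The scalars pass through \<open>s\<close>, which need not be linear over the coefficient
  ring; \<open>bar_poly\<close> uses the conjugated scalars.\<close>

definition ev :: "(laurent \<Rightarrow> 'r :: ring_1) \<Rightarrow> (nat \<Rightarrow> 'r) \<Rightarrow> free_poly \<Rightarrow> 'r" where
  "ev s \<phi> p = (\<Sum>w \<in> Poly_Mapping.keys p. s (Poly_Mapping.lookup p w) * prod_list (map \<phi> (letters w)))"

lemma single_word: "Poly_Mapping.single (Word is) c = scalar c * prod_list (map gen is)"
proof (induction "is" arbitrary: c rule: rev_induct)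
  case (snoc i "is")
  have "Poly_Mapping.single (Word (is @ [i])) c = Poly_Mapping.single (Word is) c * gen i"
    by (simp add: gen_def mult_single plus_word_def)
  then show ?case by (simp add: snoc mult.assoc)
qed (simp add: scalar_def zero_word_def)

lemma free_poly_induct [case_names word add]:
  assumes "\<And>c is. P (scalar c * prod_list (map gen is))" "\<And>p q. P p \<Longrightarrow> P q \<Longrightarrow> P (p + q)"
  shows "P (p :: free_poly)"
proof (induction p rule: poly_mapping_single_induct)
  case zero
  then show ?case using assms(1)[of 0 "[]"] by (simp add: scalar_def)
next
  case (single w c)
  then show ?case using assms(1)[of c "letters w"] single_word[of "letters w" c] by simp
qed (rule assms(2))

lemma scalar_add: "scalar (c + d) = scalar c + scalar d"
  by (simp add: scalar_def single_add)

lemma scalar_mult: "scalar (c * d) = scalar c * scalar d"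
  by (simp add: scalar_def mult_single)

lemma scalar_1 [simp]: "scalar 1 = 1" and scalar_0 [simp]: "scalar 0 = 0"
  by (simp_all add: scalar_def)

lemma scalar_comm: "p * scalar c = scalar c * p"
  by (induction p rule: poly_mapping_single_induct)
    (simp_all add: scalar_def mult_single distrib_left distrib_right mult.commute)

locale evaluation =
  fixes s :: "laurent \<Rightarrow> 'r :: ring_1" and \<phi> :: "nat \<Rightarrow> 'r"
  assumes s_add: "s (p + q) = s p + s q" and s_mult: "s (p * q) = s p * s q" and s_1: "s 1 = 1"
    and s_comm: "\<phi> i * s p = s p * \<phi> i"
begin

lemma s_0: "s 0 = 0"
  using s_add[of 0 0] by simp

lemma ev_superset:
  assumes "finite X" "Poly_Mapping.keys p \<subseteq> X"
  shows "ev s \<phi> p = (\<Sum>w \<in> X. s (Poly_Mapping.lookup p w) * prod_list (map \<phi> (letters w)))"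
  unfolding ev_def using assms
  by (intro sum.mono_neutral_left) (auto simp: in_keys_iff s_0)

lemma ev_add: "ev s \<phi> (p + q) = ev s \<phi> p + ev s \<phi> q"
proof -
  let ?X = "Poly_Mapping.keys p \<union> Poly_Mapping.keys q"
  have "finite ?X" by simp
  from ev_superset[OF this, of p] ev_superset[OF this, of q] ev_superset[OF this, of "p + q"]
  show ?thesis using Poly_Mapping.keys_add[of p q]
    by (simp add: lookup_add s_add distrib_right sum.distrib)
qed

lemma ev_0: "ev s \<phi> 0 = 0"
  by (simp add: ev_def)

lemma ev_uminus: "ev s \<phi> (- p) = - ev s \<phi> p"
  using ev_add[of p "- p"] by (simp add: ev_0 eq_neg_iff_add_eq_0 add.commute)

lemma ev_diff: "ev s \<phi> (p - q) = ev s \<phi> p - ev s \<phi> q"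
  using ev_add[of p "- q"] by (simp add: ev_uminus)

lemma ev_single: "ev s \<phi> (Poly_Mapping.single w c) = s c * prod_list (map \<phi> (letters w))"
  by (cases "c = 0") (simp_all add: ev_def s_0)

lemma ev_gen: "ev s \<phi> (gen i) = \<phi> i"
  by (simp add: gen_def ev_single s_1)

lemma ev_scalar: "ev s \<phi> (scalar c) = s c"
  by (simp add: scalar_def ev_single zero_word_def)

lemma prod_s_comm: "prod_list (map \<phi> is) * s p = s p * prod_list (map \<phi> is)"
  by (induction "is") (simp_all add: mult.assoc, simp add: s_comm flip: mult.assoc)

lemma ev_mult: "ev s \<phi> (p * q) = ev s \<phi> p * ev s \<phi> q"
proof (induction p rule: poly_mapping_single_induct)
  case (single u c)
  show ?case
  proof (induction q rule: poly_mapping_single_induct)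
    case (single w d)
    show ?case using prod_s_comm[of "letters u" d]
      by (simp add: mult_single ev_single plus_word_def s_mult mult.assoc)
         (simp flip: mult.assoc)
  qed (simp_all add: ev_0 ev_add distrib_left)
qed (simp_all add: ev_0 ev_add distrib_right)

lemma ev_1: "ev s \<phi> 1 = 1"
  using ev_scalar[of 1] by (simp add: s_1)

lemma ev_prod: "ev s \<phi> (prod_list (map gen is)) = prod_list (map \<phi> is)"
  by (induction "is") (simp_all add: ev_1 ev_mult ev_gen)

lemma ev_sum: "ev s \<phi> (\<Sum>x \<in> X. f x) = (\<Sum>x \<in> X. ev s \<phi> (f x))"
  by (induction X rule: infinite_finite_induct) (simp_all add: ev_0 ev_add)

lemmas ev_simps = ev_add ev_0 ev_uminus ev_diff ev_gen ev_scalar ev_mult ev_1 ev_prod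

end

section \<open>Additive endomorphisms\<close>

text \<open>As a \<open>ring_1\<close> the operators are a possible target of \<open>ev\<close>. The
  sort \<open>zero_neq_one\<close> on the base type is there to make the identity differ from
  zero.\<close>

typedef (overloaded) 'a endo = "{f :: 'a :: {ab_group_add, zero_neq_one} \<Rightarrow> 'a. \<forall>x y. f (x + y) = f x + f y}"
  morphisms app Endo by (rule exI[of _ id]) simp

setup_lifting type_definition_endo

instantiation endo :: ("{ab_group_add, zero_neq_one}") ring_1
begin

lift_definition zero_endo :: "'a endo" is "\<lambda>_. 0" by simp
lift_definition one_endo :: "'a endo" is "\<lambda>x. x" by simp
lift_definition plus_endo :: "'a endo \<Rightarrow> 'a endo \<Rightarrow> 'a endo" is "\<lambda>f g x. f x + g x"
  by (simp add: algebra_simps)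
lift_definition minus_endo :: "'a endo \<Rightarrow> 'a endo \<Rightarrow> 'a endo" is "\<lambda>f g x. f x - g x"
  by (simp add: algebra_simps)
lift_definition uminus_endo :: "'a endo \<Rightarrow> 'a endo" is "\<lambda>f x. - f x"
  by (simp add: algebra_simps)
lift_definition times_endo :: "'a endo \<Rightarrow> 'a endo \<Rightarrow> 'a endo" is "\<lambda>f g x. f (g x)"
  by simp

instance
proof
  fix a b c :: "'a endo"
  show "(a + b) * c = a * c + b * c" by transfer (simp add: fun_eq_iff)
  show "(0 :: 'a endo) \<noteq> 1" by transfer (metis zero_neq_one)
qed (transfer; simp add: fun_eq_iff algebra_simps)+

end

lemma endo_eqI: "(\<And>x. app f x = app g x) \<Longrightarrow> f = g"
  by (metis app_inject ext)

lemma app_simps: "app 0 x = 0" "app 1 x = x" "app (f + g) x = app f x + app g x"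
  "app (f - g) x = app f x - app g x" "app (- f) x = - app f x" "app (f * g) x = app f (app g x)"
  by (transfer; simp)+

section \<open>The permutation modules\<close>

text \<open>The Hecke algebra acts on functions on odd maps \<open>f :: int \<Rightarrow> int\<close>: the generator \<open>T\<^sub>i\<close> compares
  the two values of \<open>f\<close> that \<open>s\<^sub>i\<close> exchanges.  On maps outside \<open>P\<close> every \<open>T\<^sub>i\<close> acts by its
  eigenvalue \<open>q\<^sub>i\<close>.\<close>

definition cmp :: "int \<Rightarrow> int \<Rightarrow> int \<Rightarrow> laurent" where
  "cmp k x y = (if x < y then 0 else if x = y then vpow k - 1 else vpow k - vpow (- k))"

type_synonym module = "(int \<Rightarrow> int) \<Rightarrow> laurent"

text \<open>On a tie \<open>f \<circ> s_gen i = f\<close> for odd f, and the value v^k - 1 of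
  \<open>cmp\<close> makes the operator act at f by v^k. Off ties the formula is that of the regular
  representation.\<close>

definition op0 :: "int \<Rightarrow> int \<Rightarrow> nat \<Rightarrow> module \<Rightarrow> module" where
  "op0 a b i g f = g (f \<circ> s_gen i) + cmp (param a b i) (f (lo i)) (f (hi i)) * g f"

definition T_op :: "((int \<Rightarrow> int) \<Rightarrow> bool) \<Rightarrow> int \<Rightarrow> int \<Rightarrow> nat \<Rightarrow> module endo" where
  "T_op P a b i = Endo (\<lambda>g f. if P f then op0 a b i g f else vpow (param a b i) * g f)"

definition S_op :: "laurent \<Rightarrow> module endo" where "S_op c = Endo (\<lambda>g f. c * g f)"

lemma app_T_op: "app (T_op P a b i) g f = (if P f then op0 a b i g f else vpow (param a b i) * g f)"
  unfolding T_op_def by (subst Endo_inverse) (auto simp: fun_eq_iff op0_def algebra_simps)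

lemma app_S_op: "app (S_op c) g f = c * g f"
  unfolding S_op_def by (subst Endo_inverse) (auto simp: fun_eq_iff algebra_simps)

lemma evaluation_T_op: "evaluation S_op (T_op P a b)"
proof
  fix p q :: laurent and i :: nat
  show "S_op (p + q) = S_op p + S_op q" "S_op (p * q) = S_op p * S_op q" "S_op 1 = 1"
    by (rule endo_eqI, simp add: fun_eq_iff app_simps app_S_op algebra_simps)+
  show "T_op P a b i * S_op p = S_op p * T_op P a b i"
    by (rule endo_eqI) (auto simp: fun_eq_iff app_simps app_T_op app_S_op op0_def algebra_simps)
qed

interpretation T_op: evaluation S_op "T_op P a b" for P a b
  by (rule evaluation_T_op)

text \<open>Isolates the three entries, with their negatives, that neighbouring generators touch, so
  that each relation becomes a finite check over the relative orders of x, y, z.\<close>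

definition put :: "nat \<Rightarrow> (int \<Rightarrow> int) \<Rightarrow> int \<Rightarrow> int \<Rightarrow> int \<Rightarrow> int \<Rightarrow> int" where
  "put i f x y z k = (if k = int i then x else if k = int i + 1 then y else if k = int i + 2 then z
     else if k = - int i then - x else if k = - int i - 1 then - y else if k = - int i - 2 then - z else f k)"

lemma put_self:
  assumes "odd_fun f" shows "put i f (f (int i)) (f (int i + 1)) (f (int i + 2)) = f"
proof
  fix k
  show "put i f (f (int i)) (f (int i + 1)) (f (int i + 2)) k = f k"
    using odd_funD[OF assms, of "int i"] odd_funD[OF assms, of "int i + 1"] odd_funD[OF assms, of "int i + 2"]
    by (simp add: put_def)
qed

lemma put_comp:
  assumes "1 \<le> i"
  shows "put i f x y z \<circ> s_gen i = put i f y x z"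
    and "put i f x y z \<circ> s_gen (Suc i) = put i f x z y"
    and "i = 1 \<Longrightarrow> put i f x y z \<circ> s_gen 0 = put i f (- x) y z"
proof -
  have s: "s_gen j k = (if k = int j then int j + 1 else if k = int j + 1 then int j else
     if k = - int j then - int j - 1 else if k = - int j - 1 then - int j else k)" if "1 \<le> j" for j k
    using that by (auto simp: s_gen_eq_refl refl_def lo_def hi_def)
  have s0: "s_gen 0 k = (if k = 1 then - 1 else if k = - 1 then 1 else k)" for k
    by (auto simp: s_gen_eq_refl refl_def lo_def hi_def)
  show "put i f x y z \<circ> s_gen i = put i f y x z"
    using assms by (auto simp: fun_eq_iff put_def s)
  show "put i f x y z \<circ> s_gen (Suc i) = put i f x z y"
    using assms by (auto simp: fun_eq_iff put_def s)
  show "put i f x y z \<circ> s_gen 0 = put i f (- x) y z" if "i = 1"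
    using that by (auto simp: fun_eq_iff put_def s0)
qed

lemma op0_put:
  assumes "1 \<le> i"
  shows "op0 a b i g (put i f x y z) = g (put i f y x z) + cmp a x y * g (put i f x y z)"
    and "op0 a b (Suc i) g (put i f x y z) = g (put i f x z y) + cmp a y z * g (put i f x y z)"
    and "i = 1 \<Longrightarrow> op0 a b 0 g (put i f x y z) = g (put i f (- x) y z) + cmp b (- x) x * g (put i f x y z)"
  using assms by (simp_all add: op0_def put_comp, simp_all add: param_def lo_def hi_def put_def)

lemma vpow_inverse: "vpow k * vpow (- k) = 1" "vpow k * (vpow (- k) * x) = x"
  "vpow (- k) * vpow k = 1" "vpow (- k) * (vpow k * x) = x"
  by (simp_all add: vpow_add)

lemma cmp_cases:
  "x < y \<Longrightarrow> cmp k x y = 0" "cmp k x x = vpow k - 1" "y < x \<Longrightarrow> cmp k x y = vpow k - vpow (- k)"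
  by (auto simp: cmp_def)

lemma op0_braid3:
  assumes "odd_fun f" "1 \<le> i"
  shows "op0 a b i (op0 a b (Suc i) (op0 a b i g)) f = op0 a b (Suc i) (op0 a b i (op0 a b (Suc i) g)) f"
proof -
  define q q' where q: "q = vpow a" "q' = vpow (- a)"
  have qq: "q' * q = 1" "q' * (q * x) = x" for x by (simp_all add: q vpow_add)
  define G where "G x y z = g (put i f x y z)" for x y z
  have "op0 a b i (op0 a b (Suc i) (op0 a b i g)) (put i f x y z) =
    op0 a b (Suc i) (op0 a b i (op0 a b (Suc i) g)) (put i f x y z)" for x y z
    unfolding op0_put(1,2)[OF assms(2)] G_def[symmetric]
    by (cases x y rule: linorder_cases; cases y z rule: linorder_cases; cases x z rule: linorder_cases)
       (simp_all add: cmp_cases algebra_simps qq flip: q)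
  from this[of "f (int i)" "f (int i + 1)" "f (int i + 2)"] show ?thesis
    unfolding put_self[OF assms(1)] .
qed

text \<open>The signs of x and y together with the comparisons of x with y and with -y decide every
  case of \<open>cmp\<close> that occurs.\<close>

lemma op0_braid4:
  assumes "odd_fun f"
  shows "op0 a b 0 (op0 a b 1 (op0 a b 0 (op0 a b 1 g))) f = op0 a b 1 (op0 a b 0 (op0 a b 1 (op0 a b 0 g))) f"
proof -
  define q q' where q: "q = vpow a" "q' = vpow (- a)"
  define r r' where r: "r = vpow b" "r' = vpow (- b)"
  have qq: "q' * q = 1" "q' * (q * x) = x" "r' * r = 1" "r' * (r * x) = x" for x
    by (simp_all add: q r vpow_add)
  define G where "G x y z = g (put 1 f x y z)" for x y z
  have "op0 a b 0 (op0 a b 1 (op0 a b 0 (op0 a b 1 g))) (put 1 f x y z) =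
    op0 a b 1 (op0 a b 0 (op0 a b 1 (op0 a b 0 g))) (put 1 f x y z)" for x y z
    unfolding op0_put(1)[OF order_refl] op0_put(3)[OF order_refl refl] G_def[symmetric] minus_minus
    by (cases x "0 :: int" rule: linorder_cases; cases y "0 :: int" rule: linorder_cases;
        cases x y rule: linorder_cases; cases x "- y" rule: linorder_cases)
       (simp_all add: cmp_cases algebra_simps qq flip: q r)
  from this[of "f (int 1)" "f (int 1 + 1)" "f (int 1 + 2)"] show ?thesis
    unfolding put_self[OF assms(1)] .
qed

lemma op0_comm:
  assumes "i + 1 < j" shows "op0 a b i (op0 a b j g) f = op0 a b j (op0 a b i g) f"
proof -
  have c: "f \<circ> s_gen i \<circ> s_gen j = f \<circ> s_gen j \<circ> s_gen i"
    by (simp only: comp_assoc s_gen_commute[OF assms])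
  have v: "(f \<circ> s_gen i) (lo j) = f (lo j)" "(f \<circ> s_gen i) (hi j) = f (hi j)"
    "(f \<circ> s_gen j) (lo i) = f (lo i)" "(f \<circ> s_gen j) (hi i) = f (hi i)"
    using s_gen_far[OF assms] by simp_all
  show ?thesis unfolding op0_def v c by (simp add: algebra_simps)
qed

lemma comp_s_gen_tie:
  assumes "odd_fun f" "f (lo i) = f (hi i)" shows "f \<circ> s_gen i = f"
  using assms odd_funD[OF assms(1), of "lo i"] odd_funD[OF assms(1), of "hi i"]
  by (auto simp: fun_eq_iff s_gen_eq_refl refl_def)

lemma op0_quad:
  assumes "odd_fun f"
  shows "op0 a b i (op0 a b i g) f = g f + (vpow (param a b i) - vpow (- param a b i)) * op0 a b i g f"
proof -
  have 1: "f \<circ> s_gen i \<circ> s_gen i = f" by (simp only: comp_assoc s_gen_comp_self comp_id)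
  have 2: "(f \<circ> s_gen i) (lo i) = f (hi i)" "(f \<circ> s_gen i) (hi i) = f (lo i)" by simp_all
  show ?thesis unfolding op0_def 1 2
    by (cases "f (lo i)" "f (hi i)" rule: linorder_cases)
       (simp_all add: cmp_cases comp_s_gen_tie[OF assms] algebra_simps vpow_inverse)
qed

text \<open>\<open>c i g\<close> vanishes at every f with a tie at i, and among three entries from
  {1, -1} two always agree; the relation is checked on the eight sign patterns.\<close>

lemma op0_TL:
  assumes "odd_fun f" "\<And>k. k \<in> {1, 2, 3} \<Longrightarrow> f k = 1 \<or> f k = - 1"
  defines "c \<equiv> \<lambda>i g f. op0 2 1 i g f - vpow 2 * g f"
  shows "c 1 (c 2 (c 1 g)) f = c 1 g f"
proof -
  define t t' where t: "t = vpow 1" "t' = vpow (- 1)"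
  have v: "vpow 1 = t" "vpow (- 1) = t'" "vpow 2 = t * t" "vpow (- 2) = t' * t'" by (simp_all add: t vpow_add)
  have tt: "t' * t = 1" "t' * (t * x) = x" for x by (simp_all add: t vpow_add)
  define G where "G x y z = g (put 1 f x y z)" for x y z
  have "c 1 (c 2 (c 1 g)) (put 1 f x y z) = c 1 g (put 1 f x y z)"
    if "x = 1 \<or> x = - 1" "y = 1 \<or> y = - 1" "z = 1 \<or> z = - 1" for x y z
    unfolding c_def op0_put(1)[OF order_refl] op0_put(2)[OF order_refl, unfolded Suc_1] G_def[symmetric]
    using that by (auto simp: cmp_def algebra_simps tt v)
  from this[of "f (int 1)" "f (int 1 + 1)" "f (int 1 + 2)"] show ?thesis
    unfolding put_self[OF assms(1)] using assms(2) by simp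
qed

lemma op0_blob:
  assumes "odd_fun f" "\<And>k. k \<in> {1, 2} \<Longrightarrow> f k = 1 \<or> f k = - 1"
  defines "c \<equiv> \<lambda>i g f. op0 2 1 i g f - vpow 2 * g f" and "c0 \<equiv> \<lambda>i g f. op0 2 1 i g f - vpow 1 * g f"
  shows "c 1 (c0 0 (c 1 g)) f = (vpow (- 1) + vpow 1) * c 1 g f"
proof -
  define t t' where t: "t = vpow 1" "t' = vpow (- 1)"
  have v: "vpow 1 = t" "vpow (- 1) = t'" "vpow 2 = t * t" "vpow (- 2) = t' * t'" by (simp_all add: t vpow_add)
  have tt: "t' * t = 1" "t' * (t * x) = x" for x by (simp_all add: t vpow_add)
  define G where "G x y z = g (put 1 f x y z)" for x y z
  have "c 1 (c0 0 (c 1 g)) (put 1 f x y z) = (vpow (- 1) + vpow 1) * c 1 g (put 1 f x y z)"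
    if "x = 1 \<or> x = - 1" "y = 1 \<or> y = - 1" for x y z
    unfolding c_def c0_def op0_put(1)[OF order_refl] op0_put(3)[OF order_refl refl] G_def[symmetric]
    using that by (auto simp: cmp_def algebra_simps tt v)
  from this[of "f (int 1)" "f (int 1 + 1)" "f (int 1 + 2)"] show ?thesis
    unfolding put_self[OF assms(1)] using assms(2) by simp
qed

definition closed_under :: "nat \<Rightarrow> ((int \<Rightarrow> int) \<Rightarrow> bool) \<Rightarrow> bool" where
  "closed_under n P \<longleftrightarrow> (\<forall>f. P f \<longrightarrow> odd_fun f \<and> (\<forall>i < n. P (f \<circ> s_gen i)))"

lemma app_T_op_cong:
  assumes "closed_under n P" "P f" "i < n" "\<And>f. P f \<Longrightarrow> g f = g' f"
  shows "app (T_op P a b i) g f = op0 a b i g' f"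
  using assms by (simp add: app_T_op op0_def closed_under_def)

lemma hecke_relators_T_op:
  assumes P: "closed_under n P" and p: "p \<in> hecke_relators a b n"
  shows "ev S_op (T_op P a b) p = 0"
proof -
  let ?T = "T_op P a b"
  note T = app_T_op_cong[OF P]
  have n: "app (?T i) g f = vpow (param a b i) * g f" if "\<not> P f" for i f g
    using that by (simp add: app_T_op)
  have odd: "odd_fun f" if "P f" for f using P that by (simp add: closed_under_def)
  have braid3: "?T i * ?T (Suc i) * ?T i = ?T (Suc i) * ?T i * ?T (Suc i)" if i: "1 \<le> i" "Suc i < n" for i
  proof (intro endo_eqI ext)
    fix g f
    have p: "param a b (Suc i) = param a b i" using i by (simp add: param_def)
    show "app (?T i * ?T (Suc i) * ?T i) g f = app (?T (Suc i) * ?T i * ?T (Suc i)) g f"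
    proof (cases "P f")
      case True
      have "app (?T i * ?T (Suc i) * ?T i) g f = op0 a b i (op0 a b (Suc i) (op0 a b i g)) f"
        unfolding app_simps using i True by (intro T) auto
      moreover have "app (?T (Suc i) * ?T i * ?T (Suc i)) g f = op0 a b (Suc i) (op0 a b i (op0 a b (Suc i) g)) f"
        unfolding app_simps using i True by (intro T) auto
      ultimately show ?thesis using op0_braid3[OF odd[OF True] i(1)] by simp
    qed (simp add: app_simps n p)
  qed
  have braid4: "?T 0 * ?T 1 * ?T 0 * ?T 1 = ?T 1 * ?T 0 * ?T 1 * ?T 0" if i: "2 \<le> n"
  proof (intro endo_eqI ext)
    fix g f
    show "app (?T 0 * ?T 1 * ?T 0 * ?T 1) g f = app (?T 1 * ?T 0 * ?T 1 * ?T 0) g f"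
    proof (cases "P f")
      case True
      have "app (?T 0 * ?T 1 * ?T 0 * ?T 1) g f = op0 a b 0 (op0 a b 1 (op0 a b 0 (op0 a b 1 g))) f"
        unfolding app_simps using i True by (intro T) auto
      moreover have "app (?T 1 * ?T 0 * ?T 1 * ?T 0) g f = op0 a b 1 (op0 a b 0 (op0 a b 1 (op0 a b 0 g))) f"
        unfolding app_simps using i True by (intro T) auto
      ultimately show ?thesis using op0_braid4[OF odd[OF True]] by simp
    qed (simp add: app_simps n ac_simps del: vpow_add_cancel)
  qed
  have comm1: "?T i * ?T j = ?T j * ?T i" if ij: "i < n" "j < n" "i + 1 < j" for i j
  proof (intro endo_eqI ext)
    fix g f
    show "app (?T i * ?T j) g f = app (?T j * ?T i) g f"
    proof (cases "P f")
      case True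
      have "app (?T i * ?T j) g f = op0 a b i (op0 a b j g) f"
        unfolding app_simps using ij True by (intro T) auto
      moreover have "app (?T j * ?T i) g f = op0 a b j (op0 a b i g) f"
        unfolding app_simps using ij True by (intro T) auto
      ultimately show ?thesis using op0_comm[OF ij(3)] by simp
    qed (simp add: app_simps n mult.left_commute)
  qed
  have comm: "?T i * ?T j = ?T j * ?T i" if ij: "i < n" "j < n" "\<bar>int i - int j\<bar> > 1" for i j
    using comm1[of i j] comm1[of j i] ij by fastforce
  have quad: "(?T i - S_op (vpow (param a b i))) * (?T i + S_op (vpow (- param a b i))) = 0" if i: "i < n" for i
  proof (intro endo_eqI ext)
    fix g f
    let ?q = "vpow (param a b i)" and ?q' = "vpow (- param a b i)"
    have pt: "(x + y) f = x f + y f" "(x - y) f = x f - y f" for x y :: module by simp_all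
    have S: "app (S_op c) h = (\<lambda>f. c * h f)" for c h by (simp add: fun_eq_iff app_S_op)
    show "app ((?T i - S_op ?q) * (?T i + S_op ?q')) g f = app 0 g f"
    proof (cases "P f")
      case True
      have "app (?T i) (\<lambda>f. ?q' * g f) f = ?q' * app (?T i) g f"
        using True by (simp add: app_T_op op0_def distrib_left mult.left_commute)
      moreover have "app (?T i) (app (?T i) g) f = op0 a b i (op0 a b i g) f"
        using i True by (intro T) (auto simp: app_T_op)
      moreover have "app (?T i) g f = op0 a b i g f" using True by (simp add: app_T_op)
      ultimately show ?thesis using op0_quad[OF odd[OF True], of a b i g]
        by (simp add: app_simps pt S algebra_simps vpow_inverse)
    qed (simp add: app_simps pt S n algebra_simps vpow_inverse)
  qed
  show ?thesis using p unfolding hecke_relators_def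
  proof (elim UnE)
    assume "p \<in> {gen i * gen (i - 1) * gen i - gen (i - 1) * gen i * gen (i - 1) |i. 2 \<le> i \<and> i < n}"
    then obtain i where i: "2 \<le> i" "i < n" "p = gen i * gen (i - 1) * gen i - gen (i - 1) * gen i * gen (i - 1)" by blast
    then show ?thesis using braid3[of "i - 1"] by (simp add: T_op.ev_simps)
  next
    assume "p \<in> (if 2 \<le> n then {gen 0 * gen 1 * gen 0 * gen 1 - gen 1 * gen 0 * gen 1 * gen 0} else {})"
    then show ?thesis using braid4 by (auto simp: T_op.ev_simps split: if_splits)
  next
    assume "p \<in> {gen i * gen j - gen j * gen i |i j. i < n \<and> j < n \<and> 1 < \<bar>int i - int j\<bar>}"
    then show ?thesis using comm by (auto simp: T_op.ev_simps)
  next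
    assume "p \<in> {(gen i - scalar (vpow (param a b i))) * (gen i + scalar (vpow (- param a b i))) |i. i < n}"
    then show ?thesis using quad by (auto simp: T_op.ev_simps)
  qed
qed

section \<open>Standard products acting on indicator functions\<close>

definition ind :: "(int \<Rightarrow> int) \<Rightarrow> module" where "ind h f = (if f = h then 1 else 0)"

lemma reduced_rev: assumes "reduced n us" shows "reduced n (rev us)"
proof -
  have s: "set us \<subseteq> {..<n}" "length us = len n (word_perm us)" using assms by (auto simp: reduced_def)
  obtain vs where vs: "reduced n vs" "word_perm vs = word_perm (rev us)"
    using ex_reduced_expression[OF word_perm_weylB, of "rev us" n] s by (auto simp: reduced_expression_reduced)
  have "word_perm (rev vs) = word_perm us"
    using vs(2) inv_word_perm[of vs] inv_word_perm[of "rev us"] by simp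
  then have "length us \<le> length vs" using len_le[of "rev vs" n] vs s by (simp add: reduced_def)
  then show ?thesis using vs s len_le[of "rev us" n] by (simp add: reduced_def)
qed

lemma comp_s_gen_eq_iff: "f \<circ> s_gen i = h \<longleftrightarrow> f = h \<circ> s_gen i"
  by (metis comp_assoc s_gen_comp_self comp_id)

text \<open>The identity has increasing entries, and along a reduced word each generator meets a
  pair in increasing order, where \<open>cmp\<close> is 0. So an indicator always goes to a single
  indicator, at the inverse of the element reached; distinct elements are thereby separated.\<close>

lemma T_op_reduced:
  assumes P: "closed_under n P" "P id" and "reduced n us"
  shows "app (prod_list (map (T_op P a b) us)) (ind id) = ind (word_perm (rev us)) \<and> P (word_perm (rev us))"
  using assms(3)
proof (induction us)
  case Nil
  show ?case using P(2) by (simp only: rev.simps word_perm_Nil list.map prod_list.Nil app_simps simp_thms)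
next
  case (Cons i us)
  let ?h = "word_perm (rev us)"
  have i: "i < n" "reduced n us" using Cons.prems reduced_append(2)[of n "[i]" us] by (auto simp: reduced_def)
  have "reduced n (rev us @ [i])" using reduced_rev[OF Cons.prems] by simp
  then have nd: "\<not> descent ?h i" using reduced_snoc[OF reduced_rev[OF i(2)] i(1)] by simp
  have h: "app (prod_list (map (T_op P a b) us)) (ind id) = ind ?h" "P ?h" using Cons.IH[OF i(2)] by blast+
  have lt: "?h (lo i) < ?h (hi i)"
  proof -
    have "?h \<in> weylB n" using i(2) by (intro word_perm_weylB) (auto simp: reduced_def)
    from weylB_inj[OF this, of "lo i" "hi i"] show ?thesis using nd lo_less_hi[of i] by (auto simp: descent_def)
  qed
  have Ps: "P (?h \<circ> s_gen i)" using P(1) h(2) i(1) by (simp add: closed_under_def)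
  have "app (T_op P a b i) (ind ?h) = ind (?h \<circ> s_gen i)"
  proof
    fix f
    show "app (T_op P a b i) (ind ?h) f = ind (?h \<circ> s_gen i) f"
    proof (cases "f = ?h")
      case True
      have ne: "?h \<noteq> ?h \<circ> s_gen i" using lt by (metis comp_apply less_irrefl s_gen_lo)
      then show ?thesis using h(2) lt unfolding True app_T_op op0_def ind_def comp_s_gen_eq_iff
        by (simp add: cmp_cases)
    next
      case False
      then show ?thesis using Ps unfolding app_T_op op0_def ind_def comp_s_gen_eq_iff by simp
    qed
  qed
  moreover have "word_perm (rev (i # us)) = ?h \<circ> s_gen i" by simp
  ultimately show ?case using Ps h(1) by (simp only: list.map prod_list.Cons app_simps)
qed

text \<open>From an arbitrary starting map ties and inversions create further terms, but each of
  them comes from letting a letter act by a scalar, so it sits at a map that a shorter word reaches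
  from h.\<close>

lemma T_op_lower_terms:
  assumes P: "closed_under n P" "P h" and us: "set us \<subseteq> {..<n}"
    and nz: "app (prod_list (map (T_op P a b) us)) (ind h) f \<noteq> ind (h \<circ> word_perm (rev us)) f"
  shows "\<exists>vs. set vs \<subseteq> {..<n} \<and> length vs < length us \<and> f = h \<circ> word_perm (rev vs)"
  using us nz
proof (induction us arbitrary: f)
  case Nil
  then show ?case by (simp add: app_simps)
next
  case (Cons i us)
  let ?G = "app (prod_list (map (T_op P a b) us)) (ind h)"
  let ?hu = "h \<circ> word_perm (rev us)"
  have i: "i < n" "set us \<subseteq> {..<n}" using Cons.prems by auto
  have Pw: "P (h \<circ> word_perm vs)" if "set vs \<subseteq> {..<n}" for vs
    using that
  proof (induction vs rule: rev_induct)
    case (snoc j vs)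
    have "P (h \<circ> word_perm vs)" by (rule snoc.IH) (use snoc.prems in auto)
    then have "P (h \<circ> word_perm vs \<circ> s_gen j)" using P(1) snoc.prems unfolding closed_under_def by auto
    then show ?case by (simp only: word_perm_append word_perm_Cons word_perm_Nil comp_id comp_assoc)
  qed (use P in simp)
  have G: "\<exists>vs. set vs \<subseteq> {..<n} \<and> length vs \<le> length us \<and> k = h \<circ> word_perm (rev vs)" if "?G k \<noteq> 0" for k
  proof (cases "?G k = ind ?hu k")
    case True
    then have "k = ?hu" using that by (auto simp: ind_def split: if_splits)
    then show ?thesis using i by blast
  next
    case False
    then show ?thesis using Cons.IH[OF i(2)] less_imp_le by blast
  qed
  have short: ?case if "?G f \<noteq> 0"
    using G[OF that] le_imp_less_Suc by (metis length_Cons)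
  show ?case
  proof (cases "P f")
    case False
    then have "?G f = 0" using G Pw by (metis set_rev)
    moreover have "f \<noteq> h \<circ> word_perm (rev (i # us))" using Pw[of "rev (i # us)"] Cons.prems(1) False by auto
    then have "ind (h \<circ> word_perm (rev (i # us))) f = 0" unfolding ind_def by (rule if_not_P)
    moreover have "app (prod_list (map (T_op P a b) (i # us))) (ind h) f = vpow (param a b i) * ?G f"
      using False by (simp only: list.map prod_list.Cons app_simps app_T_op if_False)
    ultimately have "app (prod_list (map (T_op P a b) (i # us))) (ind h) f = ind (h \<circ> word_perm (rev (i # us))) f"
      by (simp only: mult_zero_right)
    with Cons.prems(2) show ?thesis by blast
  next
    case True
    have val: "app (prod_list (map (T_op P a b) (i # us))) (ind h) f =
        ?G (f \<circ> s_gen i) + cmp (param a b i) (f (lo i)) (f (hi i)) * ?G f"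
      using True by (simp add: app_simps app_T_op op0_def)
    have eq: "h \<circ> word_perm (rev (i # us)) = ?hu \<circ> s_gen i" by (simp add: comp_assoc)
    have ieq: "ind (h \<circ> word_perm (rev (i # us))) f = ind ?hu (f \<circ> s_gen i)"
      unfolding ind_def eq comp_s_gen_eq_iff ..
    have "?G f \<noteq> 0 \<or> ?G (f \<circ> s_gen i) \<noteq> ind ?hu (f \<circ> s_gen i)"
    proof (rule ccontr)
      assume "\<not> ?thesis"
      then have g: "?G f = 0" "?G (f \<circ> s_gen i) = ind ?hu (f \<circ> s_gen i)" by auto
      have "app (prod_list (map (T_op P a b) (i # us))) (ind h) f = ind (h \<circ> word_perm (rev (i # us))) f"
        unfolding val g ieq mult_zero_right add_0_right ..
      with Cons.prems(2) show False by blast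
    qed
    then show ?thesis
    proof
      assume "?G (f \<circ> s_gen i) \<noteq> ind ?hu (f \<circ> s_gen i)"
      then obtain vs where vs: "set vs \<subseteq> {..<n}" "length vs < length us" "f \<circ> s_gen i = h \<circ> word_perm (rev vs)"
        using Cons.IH[OF i(2)] by blast
      then have "f = h \<circ> word_perm (rev vs) \<circ> s_gen i" by (intro comp_s_gen_eq_iff[THEN iffD1])
      also have "\<dots> = h \<circ> word_perm (rev (i # vs))" by (simp add: comp_assoc)
      finally have "f = h \<circ> word_perm (rev (i # vs))" .
      moreover have "set (i # vs) \<subseteq> {..<n}" "length (i # vs) < length (i # us)" using vs i by auto
      ultimately show ?thesis by blast
    qed (rule short)
  qed
qed

subsection \<open>Independence of the elements avoiding decreasing triples\<close>

definition is_rec :: "(int \<Rightarrow> int) \<Rightarrow> int \<Rightarrow> bool" where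
  "is_rec w i \<longleftrightarrow> (\<forall>j. j \<noteq> 0 \<longrightarrow> j < i \<longrightarrow> w j < w i)"

text \<open>A transversal of the pairs \<open>{i, -i}\<close> on which an element avoiding decreasing triples is
  increasing: the left-to-right maxima, where of a pair of left-to-right maxima the positive one is taken.\<close>

definition rec_set :: "nat \<Rightarrow> (int \<Rightarrow> int) \<Rightarrow> int set" where
  "rec_set n w = {i. i \<noteq> 0 \<and> \<bar>i\<bar> \<le> int n \<and> is_rec w i \<and> (is_rec w (- i) \<longrightarrow> 0 < i)}"

text \<open>If neither i nor -i is a left-to-right maximum, there is a larger value before i and, by
  oddness, a smaller value after i: a decreasing triple with i in the middle.\<close>

lemma rec_set_transversal:
  assumes w: "w \<in> weylB n" "avoids w" and i: "i \<noteq> 0" "\<bar>i\<bar> \<le> int n"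
  shows "- i \<in> rec_set n w \<longleftrightarrow> i \<notin> rec_set n w"
proof -
  have "is_rec w i \<or> is_rec w (- i)"
  proof (rule ccontr)
    assume "\<not> ?thesis"
    then obtain j k where j: "j \<noteq> 0" "j < i" "\<not> w j < w i" and k: "k \<noteq> 0" "k < - i" "\<not> w k < w (- i)"
      by (auto simp: is_rec_def)
    have "w i < w j" using j weylB_inj[OF w(1), of i j] by auto
    moreover have "w (- k) < w i" using k weylB_inj[OF w(1), of k "- i"] weylB_uminus[OF w(1)] by auto
    moreover have "i < - k" "- k \<noteq> 0" using k by auto
    ultimately show False using w(2) j(1,2) i(1) unfolding avoids_def by blast
  qed
  then show ?thesis using i by (auto simp: rec_set_def)
qed

lemma rec_set_increasing: "i \<in> rec_set n w \<Longrightarrow> j \<in> rec_set n w \<Longrightarrow> i < j \<Longrightarrow> w i < w j"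
  by (auto simp: rec_set_def is_rec_def)

lemma increasing_bij_id:
  assumes "finite (S :: int set)" "bij_betw f S S" "\<And>x y. x \<in> S \<Longrightarrow> y \<in> S \<Longrightarrow> x < y \<Longrightarrow> f x < f y" "x \<in> S"
  shows "f x = (x :: int)"
proof (rule ccontr)
  assume "f x \<noteq> x"
  let ?D = "{x \<in> S. f x \<noteq> x}"
  define m where "m = Min ?D"
  have D: "finite ?D" "?D \<noteq> {}" using assms(1,4) \<open>f x \<noteq> x\<close> by auto
  then have m: "m \<in> S" "f m \<noteq> m" using Min_in[OF D] by (auto simp: m_def)
  have least: "f y = y" if "y \<in> S" "y < m" for y
    using Min_le[OF D(1), of y] that by (force simp: m_def)
  have inj: "inj_on f S" and img: "f ` S = S" using assms(2) by (auto simp: bij_betw_def)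
  have fm: "f m \<in> S" using img m by blast
  have "\<not> f m < m" using least[OF fm] inj_onD[OF inj, of "f m" m] fm m by auto
  then have "m < f m" using m by simp
  have "m \<in> f ` S" using img m by simp
  then obtain u where u: "u \<in> S" "f u = m" by blast
  have "\<not> u < m" using least[OF u(1)] u by auto
  moreover have "u \<noteq> m" using u m by auto
  ultimately have "f m < f u" using assms(3) u m by auto
  then show False using u \<open>m < f m\<close> by simp
qed

definition sign_fun :: "nat \<Rightarrow> int set \<Rightarrow> int \<Rightarrow> int" where
  "sign_fun n S x = (if x = 0 \<or> \<bar>x\<bar> > int n then 0 else if x \<in> S then 1 else - 1)"

definition pm_fun :: "nat \<Rightarrow> (int \<Rightarrow> int) \<Rightarrow> bool" where
  "pm_fun n f \<longleftrightarrow> odd_fun f \<and> (\<forall>x. x \<noteq> 0 \<longrightarrow> \<bar>x\<bar> \<le> int n \<longrightarrow> f x = 1 \<or> f x = - 1)"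

lemma closed_odd: "closed_under n odd_fun"
  by (auto simp: closed_under_def intro: odd_fun_comp odd_s_gen)

lemma closed_pm_fun: "closed_under n (pm_fun n)"
  unfolding closed_under_def
proof (intro allI impI conjI)
  fix f i assume f: "pm_fun n f"
  then show "odd_fun f" by (simp add: pm_fun_def)
  fix i assume "i < n"
  then have s: "s_gen i \<in> weylB n" by (rule s_gen_weylB)
  show "pm_fun n (f \<circ> s_gen i)"
    using f weylB_bound[OF s] weylB_eq_0_iff[OF s] odd_fun_comp[OF _ odd_s_gen, of f i] by (auto simp: pm_fun_def)
qed

lemma sign_fun_pm_fun:
  assumes "w \<in> weylB n" "avoids w" shows "pm_fun n (sign_fun n (rec_set n w))"
  using rec_set_transversal[OF assms] by (auto simp: pm_fun_def odd_fun_def sign_fun_def)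

text \<open>With S = \<open>rec_set n w\<close> the hypothesis amounts to z(S) = w(S), that is, z
  lies in the coset of w by the stabiliser of S. If z has an inversion inside S, the reflection in
  it belongs to the stabiliser and shortens z. Otherwise z and w both increase on S and have the
  same image, so they agree on S and by oddness everywhere.\<close>

lemma minimal_length:
  assumes w: "w \<in> weylB n" "avoids w" and z: "z \<in> weylB n"
    and eq: "\<And>x. x \<in> rec_set n w \<Longrightarrow> \<exists>y \<in> rec_set n w. z x = w y"
  shows "z = w \<or> len n w < len n z"
  using z eq
proof (induction "len n z" arbitrary: z rule: less_induct)
  case less
  let ?S = "rec_set n w"
  have fin: "finite ?S" by (rule finite_subset[of _ "{- int n..int n}"]) (auto simp: rec_set_def)
  have S0: "x \<noteq> 0" "\<bar>x\<bar> \<le> int n" if "x \<in> ?S" for x using that by (auto simp: rec_set_def)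
  show ?case
  proof (cases "\<exists>a \<in> ?S. \<exists>b \<in> ?S. a < b \<and> z b < z a")
    case True
    then obtain a b where ab: "a \<in> ?S" "b \<in> ?S" "a < b" "z b < z a" by blast
    have nz: "a \<noteq> 0" "b \<noteq> 0" using S0 ab by auto
    let ?t = "refl a b"
    have lt: "len n (z \<circ> ?t) < len n z" using len_exchange[OF less.prems(1) ab(3) nz ab(4)] .
    have tS: "?t x \<in> ?S" if "x \<in> ?S" for x
    proof -
      have "x \<noteq> - a" "x \<noteq> - b"
        using rec_set_transversal[OF w S0[OF ab(1)]] rec_set_transversal[OF w S0[OF ab(2)]] ab that by auto
      then show ?thesis using that ab by (simp add: refl_def)
    qed
    have tW: "z \<circ> ?t \<in> weylB n"
    proof (rule weylB_comp[OF less.prems(1)], rule weylBI)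
      have "?t \<circ> ?t = id" using refl_refl[OF nz] by (simp add: fun_eq_iff)
      then show "bij ?t" by (rule o_bij) fact
      show "odd_fun ?t" using refl_uminus[OF nz] by (simp add: odd_fun_def)
      show "?t x = x" if "x > int n" for x using that S0[OF ab(1)] S0[OF ab(2)] by (auto simp: refl_def)
    qed
    have "z \<circ> ?t = w \<or> len n w < len n (z \<circ> ?t)"
      by (rule less.hyps[OF lt tW]) (use less.prems(2) tS in auto)
    then show ?thesis using lt by auto
  next
    case False
    then have inc: "z x < z y" if "x \<in> ?S" "y \<in> ?S" "x < y" for x y
      using that weylB_inj[OF less.prems(1), of x y] by (metis linorder_neqE less_irrefl)
    obtain v where v: "\<And>x. x \<in> ?S \<Longrightarrow> v x \<in> ?S \<and> z x = w (v x)" using less.prems(2) by metis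
    have v_inc: "v x < v y" if "x \<in> ?S" "y \<in> ?S" "x < y" for x y
      using inc[OF that] v[OF that(1)] v[OF that(2)] rec_set_increasing[of "v y" n w "v x"]
      by (metis linorder_neqE less_asym' less_irrefl)
    have "inj_on v ?S" using v_inc by (intro inj_onI) (metis linorder_neqE less_irrefl)
    moreover have "v ` ?S \<subseteq> ?S" using v by auto
    ultimately have "bij_betw v ?S ?S"
      using fin by (simp add: bij_betw_def endo_inj_surj)
    from increasing_bij_id[OF fin this v_inc] have zS: "z x = w x" if "x \<in> ?S" for x
      using v that by metis
    have "z x = w x" for x
    proof -
      consider "x = 0" | "\<bar>x\<bar> > int n" | "x \<in> ?S" | "- x \<in> ?S"
        using rec_set_transversal[OF w, of x] by fastforce
      then show ?thesis
        using zS[of x] zS[of "- x"] weylB_zero[OF w(1)] weylB_zero[OF less.prems(1)]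
          weylB_fixes[OF w(1), of x] weylB_fixes[OF less.prems(1), of x]
          weylB_uminus[OF w(1), of x] weylB_uminus[OF less.prems(1), of x] by cases auto
    qed
    then show ?thesis by auto
  qed
qed

lemma minimal_length_sign:
  assumes w: "w \<in> weylB n" "avoids w" and us: "set us \<subseteq> {..<n}"
    and eq: "sign_fun n (rec_set n w) \<circ> word_perm (rev us) = sign_fun n (rec_set n w) \<circ> inv_into UNIV w"
  shows "word_perm us = w \<or> len n w < length us"
proof -
  let ?S = "rec_set n w"
  have z: "word_perm us \<in> weylB n" using us by (rule word_perm_weylB)
  have "word_perm us = w \<or> len n w < len n (word_perm us)"
  proof (rule minimal_length[OF w z])
    fix x assume x: "x \<in> ?S"
    define y where "y = inv_into UNIV w (word_perm us x)"
    have wy: "w y = word_perm us x" unfolding y_def using weylB_bij[OF w(1)] by (simp add: bij_is_surj surj_f_inv_f)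
    have "sign_fun n ?S x = sign_fun n ?S y"
      using fun_cong[OF eq, of "word_perm us x"] word_perm_rev_comp[of us] by (simp add: fun_eq_iff y_def)
    moreover have "sign_fun n ?S x = 1" using x by (auto simp: sign_fun_def rec_set_def)
    ultimately have "y \<in> ?S" by (auto simp: sign_fun_def split: if_splits)
    then show "\<exists>y \<in> ?S. word_perm us x = w y" using wy by metis
  qed
  then show ?thesis using len_le[OF us] by auto
qed

section \<open>Linear combinations of standard words and their independence\<close>

definition rw :: "nat \<Rightarrow> (int \<Rightarrow> int) \<Rightarrow> nat list" where
  "rw n w = (SOME is. reduced_expression n is w)"

lemma rw: assumes "w \<in> weylB n" shows "reduced n (rw n w)" "word_perm (rw n w) = w"
  using someI_ex[OF ex_reduced_expression[OF assms]] by (simp_all add: rw_def reduced_expression_reduced)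

definition std_poly :: "nat \<Rightarrow> ((int \<Rightarrow> int) \<Rightarrow> laurent) \<Rightarrow> free_poly" where
  "std_poly n c = (\<Sum>w \<in> weylB n. scalar (c w) * prod_list (map gen (rw n w)))"

lemma app_sum: "app (\<Sum>x \<in> X. f x) g = (\<Sum>x \<in> X. app (f x) g)"
  by (induction X rule: infinite_finite_induct) (simp_all add: app_simps)

lemma sum_fun_apply: "(\<Sum>x \<in> X. f x) y = (\<Sum>x \<in> X. f x (y :: 'b) :: 'c :: comm_monoid_add)"
  by (induction X rule: infinite_finite_induct) simp_all

lemma app_std_poly:
  "app (ev S_op (T_op P a b) (std_poly n c)) g f =
    (\<Sum>w \<in> weylB n. c w * app (prod_list (map (T_op P a b) (rw n w))) g f)"
  by (simp add: std_poly_def T_op.ev_sum T_op.ev_simps app_sum sum_fun_apply app_simps app_S_op)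

lemma std_poly_independent:
  assumes "ev S_op (T_op odd_fun a b) (std_poly n c) = 0" "w \<in> weylB n"
  shows "c w = 0"
proof -
  let ?f = "word_perm (rev (rw n w))"
  have "app (prod_list (map (T_op odd_fun a b) (rw n y))) (ind id) ?f = (if y = w then 1 else 0)"
    if y: "y \<in> weylB n" for y
  proof -
    have "odd_fun id" by (simp add: odd_fun_def)
    from T_op_reduced[OF closed_odd this rw(1)[OF y]]
    have "app (prod_list (map (T_op odd_fun a b) (rw n y))) (ind id) = ind (word_perm (rev (rw n y)))" by blast
    moreover have "?f = word_perm (rev (rw n y)) \<longleftrightarrow> y = w"
      using inv_word_perm[of "rev (rw n w)"] inv_word_perm[of "rev (rw n y)"] rw(2)[OF y] rw(2)[OF assms(2)]
      by (metis rev_rev_ident)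
    ultimately show ?thesis by (simp add: ind_def)
  qed
  then have "app (ev S_op (T_op odd_fun a b) (std_poly n c)) (ind id) ?f = (\<Sum>y \<in> weylB n. if y = w then c y else 0)"
    unfolding app_std_poly by (intro sum.cong) auto
  then show ?thesis using assms finite_weylB by (simp add: app_simps)
qed

text \<open>For w of maximal length in the support, start at its sign vector h and evaluate at h
  w^(-1). By \<open>minimal_length_sign\<close> a word of length at most that of w can reach this
  vector only if it is a reduced word of w, so T_w alone contributes.\<close>

lemma std_poly_avoids_independent:
  assumes ev: "ev S_op (T_op (pm_fun n) a b) (std_poly n c) = 0"
    and supp: "\<And>w. w \<in> weylB n \<Longrightarrow> \<not> avoids w \<Longrightarrow> c w = 0" and u: "u \<in> weylB n"
  shows "c u = 0"
proof (rule ccontr)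
  assume "c u \<noteq> 0"
  define Z where "Z = {w \<in> weylB n. c w \<noteq> 0}"
  have Z: "finite Z" "u \<in> Z" using finite_weylB u \<open>c u \<noteq> 0\<close> by (auto simp: Z_def)
  define k where "k = Max (len n ` Z)"
  have "Max (len n ` Z) \<in> len n ` Z" using Z by (intro Max_in) auto
  then obtain w where w: "w \<in> Z" "len n w = k" by (auto simp: k_def)
  have le: "len n z \<le> len n w" if "z \<in> Z" for z unfolding w(2) k_def using Z that by (intro Max_ge) auto
  have wW: "w \<in> weylB n" "avoids w" "c w \<noteq> 0" using w supp by (auto simp: Z_def)
  let ?h = "sign_fun n (rec_set n w)"
  let ?f = "?h \<circ> word_perm (rev (rw n w))"
  have inv_w: "word_perm (rev (rw n w)) = inv_into UNIV w"
    using inv_word_perm[of "rw n w"] rw(2)[OF wW(1)] by simp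
  have h: "pm_fun n ?h" using sign_fun_pm_fun[OF wW(1,2)] .
  have "c y * app (prod_list (map (T_op (pm_fun n) a b) (rw n y))) (ind ?h) ?f = (if y = w then c y else 0)"
    if y: "y \<in> weylB n" for y
  proof (cases "y \<in> Z")
    case False
    then show ?thesis using y wW by (auto simp: Z_def)
  next
    case True
    have r: "reduced n (rw n y)" "word_perm (rw n y) = y" "set (rw n y) \<subseteq> {..<n}" "length (rw n y) = len n y"
      using rw[OF y] by (auto simp: reduced_def)
    have eq: "app (prod_list (map (T_op (pm_fun n) a b) (rw n y))) (ind ?h) ?f = ind (?h \<circ> word_perm (rev (rw n y))) ?f"
    proof (rule ccontr)
      assume "\<not> ?thesis"
      from T_op_lower_terms[OF closed_pm_fun h r(3) this]
      obtain vs where vs: "set vs \<subseteq> {..<n}" "length vs < length (rw n y)" "?f = ?h \<circ> word_perm (rev vs)"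
        by blast
      have "word_perm vs = w \<or> len n w < length vs"
        by (rule minimal_length_sign[OF wW(1,2) vs(1)]) (use vs(3) inv_w in simp)
      moreover have "length vs < len n w" using vs(2) r(4) le[OF True] by simp
      ultimately show False using len_le[OF vs(1)] by auto
    qed
    show ?thesis
    proof (cases "y = w")
      case True
      then show ?thesis unfolding eq by (simp add: ind_def)
    next
      case False
      have "?f \<noteq> ?h \<circ> word_perm (rev (rw n y))"
      proof
        assume "?f = ?h \<circ> word_perm (rev (rw n y))"
        then have "word_perm (rw n y) = w \<or> len n w < length (rw n y)"
          by (intro minimal_length_sign[OF wW(1,2) r(3)]) (simp only: inv_w)
        then show False using r le[OF \<open>y \<in> Z\<close>] False by auto
      qed
      then have "ind (?h \<circ> word_perm (rev (rw n y))) ?f = 0" unfolding ind_def by (rule if_not_P)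
      then show ?thesis using False unfolding eq by simp
    qed
  qed
  then have "app (ev S_op (T_op (pm_fun n) a b) (std_poly n c)) (ind ?h) ?f = (\<Sum>y \<in> weylB n. if y = w then c y else 0)"
    unfolding app_std_poly by (intro sum.cong) auto
  then show False using ev wW finite_weylB by (simp add: app_simps)
qed

lemma J_relators_T_op:
  fixes n defines "T \<equiv> T_op (pm_fun n) 2 1"
  defines "c \<equiv> \<lambda>i. T i - S_op (vpow (param 2 1 i))"
  shows "3 \<le> n \<Longrightarrow> c 1 * c 2 * c 1 - c 1 = 0"
    and "2 \<le> n \<Longrightarrow> c 1 * c 0 * c 1 - S_op (vpow (1 - 2) + vpow (2 - 1)) * c 1 = 0"
proof -
  have val: "app (c i) g f = op0 2 1 i g' f - vpow (param 2 1 i) * g' f"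
    if "pm_fun n f" "i < n" "\<And>f. pm_fun n f \<Longrightarrow> g f = g' f" for i g g' f
    unfolding c_def T_def app_simps using app_T_op_cong[OF closed_pm_fun that(1,2), of g g'] that
    by (simp add: app_S_op)
  have nval: "app (c i) g f = 0" if "\<not> pm_fun n f" for i g f
    using that by (simp add: c_def T_def app_simps app_T_op app_S_op)
  have p: "param 2 1 1 = 2" "param 2 1 2 = 2" "param 2 1 0 = 1" by (simp_all add: param_def)
  show "c 1 * c 2 * c 1 - c 1 = 0" if n: "3 \<le> n"
  proof (intro endo_eqI ext)
    fix g f
    show "app (c 1 * c 2 * c 1 - c 1) g f = app 0 g f"
    proof (cases "pm_fun n f")
      case True
      let ?c = "\<lambda>i g f. op0 2 1 i g f - vpow 2 * g f"
      have "app (c 1) (app (c 2) (app (c 1) g)) f = ?c 1 (?c 2 (?c 1 g)) f"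
      proof -
        have l: "1 < n" "2 < n" using n by auto
        have h1: "app (c 1) g f = ?c 1 g f" if "pm_fun n f" for f
          using val[OF that l(1), of g g] unfolding p by blast
        have h2: "app (c 2) (app (c 1) g) f = ?c 2 (?c 1 g) f" if "pm_fun n f" for f
          using val[OF that l(2) h1] unfolding p .
        show ?thesis using val[OF True l(1) h2] unfolding p .
      qed
      moreover have "app (c 1) g f = ?c 1 g f" using val[of f 1 g g] True n p by simp
      moreover have "?c 1 (?c 2 (?c 1 g)) f = ?c 1 g f"
      proof -
        have "f k = 1 \<or> f k = - 1" if "k \<in> {1, 2, 3}" for k
        proof -
          have "k \<noteq> 0" "\<bar>k\<bar> \<le> int n" using n that by auto
          then show ?thesis using True unfolding pm_fun_def by blast
        qed
        moreover have "odd_fun f" using True by (simp add: pm_fun_def)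
        ultimately show ?thesis using op0_TL[of f g] by blast
      qed
      ultimately show ?thesis by (simp add: app_simps)
    qed (simp add: app_simps nval)
  qed
  show "c 1 * c 0 * c 1 - S_op (vpow (1 - 2) + vpow (2 - 1)) * c 1 = 0" if n: "2 \<le> n"
  proof (intro endo_eqI ext)
    fix g f
    show "app (c 1 * c 0 * c 1 - S_op (vpow (1 - 2) + vpow (2 - 1)) * c 1) g f = app 0 g f"
    proof (cases "pm_fun n f")
      case True
      let ?c = "\<lambda>i g f. op0 2 1 i g f - vpow 2 * g f" and ?d = "\<lambda>i g f. op0 2 1 i g f - vpow 1 * g f"
      have "app (c 1) (app (c 0) (app (c 1) g)) f = ?c 1 (?d 0 (?c 1 g)) f"
      proof -
        have l: "1 < n" "0 < n" using n by auto
        have h1: "app (c 1) g f = ?c 1 g f" if "pm_fun n f" for f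
          using val[OF that l(1), of g g] unfolding p by blast
        have h2: "app (c 0) (app (c 1) g) f = ?d 0 (?c 1 g) f" if "pm_fun n f" for f
          using val[OF that l(2) h1] unfolding p .
        show ?thesis using val[OF True l(1) h2] unfolding p .
      qed
      moreover have "app (c 1) g f = ?c 1 g f" using val[of f 1 g g] True n p by simp
      moreover have "?c 1 (?d 0 (?c 1 g)) f = (vpow (- 1) + vpow 1) * ?c 1 g f"
      proof -
        have "f k = 1 \<or> f k = - 1" if "k \<in> {1, 2}" for k
        proof -
          have "k \<noteq> 0" "\<bar>k\<bar> \<le> int n" using n that by auto
          then show ?thesis using True unfolding pm_fun_def by blast
        qed
        moreover have "odd_fun f" using True by (simp add: pm_fun_def)
        ultimately show ?thesis using op0_blob[of f g] by blast
      qed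
      ultimately show ?thesis by (simp add: app_simps app_S_op)
    qed (simp add: app_simps nval app_S_op)
  qed
qed

section \<open>Endomorphisms of the free algebra\<close>

lemma free_hom_eq:
  assumes "\<And>p q. f (p + q) = f p + f q" "\<And>p q. f (p * q) = f p * f q"
    and "\<And>p q. g (p + q) = g p + g q" "\<And>p q. g (p * q) = g p * (g q :: 'r :: ring_1)"
    and "\<And>c. f (scalar c) = g (scalar c)" "\<And>i. f (gen i) = g (gen i)"
  shows "f p = g p"
proof (induction p rule: free_poly_induct)
  case (word c "is")
  show ?case
    by (induction "is" rule: rev_induct) (simp_all add: assms(5), simp add: assms(2,4,6) flip: mult.assoc)
qed (simp add: assms)

definition qdiff :: "nat \<Rightarrow> laurent" where
  "qdiff i = vpow (param 2 1 i) - vpow (- param 2 1 i)"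

text \<open>The image of a generator is its inverse modulo the quadratic relation. The formula is an
  involution already on the free algebra, before any relation is imposed.\<close>

definition bar_poly :: "free_poly \<Rightarrow> free_poly" where
  "bar_poly = ev (\<lambda>c. scalar (lbar c)) (\<lambda>i. gen i - scalar (qdiff i))"

text \<open>Sending the generators from \<open>n\<close> on to their eigenvalues retracts the free algebra onto
  \<^const>\<open>free_algebra\<close> \<open>n\<close> and, unlike sending them to \<open>0\<close>, commutes with the bar involution.\<close>

definition retr :: "nat \<Rightarrow> free_poly \<Rightarrow> free_poly" where
  "retr n = ev scalar (\<lambda>i. if i < n then gen i else scalar (vpow (param 2 1 i)))"

lemma evaluation_bar: "evaluation (\<lambda>c. scalar (lbar c)) (\<lambda>i. gen i - scalar (qdiff i))"
  by unfold_locales (rule scalar_comm | simp add: scalar_add scalar_mult)+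

lemma evaluation_retr: "evaluation scalar (\<lambda>i. if i < n then gen i else scalar (vpow (param 2 1 i)))"
  by unfold_locales (rule scalar_comm | simp add: scalar_add scalar_mult)+

lemmas bar_poly_simps [simp] = evaluation.ev_simps[OF evaluation_bar, folded bar_poly_def]
lemmas retr_simps [simp] = evaluation.ev_simps[OF evaluation_retr, folded retr_def]

lemma lbar_qdiff [simp]: "lbar (qdiff i) = - qdiff i"
  by (simp add: qdiff_def)

lemma scalar_uminus: "scalar (- c) = - scalar c"
  by (simp add: scalar_def single_uminus)

lemma scalar_diff: "scalar (c - d) = scalar c - scalar d"
  by (simp add: scalar_def single_diff)

lemma bar_poly_bar_poly [simp]: "bar_poly (bar_poly p) = p"
  by (rule free_hom_eq[of "\<lambda>p. bar_poly (bar_poly p)" "\<lambda>p. p"]) (simp_all add: scalar_uminus)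

lemma bar_poly_retr: "bar_poly (retr n p) = retr n (bar_poly p)"
  by (rule free_hom_eq[of "\<lambda>p. bar_poly (retr n p)" "\<lambda>p. retr n (bar_poly p)"])
     (simp_all add: qdiff_def scalar_diff)

lemma retr_0_relators: "r \<in> hecke_relators 2 1 n \<Longrightarrow> retr 0 r = 0"
  unfolding hecke_relators_def
proof (elim UnE)
  assume "r \<in> {gen i * gen (i - 1) * gen i - gen (i - 1) * gen i * gen (i - 1) |i. 2 \<le> i \<and> i < n}"
  then obtain i where "2 \<le> i" "r = gen i * gen (i - 1) * gen i - gen (i - 1) * gen i * gen (i - 1)" by blast
  then show ?thesis by (simp add: param_def)
qed (auto simp: vpow_add add.commute add.left_commute simp flip: scalar_mult split: if_splits)

section \<open>All quotients of the free algebra at once\<close>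

text \<open>To calculate in the quotients of the free algebra with the type class \<^class>\<open>ring_1\<close> although the
  ideals depend on \<open>n\<close>, take the product of the quotients by all bar-stable two-sided ideals. At
  every ideal but the one of interest the generators are replaced by their eigenvalues, which satisfy
  all relations.\<close>

definition two_sided :: "free_poly set \<Rightarrow> bool" where
  "two_sided K \<longleftrightarrow> 0 \<in> K \<and> (\<forall>p \<in> K. \<forall>q \<in> K. p + q \<in> K) \<and> (\<forall>p \<in> K. \<forall>q. q * p \<in> K \<and> p * q \<in> K)"

definition bar_stable :: "free_poly set \<Rightarrow> bool" where
  "bar_stable K \<longleftrightarrow> two_sided K \<and> (\<forall>p \<in> K. bar_poly p \<in> K)"

lemma two_sided_uminus: "two_sided K \<Longrightarrow> p \<in> K \<Longrightarrow> - p \<in> K"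
  unfolding two_sided_def by (metis mult_minus1)

lemma two_sided_add: "two_sided K \<Longrightarrow> p \<in> K \<Longrightarrow> q \<in> K \<Longrightarrow> p + q \<in> K"
  by (simp add: two_sided_def)

lemma two_sided_mult: "two_sided K \<Longrightarrow> p \<in> K \<Longrightarrow> q * p \<in> K" "two_sided K \<Longrightarrow> p \<in> K \<Longrightarrow> p * q \<in> K"
  by (simp_all add: two_sided_def)

lemma two_sided_diff: "two_sided K \<Longrightarrow> p \<in> K \<Longrightarrow> q \<in> K \<Longrightarrow> p - q \<in> K"
  using two_sided_add[of K p "- q"] two_sided_uminus by simp

lemma bar_stable_cong:
  assumes "bar_stable K" "f - f' \<in> K" "g - g' \<in> K"
  shows "f + g - (f' + g') \<in> K" "f - g - (f' - g') \<in> K" "f * g - f' * g' \<in> K"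
proof -
  have K: "two_sided K" using assms(1) by (simp add: bar_stable_def)
  have "f + g - (f' + g') = (f - f') + (g - g')" by simp
  with two_sided_add[OF K assms(2,3)] show "f + g - (f' + g') \<in> K" by (simp only:)
  have "f - g - (f' - g') = (f - f') - (g - g')" by simp
  with two_sided_diff[OF K assms(2,3)] show "f - g - (f' - g') \<in> K" by (simp only:)
  have "f * g - f' * g' = f * (g - g') + (f - f') * g'" by (simp add: algebra_simps)
  with two_sided_add[OF K two_sided_mult(1)[OF K assms(3)] two_sided_mult(2)[OF K assms(2)]]
  show "f * g - f' * g' \<in> K" by (simp only:)
qed

lifting_forget poly_mapping.lifting

quotient_type hring = "free_poly set \<Rightarrow> free_poly" / "\<lambda>f g. \<forall>K. bar_stable K \<longrightarrow> f K - g K \<in> K"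
proof (rule equivpI)
  show "reflp (\<lambda>f g :: free_poly set \<Rightarrow> free_poly. \<forall>K. bar_stable K \<longrightarrow> f K - g K \<in> K)"
    by (auto simp: reflp_def bar_stable_def two_sided_def)
  show "symp (\<lambda>f g :: free_poly set \<Rightarrow> free_poly. \<forall>K. bar_stable K \<longrightarrow> f K - g K \<in> K)"
    using two_sided_uminus by (fastforce simp: symp_def bar_stable_def)
  show "transp (\<lambda>f g :: free_poly set \<Rightarrow> free_poly. \<forall>K. bar_stable K \<longrightarrow> f K - g K \<in> K)"
  proof (rule transpI, intro allI impI)
    fix f g h :: "free_poly set \<Rightarrow> free_poly" and K
    assume "\<forall>K. bar_stable K \<longrightarrow> f K - g K \<in> K" "\<forall>K. bar_stable K \<longrightarrow> g K - h K \<in> K" "bar_stable K"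
    then show "f K - h K \<in> K" using two_sided_add[of K "f K - g K" "g K - h K"] by (simp add: bar_stable_def)
  qed
qed

instantiation hring :: ring_1
begin

lift_definition zero_hring :: hring is "\<lambda>_. 0" .
lift_definition one_hring :: hring is "\<lambda>_. 1" .
lift_definition plus_hring :: "hring \<Rightarrow> hring \<Rightarrow> hring" is "\<lambda>f g K. f K + g K"
  by (rule bar_stable_cong(1)) auto
lift_definition uminus_hring :: "hring \<Rightarrow> hring" is "\<lambda>f K. - f K"
  using two_sided_uminus unfolding bar_stable_def by fastforce
lift_definition minus_hring :: "hring \<Rightarrow> hring \<Rightarrow> hring" is "\<lambda>f g K. f K - g K"
  by (rule bar_stable_cong(2)) auto
lift_definition times_hring :: "hring \<Rightarrow> hring \<Rightarrow> hring" is "\<lambda>f g K. f K * g K"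
  by (rule bar_stable_cong(3)) auto

instance
proof
  fix a b c :: hring
  have refl: "\<forall>K. bar_stable K \<longrightarrow> x K - y K \<in> K" if "x = y" for x y :: "free_poly set \<Rightarrow> free_poly"
    using that by (simp add: bar_stable_def two_sided_def)
  show "a + b + c = a + (b + c)" by transfer (rule refl, simp add: fun_eq_iff algebra_simps)
  show "a + b = b + a" by transfer (rule refl, simp add: fun_eq_iff algebra_simps)
  show "0 + a = a" by transfer (rule refl, simp)
  show "- a + a = 0" by transfer (rule refl, simp)
  show "a - b = a + - b" by transfer (rule refl, simp)
  show "a * b * c = a * (b * c)" by transfer (rule refl, simp add: fun_eq_iff algebra_simps)
  show "1 * a = a" by transfer (rule refl, simp)
  show "a * 1 = a" by transfer (rule refl, simp)
  show "(a + b) * c = a * c + b * c" by transfer (rule refl, simp add: fun_eq_iff algebra_simps)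
  show "a * (b + c) = a * b + a * c" by transfer (rule refl, simp add: fun_eq_iff algebra_simps)
  have "bar_stable {0}" by (simp add: bar_stable_def two_sided_def)
  then show "(0 :: hring) \<noteq> 1" by transfer (auto intro!: exI[of _ "{0}"])
qed

end

lift_definition bar_h :: "hring \<Rightarrow> hring" is "\<lambda>f K. bar_poly (f K)"
  unfolding bar_stable_def by (metis bar_poly_simps(4))

lift_definition emb :: "free_poly set \<Rightarrow> free_poly \<Rightarrow> hring" is
  "\<lambda>K p Y. if Y = K then p else retr 0 p" .

text \<open>The index of the component is immaterial, because \<open>retr 0\<close> fixes
  scalars.\<close>

definition sc_h :: "laurent \<Rightarrow> hring" where "sc_h c = emb {} (scalar c)"

lemma hring_eqI: "(\<And>K. bar_stable K \<Longrightarrow> f K = g K) \<Longrightarrow> abs_hring f = abs_hring g"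
  using hring.abs_eq_iff[of f g] by (auto simp: bar_stable_def two_sided_def)

lemma emb_def': "emb K p = abs_hring (\<lambda>Y. if Y = K then p else retr 0 p)"
  by (simp add: emb.abs_eq)

lemma emb_scalar: "emb K (scalar c) = sc_h c"
  unfolding sc_h_def emb_def' by (rule hring_eqI) simp

lemma emb_hom: "emb K (p + q) = emb K p + emb K q" "emb K (p * q) = emb K p * emb K q"
  "emb K (p - q) = emb K p - emb K q" "emb K (- p) = - emb K p" "emb K 0 = 0" "emb K 1 = 1"
  unfolding emb_def' plus_hring.abs_eq times_hring.abs_eq minus_hring.abs_eq uminus_hring.abs_eq
    zero_hring_def one_hring_def map_fun_apply
  by (rule hring_eqI, simp)+

lemma emb_prod: "emb K (prod_list (map gen is)) = prod_list (map (\<lambda>i. emb K (gen i)) is)"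
  by (induction "is") (simp_all add: emb_hom)

lemma emb_sum: "emb K (\<Sum>x \<in> X. f x) = (\<Sum>x \<in> X. emb K (f x))"
  by (induction X rule: infinite_finite_induct) (simp_all add: emb_hom)

lemma bar_h_emb: "bar_h (emb K p) = emb K (bar_poly p)"
  unfolding emb_def' bar_h.abs_eq by (rule hring_eqI) (simp add: bar_poly_retr)

lemma emb_eq_0D: assumes "bar_stable K" "emb K p = 0" shows "p \<in> K"
proof -
  have "abs_hring (\<lambda>Y. if Y = K then p else retr 0 p) = abs_hring (\<lambda>_. 0)"
    using assms(2) by (simp add: emb_def' zero_hring_def)
  then show ?thesis using assms(1) hring.abs_eq_iff by fastforce
qed

text \<open>The second condition takes care of all components other than K. It holds throughout the
  ideals of interest by \<open>retr_0_HI\<close> and \<open>retr_0_JI\<close>.\<close>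

lemma emb_eq_0I: assumes "p \<in> K" "retr 0 p = 0" shows "emb K p = 0"
  unfolding emb_def' zero_hring_def hring.abs_eq_iff using assms
  by (auto simp: bar_stable_def two_sided_def)

lemma abs_hring_cases: obtains f where "x = abs_hring f"
  using Quotient_abs_rep[OF Quotient_hring, of x] by metis

lemma bar_h_hom: "bar_h (x + y) = bar_h x + bar_h y" "bar_h (x * y) = bar_h x * bar_h y"
proof -
  obtain f g where x: "x = abs_hring f" "y = abs_hring g" by (metis abs_hring_cases)
  show "bar_h (x + y) = bar_h x + bar_h y" "bar_h (x * y) = bar_h x * bar_h y"
    unfolding x bar_h.abs_eq plus_hring.abs_eq times_hring.abs_eq
    by (rule hring_eqI, simp only: bar_poly_simps)+
qed

lemma sc_h_comm: "x * sc_h c = sc_h c * x"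
proof -
  obtain f where x: "x = abs_hring f" by (rule abs_hring_cases)
  show ?thesis unfolding x sc_h_def emb_def' times_hring.abs_eq
    by (rule hring_eqI) (simp only: retr_simps if_cancel scalar_comm)
qed

lemma hecke_bar_emb:
  assumes rel: "hecke_relators 2 1 n \<subseteq> K"
  shows "hecke_bar 2 1 n sc_h (\<lambda>i. emb K (gen i)) bar_h"
proof -
  let ?T = "\<lambda>i. emb K (gen i)"
  have r: "emb K p = 0" if "p \<in> hecke_relators 2 1 n" for p
    using that rel retr_0_relators by (intro emb_eq_0I) auto
  show ?thesis
  proof
    show "sc_h (p + q) = sc_h p + sc_h q" "sc_h (p * q) = sc_h p * sc_h q" "sc_h 1 = 1" for p q
      by (simp_all add: sc_h_def scalar_add scalar_mult emb_hom)
    show "x * sc_h p = sc_h p * x" for x p by (rule sc_h_comm)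
    show "?T i * ?T (Suc i) * ?T i = ?T (Suc i) * ?T i * ?T (Suc i)" if i: "1 \<le> i" "Suc i < n" for i
    proof -
      have "gen (Suc i) * gen (Suc i - 1) * gen (Suc i) - gen (Suc i - 1) * gen (Suc i) * gen (Suc i - 1) \<in> hecke_relators 2 1 n"
        unfolding hecke_relators_def using i by (intro UnI1 CollectI exI[of _ "Suc i"]) auto
      from r[OF this] show ?thesis by (simp add: emb_hom)
    qed
    show "?T 0 * ?T 1 * ?T 0 * ?T 1 = ?T 1 * ?T 0 * ?T 1 * ?T 0" if "2 \<le> n"
    proof -
      have "gen 0 * gen 1 * gen 0 * gen 1 - gen 1 * gen 0 * gen 1 * gen 0 \<in> hecke_relators 2 1 n"
        unfolding hecke_relators_def using that by auto
      from r[OF this] show ?thesis by (simp add: emb_hom)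
    qed
    show "?T i * ?T j = ?T j * ?T i" if "i + 1 < j" "j < n" for i j
    proof -
      have "gen i * gen j - gen j * gen i \<in> hecke_relators 2 1 n"
        unfolding hecke_relators_def using that by (intro UnI1 UnI2 CollectI exI[of _ i] exI[of _ j]) auto
      from r[OF this] show ?thesis by (simp add: emb_hom)
    qed
    show "?T i * ?T i = 1 + sc_h (vpow (param 2 1 i) - vpow (- param 2 1 i)) * ?T i" if "i < n" for i
    proof -
      let ?q = "vpow (param 2 1 i)" and ?q' = "vpow (- param 2 1 i)"
      have "(gen i - scalar ?q) * (gen i + scalar ?q') \<in> hecke_relators 2 1 n"
        unfolding hecke_relators_def using that by auto
      from r[OF this] have h: "(?T i - sc_h ?q) * (?T i + sc_h ?q') = 0" by (simp add: emb_hom emb_scalar)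
      have h1: "sc_h ?q * sc_h ?q' = 1"
        unfolding sc_h_def emb_hom(2)[symmetric] scalar_mult[symmetric] by (simp add: emb_hom vpow_add)
      have h2: "sc_h (?q - ?q') = sc_h ?q - sc_h ?q'" by (simp add: sc_h_def scalar_diff emb_hom)
      show ?thesis unfolding h2 using h h1 sc_h_comm[of "?T i" ?q'] by (simp add: algebra_simps)
    qed
    show "bar_h (x + y) = bar_h x + bar_h y" "bar_h (x * y) = bar_h x * bar_h y" for x y
      by (rule bar_h_hom)+
    show "bar_h (sc_h p) = sc_h (lbar p)" for p by (simp add: sc_h_def bar_h_emb)
    show "bar_h (?T i) = ?T i - sc_h (vpow (param 2 1 i) - vpow (- param 2 1 i))" for i
      by (simp add: bar_h_emb emb_hom emb_scalar qdiff_def)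
  qed
qed

section \<open>The Hecke algebra as a quotient of the free algebra\<close>

abbreviation FA :: "nat \<Rightarrow> free_poly ring" where "FA n \<equiv> free_algebra n"
abbreviation HA :: "nat \<Rightarrow> free_poly set ring" where "HA n \<equiv> hecke 2 1 n"
abbreviation HI :: "nat \<Rightarrow> free_poly set" where "HI n \<equiv> hecke_ideal 2 1 n"

lemma FA_ops [simp]: "x \<otimes>\<^bsub>FA n\<^esub> y = x * y" "x \<oplus>\<^bsub>FA n\<^esub> y = x + y" "\<zero>\<^bsub>FA n\<^esub> = 0" "\<one>\<^bsub>FA n\<^esub> = 1"
  by (simp_all add: free_algebra_def)

lemma FA_closed:
  "p \<in> carrier (FA n) \<Longrightarrow> q \<in> carrier (FA n) \<Longrightarrow> p + q \<in> carrier (FA n)"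
  "p \<in> carrier (FA n) \<Longrightarrow> q \<in> carrier (FA n) \<Longrightarrow> p * q \<in> carrier (FA n)"
  "p \<in> carrier (FA n) \<Longrightarrow> - p \<in> carrier (FA n)" "0 \<in> carrier (FA n)" "1 \<in> carrier (FA n)"
proof -
  interpret F: ring "FA n" by (rule ring_free_algebra)
  show "p \<in> carrier (FA n) \<Longrightarrow> q \<in> carrier (FA n) \<Longrightarrow> p + q \<in> carrier (FA n)"
    "p \<in> carrier (FA n) \<Longrightarrow> q \<in> carrier (FA n) \<Longrightarrow> p * q \<in> carrier (FA n)"
    "0 \<in> carrier (FA n)" "1 \<in> carrier (FA n)"
    using F.a_closed[of p q] F.m_closed[of p q] F.zero_closed F.one_closed by simp_all
  show "p \<in> carrier (FA n) \<Longrightarrow> - p \<in> carrier (FA n)" by (simp add: free_algebra_def)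
qed

lemma FA_diff_closed: "p \<in> carrier (FA n) \<Longrightarrow> q \<in> carrier (FA n) \<Longrightarrow> p - q \<in> carrier (FA n)"
  using FA_closed(1)[of p n "- q"] FA_closed(3)[of q n] by simp

lemma FA_prod_closed: "set is \<subseteq> {..<n} \<Longrightarrow> prod_list (map gen is) \<in> carrier (FA n)"
  by (induction "is") (auto intro: FA_closed gen_closed)

lemma FA_sum_closed: "finite X \<Longrightarrow> (\<And>x. x \<in> X \<Longrightarrow> f x \<in> carrier (FA n)) \<Longrightarrow> (\<Sum>x \<in> X. f x) \<in> carrier (FA n)"
  by (rule sum_in) (auto intro: FA_closed)

lemma FA_a_inv: assumes "p \<in> carrier (FA n)" shows "\<ominus>\<^bsub>FA n\<^esub> p = - p"
proof -
  interpret F: ring "FA n" by (rule ring_free_algebra)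
  show ?thesis using F.minus_equality[of "- p" p] assms FA_closed(3)[OF assms] by simp
qed

lemma FA_minus: "p \<in> carrier (FA n) \<Longrightarrow> q \<in> carrier (FA n) \<Longrightarrow> p \<ominus>\<^bsub>FA n\<^esub> q = p - q"
  by (simp add: a_minus_def FA_a_inv)

lemma retr_closed: "retr n p \<in> carrier (FA n)"
proof (induction p rule: free_poly_induct)
  case (word c "is")
  have "prod_list (map (\<lambda>i. if i < n then gen i else scalar (vpow (param 2 1 i))) is) \<in> carrier (FA n)"
    by (induction "is") (auto intro: FA_closed gen_closed scalar_closed)
  then show ?case by (auto intro: FA_closed scalar_closed)
qed (auto intro: FA_closed)

lemma free_poly_expand:
  "p = (\<Sum>w \<in> Poly_Mapping.keys p. scalar (Poly_Mapping.lookup p w) * prod_list (map gen (letters w)))"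
proof (rule poly_mapping_eqI)
  fix k
  have "scalar c * prod_list (map gen (letters w)) = Poly_Mapping.single w c" for c w
    using single_word[of "letters w" c] by simp
  then show "Poly_Mapping.lookup p k = Poly_Mapping.lookup
     (\<Sum>w \<in> Poly_Mapping.keys p. scalar (Poly_Mapping.lookup p w) * prod_list (map gen (letters w))) k"
    by (simp add: lookup_sum lookup_single when_def sum.delta in_keys_iff)
qed

lemma retr_id: assumes "p \<in> carrier (FA n)" shows "retr n p = p"
proof -
  have "map (\<lambda>i. if i < n then gen i else scalar (vpow (param 2 1 i))) (letters w) = map gen (letters w)"
    if "w \<in> Poly_Mapping.keys p" for w
    using assms that by (auto simp: free_algebra_def)
  then have "retr n p = (\<Sum>w \<in> Poly_Mapping.keys p. scalar (Poly_Mapping.lookup p w) * prod_list (map gen (letters w)))"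
    unfolding retr_def ev_def by (intro sum.cong refl arg_cong2[where f = "(*)"] arg_cong[where f = prod_list])
  then show ?thesis using free_poly_expand by metis
qed

lemma bar_poly_closed: "p \<in> carrier (FA n) \<Longrightarrow> bar_poly p \<in> carrier (FA n)"
  using retr_closed[of n "bar_poly p"] by (simp add: retr_id flip: bar_poly_retr)

section \<open>The quotient map onto the Hecke algebra\<close>

definition cls :: "nat \<Rightarrow> free_poly \<Rightarrow> free_poly set" where
  "cls n p = HI n +>\<^bsub>FA n\<^esub> p"

lemma ring_hom_cls: "ring_hom_ring (FA n) (HA n) (cls n)"
proof (rule ring_hom_ringI2[OF ring_free_algebra ring_hecke])
  show "cls n \<in> ring_hom (FA n) (HA n)"
    using ideal.rcos_ring_hom[OF ideal_hecke_ideal[of 2 1 n]] unfolding hecke_def cls_def[abs_def] .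
qed

lemma cls_closed: "p \<in> carrier (FA n) \<Longrightarrow> cls n p \<in> carrier (HA n)"
proof -
  interpret h: ring_hom_ring "FA n" "HA n" "cls n" by (rule ring_hom_cls)
  show "p \<in> carrier (FA n) \<Longrightarrow> cls n p \<in> carrier (HA n)" by (rule h.hom_closed)
qed

lemma cls_hom:
  assumes "p \<in> carrier (FA n)" "q \<in> carrier (FA n)"
  shows "cls n (p + q) = cls n p \<oplus>\<^bsub>HA n\<^esub> cls n q" "cls n (p * q) = cls n p \<otimes>\<^bsub>HA n\<^esub> cls n q"
    "cls n (p - q) = cls n p \<ominus>\<^bsub>HA n\<^esub> cls n q"
proof -
  interpret h: ring_hom_ring "FA n" "HA n" "cls n" by (rule ring_hom_cls)
  show "cls n (p + q) = cls n p \<oplus>\<^bsub>HA n\<^esub> cls n q" "cls n (p * q) = cls n p \<otimes>\<^bsub>HA n\<^esub> cls n q"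
    using h.hom_add[OF assms] h.hom_mult[OF assms] by simp_all
  show "cls n (p - q) = cls n p \<ominus>\<^bsub>HA n\<^esub> cls n q"
    using h.hom_add[OF assms(1) FA_closed(3)[OF assms(2)]] h.hom_a_inv[OF assms(2)]
    by (simp add: a_minus_def FA_a_inv[OF assms(2)])
qed

lemma cls_0: "cls n 0 = \<zero>\<^bsub>HA n\<^esub>" and cls_1: "cls n 1 = \<one>\<^bsub>HA n\<^esub>"
proof -
  interpret h: ring_hom_ring "FA n" "HA n" "cls n" by (rule ring_hom_cls)
  show "cls n 0 = \<zero>\<^bsub>HA n\<^esub>" "cls n 1 = \<one>\<^bsub>HA n\<^esub>" using h.hom_zero h.hom_one by simp_all
qed

lemma cls_sum:
  assumes "finite X" "\<And>x. x \<in> X \<Longrightarrow> f x \<in> carrier (FA n)"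
  shows "cls n (\<Sum>x \<in> X. f x) = (\<Oplus>\<^bsub>HA n\<^esub> x \<in> X. cls n (f x))"
proof -
  interpret H: ring "HA n" by (rule ring_hecke)
  show ?thesis using assms
    by (induction X rule: finite_induct) (simp_all add: cls_0 cls_hom FA_sum_closed cls_closed)
qed

lemma HA_carrierE: assumes "x \<in> carrier (HA n)" obtains p where "p \<in> carrier (FA n)" "x = cls n p"
  using assms unfolding hecke_def FactRing_def A_RCOSETS_def' cls_def by auto

lemma cls_eq_iff:
  "p \<in> carrier (FA n) \<Longrightarrow> q \<in> carrier (FA n) \<Longrightarrow> cls n p = cls n q \<longleftrightarrow> p - q \<in> HI n"
  using ring.quotient_eq_iff_same_a_r_cos[OF ring_free_algebra ideal_hecke_ideal, of p n q 2 1]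
  by (simp add: cls_def FA_minus)

lemma HI_subset: "HI n \<subseteq> carrier (FA n)"
  using ideal.Icarr[OF ideal_hecke_ideal] by blast

lemma relators_HI: "hecke_relators 2 1 n \<subseteq> HI n"
  unfolding hecke_ideal_def by (rule ring.genideal_self[OF ring_free_algebra hecke_relators_closed])

lemma ideal_FA:
  assumes "A \<subseteq> carrier (FA n)" "0 \<in> A" "\<And>p q. p \<in> A \<Longrightarrow> q \<in> A \<Longrightarrow> p + q \<in> A"
    "\<And>p q. p \<in> A \<Longrightarrow> q \<in> carrier (FA n) \<Longrightarrow> q * p \<in> A" "\<And>p q. p \<in> A \<Longrightarrow> q \<in> carrier (FA n) \<Longrightarrow> p * q \<in> A"
  shows "ideal A (FA n)"
proof (rule idealI[OF ring_free_algebra])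
  interpret F: ring "FA n" by (rule ring_free_algebra)
  show "subgroup A (add_monoid (FA n))"
  proof (rule F.add.subgroupI)
    show "A \<subseteq> carrier (FA n)" by fact
    show "A \<noteq> {}" using assms(2) by blast
    fix p assume p: "p \<in> A"
    have "(- 1) * p \<in> A" using assms(4)[OF p, of "- 1"] FA_closed by simp
    then show "\<ominus>\<^bsub>FA n\<^esub> p \<in> A" using p assms(1) FA_a_inv by auto
  qed (use assms in simp)
qed (use assms in simp_all)

lemma HI_induct:
  assumes "p \<in> HI n" "P 0" "\<And>p. p \<in> hecke_relators 2 1 n \<Longrightarrow> P p"
    "\<And>p q. P p \<Longrightarrow> P q \<Longrightarrow> P (p + q)"
    "\<And>p q. p \<in> carrier (FA n) \<Longrightarrow> P p \<Longrightarrow> q \<in> carrier (FA n) \<Longrightarrow> P (q * p)"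
    "\<And>p q. p \<in> carrier (FA n) \<Longrightarrow> P p \<Longrightarrow> q \<in> carrier (FA n) \<Longrightarrow> P (p * q)"
  shows "P p"
proof -
  let ?A = "{p \<in> carrier (FA n). P p}"
  have "ideal ?A (FA n)" using assms by (intro ideal_FA) (auto intro: FA_closed)
  moreover have "hecke_relators 2 1 n \<subseteq> ?A" using assms(3) hecke_relators_closed by blast
  ultimately have "HI n \<subseteq> ?A"
    unfolding hecke_ideal_def by (rule ring.genideal_minimal[OF ring_free_algebra])
  then show ?thesis using assms(1) by blast
qed

lemma HI_closed: "0 \<in> HI n" "p \<in> HI n \<Longrightarrow> q \<in> HI n \<Longrightarrow> p + q \<in> HI n"
  "p \<in> HI n \<Longrightarrow> q \<in> carrier (FA n) \<Longrightarrow> q * p \<in> HI n" "p \<in> HI n \<Longrightarrow> q \<in> carrier (FA n) \<Longrightarrow> p * q \<in> HI n"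
proof -
  interpret I: ideal "HI n" "FA n" by (rule ideal_hecke_ideal)
  have s: "additive_subgroup (HI n) (FA n)" by (rule I.is_additive_subgroup)
  show "0 \<in> HI n" "p \<in> HI n \<Longrightarrow> q \<in> HI n \<Longrightarrow> p + q \<in> HI n"
    using additive_subgroup.zero_closed[OF s] additive_subgroup.a_closed[OF s, of p q] by simp_all
  show "p \<in> HI n \<Longrightarrow> q \<in> carrier (FA n) \<Longrightarrow> q * p \<in> HI n" "p \<in> HI n \<Longrightarrow> q \<in> carrier (FA n) \<Longrightarrow> p * q \<in> HI n"
    using I.I_l_closed[of p q] I.I_r_closed[of p q] by simp_all
qed

lemma HI_uminus: "p \<in> HI n \<Longrightarrow> - p \<in> HI n"
  using HI_closed(3)[of p n "- 1"] FA_closed by simp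

lemma HI_diff: "p \<in> HI n \<Longrightarrow> q \<in> HI n \<Longrightarrow> p - q \<in> HI n"
  using HI_closed(2)[of p n "- q"] HI_uminus by simp

lemma retr_0_HI: "p \<in> HI n \<Longrightarrow> retr 0 p = 0"
  by (erule HI_induct[where P = "\<lambda>p. retr 0 p = 0"]) (simp_all add: retr_0_relators)

text \<open>The bar image of a braid relator differs from the relator by multiples of the quadratic
  relators t t - 1 - e t and s s - 1 - e s, so it stays in the ideal. One e serves both generators,
  as they have the same parameter.\<close>

lemma bar_braid3:
  fixes s t e :: "'a :: ring_1"
  assumes "s * e = e * s" "t * e = e * t"
  shows "(t - e) * (s - e) * (t - e) - (s - e) * (t - e) * (s - e) =
    (t * s * t - s * t * s) - e * (t * t - 1 - e * t) + e * (s * s - 1 - e * s)"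
proof -
  have c: "s * (e * x) = e * (s * x)" "t * (e * x) = e * (t * x)" for x
    using assms by (metis mult.assoc)+
  show ?thesis by (simp add: algebra_simps assms c)
qed

text \<open>With two different parameters the corrections are commutators of a generator with the
  quadratic relators u and w.\<close>

lemma bar_braid4:
  fixes s t e d :: "'a :: ring_1"
  assumes "s * e = e * s" "t * e = e * t" "s * d = d * s" "t * d = d * t" "e * d = d * e"
  defines "u \<equiv> s * s - 1 - d * s" and "w \<equiv> t * t - 1 - e * t"
  shows "(s - d) * (t - e) * (s - d) * (t - e) - (t - e) * (s - d) * (t - e) * (s - d) =
    (s * t * s * t - t * s * t * s) - e * (u * t - t * u) - d * (s * w - w * s)"
proof -
  have c: "s * (e * x) = e * (s * x)" "t * (e * x) = e * (t * x)" "s * (d * x) = d * (s * x)"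
    "t * (d * x) = d * (t * x)" "e * (d * x) = d * (e * x)" for x
    using assms(1-5) by (metis mult.assoc)+
  show ?thesis by (simp add: u_def w_def algebra_simps assms(1-5) c)
qed

lemma bar_relators_HI: assumes "p \<in> hecke_relators 2 1 n" shows "bar_poly p \<in> HI n"
proof -
  have quad_in: "gen i * gen i - 1 - scalar (qdiff i) * gen i \<in> HI n" if "i < n" for i
  proof -
    have "(gen i - scalar (vpow (param 2 1 i))) * (gen i + scalar (vpow (- param 2 1 i))) \<in> HI n"
      using relators_HI[of n] that by (auto simp: hecke_relators_def)
    moreover have "(gen i - scalar (vpow (param 2 1 i))) * (gen i + scalar (vpow (- param 2 1 i))) =
        gen i * gen i - 1 - scalar (qdiff i) * gen i"
      using scalar_comm[of "gen i"] scalar_mult[of "vpow (param 2 1 i)" "vpow (- param 2 1 i)"]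
      by (simp add: qdiff_def scalar_diff algebra_simps vpow_add)
    ultimately show ?thesis by simp
  qed
  show ?thesis using assms unfolding hecke_relators_def
  proof (elim UnE)
    assume "p \<in> {gen i * gen (i - 1) * gen i - gen (i - 1) * gen i * gen (i - 1) |i. 2 \<le> i \<and> i < n}"
    then obtain i where i: "2 \<le> i" "i < n" and p: "p = gen i * gen (i - 1) * gen i - gen (i - 1) * gen i * gen (i - 1)" by blast
    have p0: "p \<in> HI n" using relators_HI[of n] assms by blast
    have e: "qdiff (i - 1) = qdiff i" using i by (simp add: qdiff_def param_def)
    have "bar_poly p = p - scalar (qdiff i) * (gen i * gen i - 1 - scalar (qdiff i) * gen i)
        + scalar (qdiff i) * (gen (i - 1) * gen (i - 1) - 1 - scalar (qdiff i) * gen (i - 1))"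
      unfolding p bar_poly_simps e by (rule bar_braid3) (rule scalar_comm)+
    also have "\<dots> \<in> HI n"
    proof -
      have "i - 1 < n" using i by simp
      note q = quad_in[OF i(2)] quad_in[OF this, unfolded e]
      show ?thesis
        by (rule HI_closed(2)[OF HI_diff[OF p0 HI_closed(3)[OF q(1) scalar_closed]] HI_closed(3)[OF q(2) scalar_closed]])
    qed
    finally show ?thesis .
  next
    assume "p \<in> (if 2 \<le> n then {gen 0 * gen 1 * gen 0 * gen 1 - gen 1 * gen 0 * gen 1 * gen 0} else {})"
    then have n: "2 \<le> n" and p: "p = gen 0 * gen 1 * gen 0 * gen 1 - gen 1 * gen 0 * gen 1 * gen 0"
      by (auto split: if_splits)
    have p0: "p \<in> HI n" using relators_HI[of n] assms by blast
    have "bar_poly p = p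
       - scalar (qdiff 1) * ((gen 0 * gen 0 - 1 - scalar (qdiff 0) * gen 0) * gen 1 - gen 1 * (gen 0 * gen 0 - 1 - scalar (qdiff 0) * gen 0))
       - scalar (qdiff 0) * (gen 0 * (gen 1 * gen 1 - 1 - scalar (qdiff 1) * gen 1) - (gen 1 * gen 1 - 1 - scalar (qdiff 1) * gen 1) * gen 0)"
      unfolding p bar_poly_simps by (rule bar_braid4) (rule scalar_comm)+
    also have "\<dots> \<in> HI n"
    proof -
      have l: "0 < n" "1 < n" using n by auto
      note u = quad_in[OF l(1)] and w = quad_in[OF l(2)] and g = gen_closed[OF l(1)] gen_closed[OF l(2)]
      show ?thesis
        by (rule HI_diff[OF HI_diff[OF p0 HI_closed(3)[OF HI_diff[OF HI_closed(4)[OF u g(2)] HI_closed(3)[OF u g(2)]] scalar_closed]]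
           HI_closed(3)[OF HI_diff[OF HI_closed(3)[OF w g(1)] HI_closed(4)[OF w g(1)]] scalar_closed]])
    qed
    finally show ?thesis .
  next
    assume "p \<in> {gen i * gen j - gen j * gen i |i j. i < n \<and> j < n \<and> 1 < \<bar>int i - int j\<bar>}"
    then obtain i j where p: "p = gen i * gen j - gen j * gen i" by blast
    have p0: "p \<in> HI n" using relators_HI[of n] assms by blast
    have "bar_poly p = p"
      unfolding p using scalar_comm[of "gen i"] scalar_comm[of "gen j"] scalar_comm[of "scalar (qdiff i)"]
      by (simp add: algebra_simps)
    then show ?thesis using p0 by simp
  next
    assume "p \<in> {(gen i - scalar (vpow (param 2 1 i))) * (gen i + scalar (vpow (- param 2 1 i))) |i. i < n}"
    then obtain i where p: "p = (gen i - scalar (vpow (param 2 1 i))) * (gen i + scalar (vpow (- param 2 1 i)))" by blast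
    have p0: "p \<in> HI n" using relators_HI[of n] assms by blast
    have "bar_poly p = p"
      unfolding p by (simp add: qdiff_def scalar_diff)
    then show ?thesis using p0 by simp
  qed
qed

lemma bar_HI: "p \<in> HI n \<Longrightarrow> bar_poly p \<in> HI n"
  by (erule HI_induct[where P = "\<lambda>p. bar_poly p \<in> HI n"])
     (simp_all add: bar_relators_HI HI_closed bar_poly_closed)

lemma hecke_scalar_cls: "hecke_scalar 2 1 n c = cls n (scalar c)"
  by (simp add: hecke_scalar_def cls_def)

lemma T_gen_cls: "T_gen 2 1 n i = cls n (gen i)"
  by (simp add: T_gen_def cls_def)

lemma T_word_cls: "set is \<subseteq> {..<n} \<Longrightarrow> T_word 2 1 n is = cls n (prod_list (map gen is))"
  unfolding T_word_def
  by (induction "is") (simp_all add: cls_1 T_gen_cls cls_hom(2) gen_closed FA_prod_closed)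

definition gen_poly :: "nat \<Rightarrow> (int \<Rightarrow> int) \<Rightarrow> free_poly" where
  "gen_poly n w = prod_list (map gen (rw n w))"

lemma rw_lt: "w \<in> weylB n \<Longrightarrow> set (rw n w) \<subseteq> {..<n}"
  using rw[of w n] by (simp add: reduced_def)

lemma T_std_cls: "w \<in> weylB n \<Longrightarrow> T_std 2 1 n w = cls n (gen_poly n w)"
  unfolding gen_poly_def using T_word_cls[OF rw_lt] by (simp add: T_std_def rw_def)

lemma gen_poly_closed: "w \<in> weylB n \<Longrightarrow> gen_poly n w \<in> carrier (FA n)"
  unfolding gen_poly_def by (rule FA_prod_closed[OF rw_lt])

lemma std_poly_closed: "std_poly n c \<in> carrier (FA n)"
  unfolding std_poly_def using gen_poly_closed
  by (intro FA_sum_closed finite_weylB FA_closed(2) scalar_closed) (simp add: gen_poly_def)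

lemma cls_std_poly:
  "cls n (std_poly n c) = (\<Oplus>\<^bsub>HA n\<^esub> w \<in> weylB n. hecke_scalar 2 1 n (c w) \<otimes>\<^bsub>HA n\<^esub> T_std 2 1 n w)"
proof -
  interpret H: ring "HA n" by (rule ring_hecke)
  have "cls n (std_poly n c) = (\<Oplus>\<^bsub>HA n\<^esub> w \<in> weylB n. cls n (scalar (c w) * gen_poly n w))"
    unfolding std_poly_def gen_poly_def[symmetric]
    by (rule cls_sum[OF finite_weylB FA_closed(2)[OF scalar_closed gen_poly_closed]])
  also have "\<dots> = (\<Oplus>\<^bsub>HA n\<^esub> w \<in> weylB n. hecke_scalar 2 1 n (c w) \<otimes>\<^bsub>HA n\<^esub> T_std 2 1 n w)"
    by (intro H.finsum_cong') (auto simp: cls_hom scalar_closed gen_poly_closed hecke_scalar_cls T_std_cls cls_closed)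
  finally show ?thesis .
qed

section \<open>The ideal J\<close>

definition cgen :: "nat \<Rightarrow> free_poly" where
  "cgen i = gen i - scalar (vpow (param 2 1 i))"

definition J_relators :: "nat \<Rightarrow> free_poly set" where
  "J_relators n = (if 3 \<le> n then {cgen 1 * cgen 2 * cgen 1 - cgen 1} else {}) \<union>
     (if 2 \<le> n then {cgen 1 * cgen 0 * cgen 1 - scalar (vpow (1 - 2) + vpow (2 - 1)) * cgen 1} else {})"

lemma cgen_closed: "i < n \<Longrightarrow> cgen i \<in> carrier (FA n)"
  unfolding cgen_def by (intro FA_diff_closed gen_closed scalar_closed)

lemma C_gen_cls: "i < n \<Longrightarrow> C_gen 2 1 n i = cls n (cgen i)"
  by (simp add: C_gen_def cgen_def T_gen_cls hecke_scalar_cls cls_hom gen_closed scalar_closed)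

lemma J_relators_closed: "J_relators n \<subseteq> carrier (FA n)"
  unfolding J_relators_def
  by (auto intro!: FA_diff_closed FA_closed(2) cgen_closed scalar_closed)

lemma J_gens_cls: "J_gens 2 1 n = cls n ` J_relators n"
proof -
  have "C_gen 2 1 n 1 \<otimes>\<^bsub>HA n\<^esub> C_gen 2 1 n 2 \<otimes>\<^bsub>HA n\<^esub> C_gen 2 1 n 1 \<ominus>\<^bsub>HA n\<^esub> C_gen 2 1 n 1
      = cls n (cgen 1 * cgen 2 * cgen 1 - cgen 1)" if "3 \<le> n"
    using that by (simp add: C_gen_cls cls_hom FA_closed(2) cgen_closed)
  moreover have "C_gen 2 1 n 1 \<otimes>\<^bsub>HA n\<^esub> C_gen 2 1 n 0 \<otimes>\<^bsub>HA n\<^esub> C_gen 2 1 n 1 \<ominus>\<^bsub>HA n\<^esub>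
        hecke_scalar 2 1 n (vpow (1 - 2) + vpow (2 - 1)) \<otimes>\<^bsub>HA n\<^esub> C_gen 2 1 n 1
      = cls n (cgen 1 * cgen 0 * cgen 1 - scalar (vpow (1 - 2) + vpow (2 - 1)) * cgen 1)" if "2 \<le> n"
    using that by (simp add: C_gen_cls hecke_scalar_cls cls_hom FA_closed(2) cgen_closed scalar_closed)
  ultimately show ?thesis unfolding J_gens_def J_relators_def image_Un by auto
qed

lemma J_gens_closed: "J_gens 2 1 n \<subseteq> carrier (HA n)"
  unfolding J_gens_cls using J_relators_closed cls_closed by blast

lemma ideal_J: "ideal (J_ideal 2 1 n) (HA n)"
  unfolding J_ideal_def by (rule ring.genideal_ideal[OF ring_hecke J_gens_closed])

lemma ideal_cls_image:
  assumes "A \<subseteq> carrier (FA n)" "0 \<in> A" "\<And>p q. p \<in> A \<Longrightarrow> q \<in> A \<Longrightarrow> p + q \<in> A"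
    "\<And>p q. p \<in> A \<Longrightarrow> q \<in> carrier (FA n) \<Longrightarrow> q * p \<in> A" "\<And>p q. p \<in> A \<Longrightarrow> q \<in> carrier (FA n) \<Longrightarrow> p * q \<in> A"
  shows "ideal (cls n ` A) (HA n)"
proof (rule idealI[OF ring_hecke])
  interpret H: ring "HA n" by (rule ring_hecke)
  interpret h: ring_hom_ring "FA n" "HA n" "cls n" by (rule ring_hom_cls)
  have A: "p \<in> carrier (FA n)" if "p \<in> A" for p using that assms(1) by blast
  show "subgroup (cls n ` A) (add_monoid (HA n))"
  proof (rule H.add.subgroupI)
    show "cls n ` A \<subseteq> carrier (HA n)" using cls_closed A by blast
    show "cls n ` A \<noteq> {}" using assms(2) by blast
    fix x assume "x \<in> cls n ` A"
    then obtain p where p: "p \<in> A" "x = cls n p" by blast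
    have "- p \<in> A" using assms(4)[OF p(1), of "- 1"] FA_closed by simp
    moreover have "\<ominus>\<^bsub>HA n\<^esub> x = cls n (- p)"
      unfolding p(2) using h.hom_a_inv[OF A[OF p(1)]] FA_a_inv[OF A[OF p(1)]] by simp
    ultimately show "\<ominus>\<^bsub>HA n\<^esub> x \<in> cls n ` A" by blast
  next
    fix x y assume "x \<in> cls n ` A" "y \<in> cls n ` A"
    then obtain p q where p: "p \<in> A" "x = cls n p" "q \<in> A" "y = cls n q" by blast
    then have "x \<oplus>\<^bsub>HA n\<^esub> y = cls n (p + q)" by (simp add: cls_hom A)
    then show "x \<oplus>\<^bsub>HA n\<^esub> y \<in> cls n ` A" using assms(3) p by blast
  qed
  fix x y assume "x \<in> cls n ` A" "y \<in> carrier (HA n)"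
  then obtain p q where p: "p \<in> A" "x = cls n p" "q \<in> carrier (FA n)" "y = cls n q" by (auto elim: HA_carrierE)
  then have "y \<otimes>\<^bsub>HA n\<^esub> x = cls n (q * p)" "x \<otimes>\<^bsub>HA n\<^esub> y = cls n (p * q)" by (simp_all add: cls_hom A)
  then show "y \<otimes>\<^bsub>HA n\<^esub> x \<in> cls n ` A" "x \<otimes>\<^bsub>HA n\<^esub> y \<in> cls n ` A" using assms(4,5) p by blast+
qed

text \<open>The preimage of J in the free algebra on n letters, where all computations with
  representatives take place.\<close>

definition JI :: "nat \<Rightarrow> free_poly set" where
  "JI n = {p \<in> carrier (FA n). cls n p \<in> J_ideal 2 1 n}"

lemma JI_closed: "0 \<in> JI n" "p \<in> JI n \<Longrightarrow> q \<in> JI n \<Longrightarrow> p + q \<in> JI n"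
  "p \<in> JI n \<Longrightarrow> q \<in> carrier (FA n) \<Longrightarrow> q * p \<in> JI n" "p \<in> JI n \<Longrightarrow> q \<in> carrier (FA n) \<Longrightarrow> p * q \<in> JI n"
proof -
  interpret I: ideal "J_ideal 2 1 n" "HA n" by (rule ideal_J)
  have s: "additive_subgroup (J_ideal 2 1 n) (HA n)" by (rule I.is_additive_subgroup)
  show "0 \<in> JI n" "p \<in> JI n \<Longrightarrow> q \<in> JI n \<Longrightarrow> p + q \<in> JI n"
    using additive_subgroup.zero_closed[OF s] additive_subgroup.a_closed[OF s, of "cls n p" "cls n q"]
    by (simp_all add: JI_def cls_0 cls_hom FA_closed)
  show "p \<in> JI n \<Longrightarrow> q \<in> carrier (FA n) \<Longrightarrow> q * p \<in> JI n" "p \<in> JI n \<Longrightarrow> q \<in> carrier (FA n) \<Longrightarrow> p * q \<in> JI n"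
    using I.I_l_closed[of "cls n p" "cls n q"] I.I_r_closed[of "cls n p" "cls n q"]
    by (simp_all add: JI_def cls_hom FA_closed cls_closed)
qed

lemma HI_JI: "HI n \<subseteq> JI n"
proof
  fix p assume p: "p \<in> HI n"
  then have c: "p \<in> carrier (FA n)" using HI_subset by blast
  have "cls n p = cls n 0" using p by (subst cls_eq_iff[OF c FA_closed(4)]) simp
  then show "p \<in> JI n" using JI_closed(1)[of n] c by (simp add: JI_def)
qed

lemma J_relators_JI: "J_relators n \<subseteq> JI n"
  using ring.genideal_self[OF ring_hecke J_gens_closed] J_relators_closed
  unfolding JI_def J_ideal_def J_gens_cls by blast

text \<open>The polynomials with P map onto an ideal of the Hecke algebra that contains the
  generators of J. Passing back to a representative changes p by an element of \<open>HI n\<close>,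
  hence the hypothesis on all of \<open>HI n\<close>.\<close>

lemma JI_induct:
  assumes "p \<in> JI n" and HI: "\<And>p. p \<in> HI n \<Longrightarrow> P p" and J: "\<And>p. p \<in> J_relators n \<Longrightarrow> P p"
    and add: "\<And>p q. P p \<Longrightarrow> P q \<Longrightarrow> P (p + q)"
    and mult: "\<And>p q. p \<in> carrier (FA n) \<Longrightarrow> P p \<Longrightarrow> q \<in> carrier (FA n) \<Longrightarrow> P (q * p)"
      "\<And>p q. p \<in> carrier (FA n) \<Longrightarrow> P p \<Longrightarrow> q \<in> carrier (FA n) \<Longrightarrow> P (p * q)"
  shows "P p"
proof -
  let ?A = "{p \<in> carrier (FA n). P p}"
  have "ideal (cls n ` ?A) (HA n)"
    using add mult HI[OF HI_closed(1)] by (intro ideal_cls_image) (auto intro: FA_closed)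
  moreover have "J_gens 2 1 n \<subseteq> cls n ` ?A" unfolding J_gens_cls using J J_relators_closed by blast
  ultimately have "J_ideal 2 1 n \<subseteq> cls n ` ?A"
    unfolding J_ideal_def by (rule ring.genideal_minimal[OF ring_hecke])
  then obtain q where q: "q \<in> carrier (FA n)" "P q" "cls n p = cls n q" using assms(1) unfolding JI_def by blast
  then have "p - q \<in> HI n" using assms(1) cls_eq_iff unfolding JI_def by blast
  from add[OF HI[OF this] q(2)] show ?thesis by simp
qed

lemma bar_cgen: "bar_poly (cgen i) = cgen i"
  by (simp add: cgen_def qdiff_def scalar_diff)

lemma bar_J_relators: "p \<in> J_relators n \<Longrightarrow> bar_poly p = p"
  unfolding J_relators_def by (auto simp: bar_cgen add.commute split: if_splits)

lemma retr_0_J_relators: "p \<in> J_relators n \<Longrightarrow> retr 0 p = 0"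
  unfolding J_relators_def by (auto simp: cgen_def split: if_splits)

lemma bar_JI: "p \<in> JI n \<Longrightarrow> bar_poly p \<in> JI n"
proof (erule JI_induct[where P = "\<lambda>p. bar_poly p \<in> JI n"])
  show "bar_poly p \<in> JI n" if "p \<in> HI n" for p using bar_HI[OF that] HI_JI by blast
  show "bar_poly p \<in> JI n" if "p \<in> J_relators n" for p
    unfolding bar_J_relators[OF that] using that J_relators_JI by blast
qed (simp_all add: JI_closed bar_poly_closed)

lemma retr_0_JI: "p \<in> JI n \<Longrightarrow> retr 0 p = 0"
  by (erule JI_induct[where P = "\<lambda>p. retr 0 p = 0"]) (simp_all add: retr_0_HI retr_0_J_relators)

section \<open>Calculating in the Hecke algebra and in its quotient\<close>

lemma bar_stable_retr:
  assumes "0 \<in> A" "\<And>p q. p \<in> A \<Longrightarrow> q \<in> A \<Longrightarrow> p + q \<in> A"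
    "\<And>p q. p \<in> A \<Longrightarrow> q \<in> carrier (FA n) \<Longrightarrow> q * p \<in> A" "\<And>p q. p \<in> A \<Longrightarrow> q \<in> carrier (FA n) \<Longrightarrow> p * q \<in> A"
    "\<And>p. p \<in> A \<Longrightarrow> bar_poly p \<in> A"
  shows "bar_stable {p. retr n p \<in> A}"
  unfolding bar_stable_def two_sided_def using assms retr_closed
  by (auto simp flip: bar_poly_retr)

text \<open>\<open>bar_stable\<close> concerns ideals of the free algebra on all letters, whereas
  \<open>HI n\<close> lives on n letters. The preimage under the retraction extends it without
  changing it on \<open>carrier (FA n)\<close>.\<close>

definition KH :: "nat \<Rightarrow> free_poly set" where "KH n = {p. retr n p \<in> HI n}"
definition KJ :: "nat \<Rightarrow> free_poly set" where "KJ n = {p. retr n p \<in> JI n}"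

lemma bar_stable_KH: "bar_stable (KH n)"
  unfolding KH_def by (rule bar_stable_retr) (auto intro: HI_closed bar_HI)

lemma bar_stable_KJ: "bar_stable (KJ n)"
  unfolding KJ_def by (rule bar_stable_retr) (auto intro: JI_closed bar_JI)

lemma mem_KH: "p \<in> carrier (FA n) \<Longrightarrow> p \<in> KH n \<longleftrightarrow> p \<in> HI n"
  by (simp add: KH_def retr_id)

lemma mem_KJ: "p \<in> carrier (FA n) \<Longrightarrow> p \<in> KJ n \<longleftrightarrow> p \<in> JI n"
  by (simp add: KJ_def retr_id)

lemma relators_K: "hecke_relators 2 1 n \<subseteq> KH n" "hecke_relators 2 1 n \<subseteq> KJ n"
proof -
  show "hecke_relators 2 1 n \<subseteq> KH n" using relators_HI[of n] hecke_relators_closed[of 2 1 n] mem_KH by blast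
  show "hecke_relators 2 1 n \<subseteq> KJ n" using relators_HI[of n] HI_JI hecke_relators_closed[of 2 1 n] mem_KJ by blast
qed

lemma emb_KH_eq_0: assumes "p \<in> carrier (FA n)" shows "emb (KH n) p = 0 \<longleftrightarrow> p \<in> HI n"
  using emb_eq_0D[OF bar_stable_KH] emb_eq_0I retr_0_HI mem_KH[OF assms] by blast

lemma emb_KJ_eq_0: assumes "p \<in> carrier (FA n)" shows "emb (KJ n) p = 0 \<longleftrightarrow> p \<in> JI n"
  using emb_eq_0D[OF bar_stable_KJ] emb_eq_0I retr_0_JI mem_KJ[OF assms] by blast

lemma emb_KH_eq_iff:
  assumes "p \<in> carrier (FA n)" "q \<in> carrier (FA n)"
  shows "emb (KH n) p = emb (KH n) q \<longleftrightarrow> cls n p = cls n q"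
  using emb_KH_eq_0[OF FA_diff_closed[OF assms]] cls_eq_iff[OF assms] by (simp add: emb_hom)

locale quotient_alg =
  fixes n :: nat and K :: "free_poly set"
  assumes K: "bar_stable K" and rel: "hecke_relators 2 1 n \<subseteq> K"
begin

sublocale hecke_bar 2 1 n sc_h "\<lambda>i. emb K (gen i)" bar_h
  by (rule hecke_bar_emb[OF rel])

lemma Tword_emb: "Tword is = emb K (prod_list (map gen is))"
  by (simp add: Tword_def emb_prod)

lemma Tw_emb: "Tw w = emb K (gen_poly n w)"
  unfolding Tw_def gen_poly_def rw_def by (rule Tword_emb)

lemma comb_emb: "comb c = emb K (std_poly n c)"
  unfolding comb_def std_poly_def emb_sum
  by (simp add: Tw_emb gen_poly_def emb_hom emb_scalar)

lemma emb_aspan: assumes "p \<in> carrier (FA n)" shows "emb K p \<in> aspan (\<lambda>_. True)"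
proof -
  have "emb K p = (\<Sum>w \<in> Poly_Mapping.keys p. sc_h (Poly_Mapping.lookup p w) * Tword (letters w))"
    by (subst free_poly_expand[of p]) (simp add: emb_sum emb_hom emb_scalar Tword_emb)
  also have "\<dots> \<in> aspan (\<lambda>_. True)"
  proof (intro aspan_sum finite_keys aspan_scale)
    fix w assume "w \<in> Poly_Mapping.keys p"
    then have "set (letters w) \<subseteq> {..<n}" using assms by (auto simp: free_algebra_def)
    from Tword_aspan[OF this] show "Tword (letters w) \<in> aspan (\<lambda>_. True)" by (rule aspan_mono) simp
  qed
  finally show ?thesis .
qed

end

lemma (in hecke_alg) triangular_span:
  assumes C: "\<And>y. y \<in> W \<Longrightarrow> C y - Tw y \<in> aspan (\<lambda>z. len n z < len n y)" and x: "x \<in> aspan (\<lambda>_. True)"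
  obtains g where "x = (\<Sum>y \<in> W. sc (g y) * C y)"
proof -
  define X where "X = {\<Sum>y \<in> W. sc (g y) * C y | g. True}"
  have X0: "0 \<in> X" unfolding X_def by (rule CollectI, rule exI[of _ "\<lambda>_. 0"]) simp
  have Xadd: "x + y \<in> X" if xy: "x \<in> X" "y \<in> X" for x y
  proof -
    obtain g h where "x = (\<Sum>y \<in> W. sc (g y) * C y)" "y = (\<Sum>y \<in> W. sc (h y) * C y)" using xy unfolding X_def by blast
    then have "x + y = (\<Sum>y \<in> W. sc (g y + h y) * C y)" by (simp add: sc_add distrib_right sum.distrib)
    then show ?thesis unfolding X_def by (intro CollectI exI[of _ "\<lambda>y. g y + h y"]) simp
  qed
  have Xscale: "sc p * x \<in> X" if x: "x \<in> X" for x p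
  proof -
    obtain g where "x = (\<Sum>y \<in> W. sc (g y) * C y)" using x unfolding X_def by blast
    then have "sc p * x = (\<Sum>y \<in> W. sc (p * g y) * C y)" by (simp add: sc_mult sum_distrib_left mult.assoc)
    then show ?thesis unfolding X_def by (intro CollectI exI[of _ "\<lambda>y. p * g y"]) simp
  qed
  have XC: "C y \<in> X" if "y \<in> W" for y
    unfolding X_def by (rule CollectI, rule exI[of _ "\<lambda>z. if z = y then 1 else 0"]) (simp add: sc_if_mult finite_weylB that)
  have Tw: "Tw w \<in> X" if "w \<in> W" for w
    using that
  proof (induction "len n w" arbitrary: w rule: less_induct)
    case less
    have "C w - Tw w \<in> X"
      by (rule aspan_induct[OF C[OF less.prems]]) (auto intro: X0 Xadd Xscale less.hyps)
    from Xadd[OF XC[OF less.prems] Xscale[OF this, of "- 1"]] show ?case by (simp add: sc_uminus)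
  qed
  have "x \<in> X" by (rule aspan_induct[OF x]) (auto intro: X0 Xadd Xscale Tw)
  then show thesis using that unfolding X_def by blast
qed

lemma (in hecke_bar) T_bar_T:
  assumes "i < n" shows "T i * bar (T i) = 1" "bar (T i) * T i = 1"
  unfolding bar_T[OF assms] using quad[OF assms] by (simp_all add: right_diff_distrib left_diff_distrib sc_comm)

lemma (in hecke_bar) Tword_rev_bar:
  "set is \<subseteq> {..<n} \<Longrightarrow> Tword (rev is) * bar (Tword is) = 1 \<and> bar (Tword is) * Tword (rev is) = 1"
proof (induction "is")
  case (Cons i "is")
  then have i: "i < n" by simp
  have "Tword (rev (i # is)) * bar (Tword (i # is)) = Tword (rev is) * (T i * bar (T i)) * bar (Tword is)"
    by (simp add: bar_mult mult.assoc)
  moreover have "bar (Tword (i # is)) * Tword (rev (i # is)) = bar (T i) * (bar (Tword is) * Tword (rev is)) * T i"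
    by (simp add: bar_mult mult.assoc)
  ultimately show ?case using Cons by (simp only: T_bar_T[OF i]) (simp add: T_bar_T[OF i])
qed (simp_all add: bar_1)

lemma (in hecke_alg) Tw_s_gen: assumes "i < n" shows "Tw (s_gen i) = T i"
proof -
  have "\<not> descent id i" by (cases i) (simp_all add: descent_def lo_def hi_def)
  from Tw_ascent[OF id_weylB assms this] show ?thesis by simp
qed

interpretation HQ: quotient_alg n "KH n" for n
  by (rule quotient_alg.intro[OF bar_stable_KH relators_K(1)])

interpretation JQ: quotient_alg n "KJ n" for n
  by (rule quotient_alg.intro[OF bar_stable_KJ relators_K(2)])

text \<open>It shares ring, scalars and generators with the preceding interpretation, so the lattice
  results and the bar involution concern the same \<open>JQ.Tw\<close>.\<close>

interpretation JQ: blob_alg n sc_h "\<lambda>i. emb (KJ n) (gen i)" for n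
proof unfold_locales
  have r: "emb (KJ n) p = 0" if "p \<in> J_relators n" for p
    using that J_relators_JI J_relators_closed emb_KJ_eq_0 by blast
  have c: "emb (KJ n) (cgen i) = emb (KJ n) (gen i) - sc_h (vpow (param 2 1 i))" for i
    by (simp add: cgen_def emb_hom emb_scalar)
  have p: "param 2 1 1 = 2" "param 2 1 2 = 2" "param 2 1 0 = 1" by (simp_all add: param_def)
  let ?T = "\<lambda>i. emb (KJ n) (gen i)"
  show "(?T 1 - sc_h (vpow 2)) * (?T 2 - sc_h (vpow 2)) * (?T 1 - sc_h (vpow 2)) = ?T 1 - sc_h (vpow 2)" if "3 \<le> n"
  proof -
    have "cgen 1 * cgen 2 * cgen 1 - cgen 1 \<in> J_relators n" using that by (simp add: J_relators_def)
    from r[OF this] show ?thesis unfolding emb_hom c p by simp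
  qed
  show "(?T 1 - sc_h (vpow 2)) * (?T 0 - sc_h (vpow 1)) * (?T 1 - sc_h (vpow 2)) =
      sc_h (vpow (- 1) + vpow 1) * (?T 1 - sc_h (vpow 2))" if "2 \<le> n"
  proof -
    have "cgen 1 * cgen 0 * cgen 1 - scalar (vpow (1 - 2) + vpow (2 - 1)) * cgen 1 \<in> J_relators n"
      using that by (simp add: J_relators_def)
    from r[OF this] show ?thesis unfolding emb_hom c p emb_scalar by simp
  qed
qed

section \<open>Independence in the Hecke algebra and in the quotient\<close>

lemma HI_T_op: "p \<in> HI n \<Longrightarrow> closed_under n P \<Longrightarrow> ev S_op (T_op P 2 1) p = 0"
  by (erule HI_induct[where P = "\<lambda>p. ev S_op (T_op P 2 1) p = 0"])
     (simp_all add: hecke_relators_T_op T_op.ev_simps)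

lemma JI_T_op: "p \<in> JI n \<Longrightarrow> ev S_op (T_op (pm_fun n) 2 1) p = 0"
proof (erule JI_induct[where P = "\<lambda>p. ev S_op (T_op (pm_fun n) 2 1) p = 0"])
  show "ev S_op (T_op (pm_fun n) 2 1) p = 0" if "p \<in> HI n" for p by (rule HI_T_op[OF that closed_pm_fun])
  show "ev S_op (T_op (pm_fun n) 2 1) p = 0" if "p \<in> J_relators n" for p
    using that J_relators_T_op[of n] unfolding J_relators_def
    by (auto simp: cgen_def T_op.ev_simps split: if_splits)
qed (simp_all add: T_op.ev_simps)

lemma HQ_independent: "HQ.independent n (\<lambda>_. True)"
  unfolding HQ.independent_def
proof (intro allI impI ballI)
  fix c w assume c: "HQ.comb n c = 0" and w: "w \<in> weylB n"
  then have "std_poly n c \<in> HI n" by (simp add: HQ.comb_emb emb_KH_eq_0[OF std_poly_closed])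
  from std_poly_independent[OF HI_T_op[OF this closed_odd] w] show "c w = 0" .
qed

lemma JQ_independent: "JQ.independent n avoids"
  unfolding JQ.independent_def
proof (intro allI impI ballI)
  fix c w assume c: "JQ.comb n c = 0" and s: "\<forall>w \<in> weylB n. \<not> avoids w \<longrightarrow> c w = 0" and w: "w \<in> weylB n"
  then have "std_poly n c \<in> JI n" by (simp add: JQ.comb_emb emb_KJ_eq_0[OF std_poly_closed])
  from std_poly_avoids_independent[OF JI_T_op[OF this] _ w] s show "c w = 0" by blast
qed

section \<open>The bar involution and the Kazhdan--Lusztig basis\<close>

text \<open>The maps are not assumed linear. Agreement at v forces agreement at v^(-1), since
  inverses are preserved, and then at all scalars.\<close>

lemma ring_hom_HA_eqI:
  assumes f: "f \<in> ring_hom (HA n) (HA n)" and g: "g \<in> ring_hom (HA n) (HA n)"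
    and v: "f (cls n (scalar (vpow 1))) = g (cls n (scalar (vpow 1)))"
    and T: "\<And>i. i < n \<Longrightarrow> f (cls n (gen i)) = g (cls n (gen i))" and x: "x \<in> carrier (HA n)"
  shows "f x = g x"
proof -
  interpret H: ring "HA n" by (rule ring_hecke)
  interpret f: ring_hom_ring "HA n" "HA n" f by (rule ring_hom_ringI2[OF ring_hecke ring_hecke f])
  interpret g: ring_hom_ring "HA n" "HA n" g by (rule ring_hom_ringI2[OF ring_hecke ring_hecke g])
  let ?G = "{p \<in> carrier (FA n). f (cls n p) = g (cls n p)}"
  have G_mult: "p * q \<in> ?G" if "p \<in> ?G" "q \<in> ?G" for p q
    using that by (simp add: FA_closed cls_hom cls_closed)
  have G_add: "p + q \<in> ?G" if "p \<in> ?G" "q \<in> ?G" for p q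
    using that by (simp add: FA_closed cls_hom cls_closed)
  have G_1: "1 \<in> ?G" by (simp add: FA_closed cls_1)
  have G_0: "0 \<in> ?G" by (simp add: FA_closed cls_0)
  have G_uminus: "- p \<in> ?G" if "p \<in> ?G" for p
    using that cls_hom(3)[OF FA_closed(4), of p n]
    by (simp add: FA_closed cls_0 cls_closed a_minus_def)
  have v1: "scalar (vpow 1) \<in> ?G" using v scalar_closed by simp
  have vm1: "scalar (vpow (- 1)) \<in> ?G"
  proof -
    let ?x = "cls n (scalar (vpow 1))" and ?y = "cls n (scalar (vpow (- 1)))"
    have c: "?x \<in> carrier (HA n)" "?y \<in> carrier (HA n)" by (simp_all add: cls_closed scalar_closed)
    have 1: "?x \<otimes>\<^bsub>HA n\<^esub> ?y = \<one>\<^bsub>HA n\<^esub>" "?y \<otimes>\<^bsub>HA n\<^esub> ?x = \<one>\<^bsub>HA n\<^esub>"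
      by (simp_all add: cls_hom(2)[symmetric] scalar_closed cls_1 vpow_add flip: scalar_mult)
    have fy: "f ?y \<otimes>\<^bsub>HA n\<^esub> f ?x = \<one>\<^bsub>HA n\<^esub>" using f.hom_mult[OF c(2,1)] 1 by simp
    have gy: "f ?x \<otimes>\<^bsub>HA n\<^esub> g ?y = \<one>\<^bsub>HA n\<^esub>" using g.hom_mult[OF c] 1 v by simp
    have "f ?y = f ?y \<otimes>\<^bsub>HA n\<^esub> (f ?x \<otimes>\<^bsub>HA n\<^esub> g ?y)" using gy c by simp
    also have "\<dots> = g ?y" using fy c by (simp flip: H.m_assoc)
    finally show ?thesis using scalar_closed by simp
  qed
  have vpow: "scalar (vpow k) \<in> ?G" for k
  proof (induction k rule: int_induct[where k = 0])
    case base
    show ?case using G_1 by simp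
  next
    case (step1 i)
    from G_mult[OF step1(2) v1] show ?case by (simp only: scalar_mult[symmetric] vpow_add)
  next
    case (step2 i)
    from G_mult[OF step2(2) vm1] show ?case by (simp only: scalar_mult[symmetric] vpow_add) simp
  qed
  have scalar: "scalar c \<in> ?G" for c
  proof (induction c rule: laurent_induct)
    case (minus p)
    then show ?case using G_uminus by (simp only: scalar_uminus)
  next
    case (add p q)
    then show ?case using G_add by (simp only: scalar_add)
  qed (rule vpow)
  have gens: "prod_list (map gen is) \<in> ?G" if "set is \<subseteq> {..<n}" for "is"
    using that
  proof (induction "is")
    case (Cons i "is")
    have "gen i \<in> ?G" using Cons.prems T gen_closed by simp
    from G_mult[OF this] Cons show ?case by simp
  qed (use G_1 in simp)
  obtain p where p: "p \<in> carrier (FA n)" "x = cls n p" using x by (rule HA_carrierE)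
  have "(\<Sum>w \<in> Poly_Mapping.keys p. scalar (Poly_Mapping.lookup p w) * prod_list (map gen (letters w))) \<in> ?G"
    by (rule sum_in[OF finite_keys G_mult[OF scalar gens] G_0 G_add]) (use p in \<open>auto simp: free_algebra_def\<close>)
  then show ?thesis unfolding p(2) using free_poly_expand[of p] by simp
qed

text \<open>\<open>bar_poly\<close> descends to the quotient. The restriction to the carrier yields
  the extensionality demanded in \<open>bar_inv\<close>.\<close>

definition bar_H :: "nat \<Rightarrow> free_poly set \<Rightarrow> free_poly set" where
  "bar_H n = (\<lambda>x \<in> carrier (HA n). cls n (bar_poly (SOME p. p \<in> carrier (FA n) \<and> cls n p = x)))"

lemma bar_H_cls: assumes "p \<in> carrier (FA n)" shows "bar_H n (cls n p) = cls n (bar_poly p)"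
proof -
  let ?q = "SOME q. q \<in> carrier (FA n) \<and> cls n q = cls n p"
  have q: "?q \<in> carrier (FA n) \<and> cls n ?q = cls n p" by (rule someI[of _ p]) (use assms in simp)
  then have "?q - p \<in> HI n" using cls_eq_iff assms by blast
  then have "bar_poly ?q - bar_poly p \<in> HI n" using bar_HI[of "?q - p"] by simp
  then have "cls n (bar_poly ?q) = cls n (bar_poly p)" using q assms cls_eq_iff bar_poly_closed by blast
  then show ?thesis using cls_closed[OF assms] by (simp add: bar_H_def)
qed

lemma bar_H_hom: "bar_H n \<in> ring_hom (HA n) (HA n)"
proof (rule ring_hom_memI)
  show "bar_H n x \<in> carrier (HA n)" if "x \<in> carrier (HA n)" for x
    using HA_carrierE[OF that] by (metis bar_H_cls bar_poly_closed cls_closed)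
  fix x y assume "x \<in> carrier (HA n)" "y \<in> carrier (HA n)"
  then obtain p q where p: "p \<in> carrier (FA n)" "x = cls n p" "q \<in> carrier (FA n)" "y = cls n q"
    by (metis HA_carrierE)
  then show "bar_H n (x \<otimes>\<^bsub>HA n\<^esub> y) = bar_H n x \<otimes>\<^bsub>HA n\<^esub> bar_H n y"
    "bar_H n (x \<oplus>\<^bsub>HA n\<^esub> y) = bar_H n x \<oplus>\<^bsub>HA n\<^esub> bar_H n y"
    by (simp_all add: bar_H_cls FA_closed bar_poly_closed flip: cls_hom)
next
  show "bar_H n \<one>\<^bsub>HA n\<^esub> = \<one>\<^bsub>HA n\<^esub>" by (simp add: bar_H_cls FA_closed flip: cls_1)
qed

lemma bar_H_iso: "bar_H n \<in> ring_iso (HA n) (HA n)"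
  unfolding ring_iso_def
proof (intro CollectI conjI bar_H_hom bij_betw_byWitness[where f' = "bar_H n"])
  show "\<forall>x \<in> carrier (HA n). bar_H n (bar_H n x) = x" "\<forall>x \<in> carrier (HA n). bar_H n (bar_H n x) = x"
    by (auto elim!: HA_carrierE simp: bar_H_cls bar_poly_closed)
  show "bar_H n ` carrier (HA n) \<subseteq> carrier (HA n)" "bar_H n ` carrier (HA n) \<subseteq> carrier (HA n)"
    by (auto elim!: HA_carrierE simp: bar_H_cls bar_poly_closed cls_closed)
qed

lemma bar_H_T_std:
  assumes w: "w \<in> weylB n" shows "bar_H n (T_std 2 1 n w) = m_inv (HA n) (T_std 2 1 n (inv_into UNIV w))"
proof -
  interpret H: ring "HA n" by (rule ring_hecke)
  let ?q = "gen_poly n (inv_into UNIV w)" and ?p = "bar_poly (gen_poly n w)"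
  note iw = weylB_inv[OF w]
  have c: "?q \<in> carrier (FA n)" "?p \<in> carrier (FA n)"
    by (simp_all add: gen_poly_closed[OF iw] bar_poly_closed gen_poly_closed[OF w])
  have q: "emb (KH n) ?q = HQ.Tword n (rev (rw n w))"
  proof -
    have "inv_into UNIV w = word_perm (rev (rw n w))" using inv_word_perm rw(2)[OF w] by metis
    then show ?thesis using HQ.Tword_reduced[OF reduced_rev[OF rw(1)[OF w]]] HQ.Tw_emb by simp
  qed
  have p: "emb (KH n) ?p = bar_h (HQ.Tword n (rw n w))"
    by (simp add: bar_h_emb HQ.Tword_emb gen_poly_def)
  have "emb (KH n) (?q * ?p) = emb (KH n) 1" "emb (KH n) (?p * ?q) = emb (KH n) 1"
    using HQ.Tword_rev_bar[OF rw_lt[OF w]] by (simp_all add: emb_hom q p)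
  then have "cls n ?q \<otimes>\<^bsub>HA n\<^esub> cls n ?p = \<one>\<^bsub>HA n\<^esub>" "cls n ?p \<otimes>\<^bsub>HA n\<^esub> cls n ?q = \<one>\<^bsub>HA n\<^esub>"
    using c by (simp_all add: emb_KH_eq_iff FA_closed cls_hom cls_1)
  from H.inv_unique'[OF cls_closed[OF c(1)] cls_closed[OF c(2)] this]
  show ?thesis by (simp add: T_std_cls[OF w] T_std_cls[OF iw] bar_H_cls[OF gen_poly_closed[OF w]])
qed

lemma T_std_s_gen: assumes "i < n" shows "T_std 2 1 n (s_gen i) = cls n (gen i)"
proof -
  have "emb (KH n) (gen_poly n (s_gen i)) = emb (KH n) (gen i)"
    using HQ.Tw_s_gen[OF assms] by (simp add: HQ.Tw_emb)
  then show ?thesis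
    using assms by (simp add: T_std_cls s_gen_weylB emb_KH_eq_iff gen_poly_closed gen_closed)
qed

text \<open>For uniqueness, T_w at w = s_i is the generator T_i, so the prescribed values determine
  a homomorphism on v and on all T_i.\<close>

lemma bar_inv_eq: "bar_inv 2 1 n = bar_H n"
  unfolding bar_inv_def
proof (rule the_equality)
  show H: "bar_H n \<in> ring_iso (HA n) (HA n) \<and> bar_H n \<in> extensional (carrier (HA n)) \<and>
     bar_H n (hecke_scalar 2 1 n (vpow 1)) = hecke_scalar 2 1 n (vpow (- 1)) \<and>
     (\<forall>w \<in> weylB n. bar_H n (T_std 2 1 n w) = m_inv (HA n) (T_std 2 1 n (inv_into UNIV w)))"
    by (simp add: bar_H_iso bar_H_T_std hecke_scalar_cls bar_H_cls scalar_closed) (simp add: bar_H_def)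
  fix f assume f: "f \<in> ring_iso (HA n) (HA n) \<and> f \<in> extensional (carrier (HA n)) \<and>
     f (hecke_scalar 2 1 n (vpow 1)) = hecke_scalar 2 1 n (vpow (- 1)) \<and>
     (\<forall>w \<in> weylB n. f (T_std 2 1 n w) = m_inv (HA n) (T_std 2 1 n (inv_into UNIV w)))"
  have "f x = bar_H n x" if "x \<in> carrier (HA n)" for x
  proof (rule ring_hom_HA_eqI[OF _ bar_H_hom _ _ that])
    show "f \<in> ring_hom (HA n) (HA n)" using f by (simp add: ring_iso_def)
    show "f (cls n (scalar (vpow 1))) = bar_H n (cls n (scalar (vpow 1)))"
      using f H by (simp add: hecke_scalar_cls)
    show "f (cls n (gen i)) = bar_H n (cls n (gen i))" if "i < n" for i
      using f H s_gen_weylB[OF that] by (metis T_std_s_gen[OF that])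
  qed
  then show "f = bar_H n" using f H by (intro extensionalityI) blast+
qed

abbreviation KL :: "nat \<Rightarrow> (int \<Rightarrow> int) \<Rightarrow> free_poly set" where "KL n \<equiv> KL_basis 2 1 n"

text \<open>Identifies the definite description with the element from \<open>KL_exists\<close> and
  keeps the finer information that its lower terms live on shorter elements, whereas the description
  admits all y.\<close>

lemma KL_basis_coeffs:
  assumes w: "w \<in> weylB n"
  obtains d p where "KL n w = cls n (std_poly n d)" "bar_poly (std_poly n d) - std_poly n d \<in> HI n"
    "d = (\<lambda>z. (if z = w then 1 else 0) + p z)"
    "\<And>z. z \<in> weylB n \<Longrightarrow> p z \<in> lpos" "\<And>z. z \<in> weylB n \<Longrightarrow> \<not> len n z < len n w \<Longrightarrow> p z = 0"
proof -
  interpret H: ring "HA n" by (rule ring_hecke)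
  obtain c where c: "bar_h c = c" "c - HQ.Tw n w \<in> HQ.lspan n lpos (\<lambda>z. len n z < len n w)"
    using HQ.KL_exists[OF HQ_independent w] by blast
  obtain p where p: "c - HQ.Tw n w = HQ.comb n p"
    "\<forall>z \<in> weylB n. p z \<in> lpos \<and> (\<not> len n z < len n w \<longrightarrow> p z = 0)"
    using c(2) unfolding HQ.lspan_def by blast
  define d where "d = (\<lambda>z. (if z = w then 1 else 0) + p z)"
  have "HQ.comb n (\<lambda>z. if z = w then 1 else 0) = HQ.Tw n w"
    using HQ.comb_single[OF w, of 1] by simp
  then have "c = HQ.comb n d" unfolding d_def HQ.comb_add[symmetric] p(1)[symmetric] by simp
  then have cd: "c = emb (KH n) (std_poly n d)" by (simp add: HQ.comb_emb)
  then have "emb (KH n) (bar_poly (std_poly n d) - std_poly n d) = 0"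
    using c(1) by (simp add: bar_h_emb emb_hom)
  then have bar: "bar_poly (std_poly n d) - std_poly n d \<in> HI n"
    by (simp add: emb_KH_eq_0 FA_diff_closed bar_poly_closed std_poly_closed)
  \<comment> \<open>Translates the defining condition, stated with the operations of the quotient
    structure, into an equation in \<open>hring\<close>.\<close>
  have minus: "cls n q \<ominus>\<^bsub>HA n\<^esub> T_std 2 1 n w =
      (\<Oplus>\<^bsub>HA n\<^esub> y \<in> weylB n. hecke_scalar 2 1 n (p' y) \<otimes>\<^bsub>HA n\<^esub> T_std 2 1 n y) \<longleftrightarrow>
      emb (KH n) q - HQ.Tw n w = HQ.comb n p'" if q: "q \<in> carrier (FA n)" for q p'
  proof -
    have "cls n q \<ominus>\<^bsub>HA n\<^esub> T_std 2 1 n w = cls n (q - gen_poly n w)"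
      by (simp add: T_std_cls[OF w] cls_hom q gen_poly_closed[OF w])
    then show ?thesis
      by (simp add: HQ.Tw_emb HQ.comb_emb emb_KH_eq_iff FA_diff_closed q gen_poly_closed[OF w] std_poly_closed
           flip: cls_std_poly emb_hom(3))
  qed
  have "KL n w = cls n (std_poly n d)"
    unfolding KL_basis_def bar_inv_eq
  proof (rule the_equality)
    have "bar_H n (cls n (std_poly n d)) = cls n (std_poly n d)"
      using bar by (simp add: bar_H_cls cls_eq_iff bar_poly_closed std_poly_closed)
    moreover have "\<forall>y \<in> weylB n. Poly_Mapping.keys (p y) \<subseteq> {0<..}" using p(2) by (simp add: lpos_def)
    moreover have "cls n (std_poly n d) \<ominus>\<^bsub>HA n\<^esub> T_std 2 1 n w =
        (\<Oplus>\<^bsub>HA n\<^esub> y \<in> weylB n. hecke_scalar 2 1 n (p y) \<otimes>\<^bsub>HA n\<^esub> T_std 2 1 n y)"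
      unfolding minus[OF std_poly_closed] using p(1) cd by simp
    ultimately show "cls n (std_poly n d) \<in> carrier (HA n) \<and> bar_H n (cls n (std_poly n d)) = cls n (std_poly n d) \<and>
      (\<exists>p. (\<forall>y \<in> weylB n. Poly_Mapping.keys (p y) \<subseteq> {0<..}) \<and>
        cls n (std_poly n d) \<ominus>\<^bsub>HA n\<^esub> T_std 2 1 n w =
          (\<Oplus>\<^bsub>HA n\<^esub> y \<in> weylB n. hecke_scalar 2 1 n (p y) \<otimes>\<^bsub>HA n\<^esub> T_std 2 1 n y))"
      using cls_closed[OF std_poly_closed] by blast
    fix x assume x: "x \<in> carrier (HA n) \<and> bar_H n x = x \<and>
      (\<exists>p. (\<forall>y \<in> weylB n. Poly_Mapping.keys (p y) \<subseteq> {0<..}) \<and>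
        x \<ominus>\<^bsub>HA n\<^esub> T_std 2 1 n w =
          (\<Oplus>\<^bsub>HA n\<^esub> y \<in> weylB n. hecke_scalar 2 1 n (p y) \<otimes>\<^bsub>HA n\<^esub> T_std 2 1 n y))"
    then obtain q where q: "q \<in> carrier (FA n)" "x = cls n q" using HA_carrierE by blast
    from x obtain p' where p': "\<forall>y \<in> weylB n. Poly_Mapping.keys (p' y) \<subseteq> {0<..}"
      "emb (KH n) q - HQ.Tw n w = HQ.comb n p'"
      unfolding q(2) minus[OF q(1)] by blast
    have "emb (KH n) q - c = HQ.comb n (\<lambda>z. p' z - p z)"
      unfolding HQ.comb_diff[symmetric] p(1)[symmetric] p'(2)[symmetric] by simp
    moreover have "p' z - p z \<in> lpos" if "z \<in> weylB n" for z
      using lpos_add[of "p' z" "- p z"] p(2) p'(1) that by (simp add: lpos_def)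
    ultimately have "emb (KH n) q - c \<in> HQ.lspan n lpos (\<lambda>_. True)" unfolding HQ.lspan_def by blast
    moreover have "bar_h (emb (KH n) q - c) = emb (KH n) q - c"
    proof -
      have "cls n (bar_poly q) = cls n q" using x q by (simp add: bar_H_cls)
      then have "emb (KH n) (bar_poly q) = emb (KH n) q" by (simp add: emb_KH_eq_iff q(1) bar_poly_closed)
      then show ?thesis using c(1) by (simp add: HQ.bar_diff bar_h_emb)
    qed
    ultimately have "emb (KH n) q - c = 0"
      by (rule HQ.bar_invariant_lpos[OF HQ_independent, rotated 1]) (simp add: HQ.bar_Tw)
    then show "x = cls n (std_poly n d)" using q by (simp add: cd emb_KH_eq_iff std_poly_closed)
  qed
  from that[OF this bar d_def] show thesis using p(2) by blast
qed

lemma (in hecke_alg) comb_unitriangular: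
  assumes "w \<in> W" "d = (\<lambda>z. (if z = w then 1 else 0) + p z)"
    "\<And>z. z \<in> W \<Longrightarrow> \<not> len n z < len n w \<Longrightarrow> p z = 0"
  shows "comb d = Tw w + comb p" "comb d - Tw w \<in> aspan (\<lambda>z. len n z < len n w)"
proof -
  show d: "comb d = Tw w + comb p"
    using comb_single[OF assms(1), of 1] unfolding assms(2) by (simp flip: comb_add)
  have "comb p \<in> aspan (\<lambda>z. len n z < len n w)" unfolding lspan_def using assms(3) by blast
  then show "comb d - Tw w \<in> aspan (\<lambda>z. len n z < len n w)" by (simp add: d)
qed

theorem corollary3p4:
  fixes n :: nat
  shows "hecke_span 2 1 n (KL_basis 2 1 n ` {w. w \<in> weylB n \<and> w \<notin> weylB_b n}) = J_ideal 2 1 n"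
proof -
  interpret H: ring "HA n" by (rule ring_hecke)
  interpret J: ideal "J_ideal 2 1 n" "HA n" by (rule ideal_J)
  let ?W = "weylB n"
  have "\<forall>w \<in> ?W. \<exists>d p. KL n w = cls n (std_poly n d) \<and> bar_poly (std_poly n d) - std_poly n d \<in> HI n \<and>
    d = (\<lambda>z. (if z = w then 1 else 0) + p z) \<and>
    (\<forall>z \<in> ?W. p z \<in> lpos) \<and> (\<forall>z \<in> ?W. \<not> len n z < len n w \<longrightarrow> p z = 0)"
    by (rule ballI, erule KL_basis_coeffs) blast
  from bchoice[OF this] obtain D where "\<forall>w \<in> ?W. \<exists>p. KL n w = cls n (std_poly n (D w)) \<and>
    bar_poly (std_poly n (D w)) - std_poly n (D w) \<in> HI n \<and> D w = (\<lambda>z. (if z = w then 1 else 0) + p z) \<and>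
    (\<forall>z \<in> ?W. p z \<in> lpos) \<and> (\<forall>z \<in> ?W. \<not> len n z < len n w \<longrightarrow> p z = 0)" by blast
  from bchoice[OF this] obtain P where KL: "\<And>w. w \<in> ?W \<Longrightarrow> KL n w = cls n (std_poly n (D w))"
    and bar: "\<And>w. w \<in> ?W \<Longrightarrow> bar_poly (std_poly n (D w)) - std_poly n (D w) \<in> HI n"
    and D: "\<And>w. w \<in> ?W \<Longrightarrow> D w = (\<lambda>z. (if z = w then 1 else 0) + P w z)"
    and P_lpos: "\<And>w z. w \<in> ?W \<Longrightarrow> z \<in> ?W \<Longrightarrow> P w z \<in> lpos"
    and P_0: "\<And>w z. w \<in> ?W \<Longrightarrow> z \<in> ?W \<Longrightarrow> \<not> len n z < len n w \<Longrightarrow> P w z = 0"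
    by blast
  let ?N = "{w. w \<in> ?W \<and> w \<notin> weylB_b n}"
  have N: "?N = {w \<in> ?W. \<not> avoids w}" using weylB_b_iff by blast
  \<comment> \<open>The image of C_w in the quotient by J.\<close>
  define E where "E w = JQ.comb n (D w)" for w
  have E_emb: "E w = emb (KJ n) (std_poly n (D w))" for w by (simp add: E_def JQ.comb_emb)
  have E_tri: "E w - JQ.Tw n w \<in> JQ.aspan n (\<lambda>z. len n z < len n w)" if "w \<in> ?W" for w
    unfolding E_def by (rule JQ.comb_unitriangular(2)[OF that D[OF that] P_0[OF that]])
  have E_0: "E w = 0" if w: "w \<in> ?W" "\<not> avoids w" for w
  proof (rule JQ.bar_invariant_lpos[OF JQ_independent])
    show "bar_h (JQ.Tw n y) - JQ.Tw n y \<in> JQ.aspan n (\<lambda>z. avoids z \<and> len n z < len n y)" if "y \<in> ?W" for y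
      by (rule JQ.aspan_avoids[OF JQ.bar_Tw[OF that]])
    \<comment> \<open>Lower terms may involve elements with decreasing triples; rewriting those over
      Z[v] keeps the coefficients in v Z[v].\<close>
    have "JQ.comb n (P w) \<in> JQ.lspan n lpos (\<lambda>_. True)"
      unfolding JQ.lspan_def using P_lpos[OF w(1)] by blast
    then have "JQ.comb n (P w) \<in> JQ.lspan n lpos avoids"
    proof (rule JQ.lspan_subset)
      show "sc_h p * JQ.Tw n z \<in> JQ.lspan n lpos avoids" if "z \<in> ?W" "p \<in> lpos" for z p
        using JQ.lspan_scale[OF _ JQ.Tw_zspan_avoids[OF that(1)]] lpos_mult[OF _ that(2)]
        by (simp add: mult.commute)
    qed (auto intro: JQ.lspan_0 JQ.lspan_add lpos_0 lpos_add)
    moreover have "E w = JQ.Tw n w + JQ.comb n (P w)"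
      unfolding E_def by (rule JQ.comb_unitriangular(1)[OF w(1) D[OF w(1)] P_0[OF w(1)]])
    ultimately show "E w \<in> JQ.lspan n lpos avoids"
      using JQ.Tw_lpos_avoids[OF w] by (auto intro: JQ.lspan_add lpos_add)
    have "emb (KJ n) (bar_poly (std_poly n (D w)) - std_poly n (D w)) = 0"
      using bar[OF w(1)] HI_JI
      by (subst emb_KJ_eq_0) (auto intro: FA_diff_closed bar_poly_closed std_poly_closed)
    then show "bar_h (E w) = E w" by (simp add: E_emb bar_h_emb emb_hom)
  qed
  have KL_J: "KL n w \<in> J_ideal 2 1 n" if w: "w \<in> ?N" for w
  proof -
    have "std_poly n (D w) \<in> JI n"
      using E_0[of w] w unfolding N by (simp add: E_emb emb_KJ_eq_0 std_poly_closed)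
    then show ?thesis using w KL by (simp add: JI_def)
  qed
  have KL_closed: "KL n w \<in> carrier (HA n)" if "w \<in> ?W" for w
    using KL[OF that] cls_closed[OF std_poly_closed] by simp
  have hs_closed: "hecke_scalar 2 1 n c \<in> carrier (HA n)" for c
    by (simp add: hecke_scalar_cls cls_closed scalar_closed)
  \<comment> \<open>In \<open>hecke_span\<close> coefficients are attached to elements of the
    algebra and not to group elements, so the final expansion has to be reindexed along the map from
    w to C_w.\<close>
  have inj: "inj_on (KL n) ?W"
  proof (rule inj_onI)
    fix u w assume uw: "u \<in> ?W" "w \<in> ?W" "KL n u = KL n w"
    then have "HQ.comb n (D u) - HQ.comb n (D w) = 0"
      by (simp add: KL HQ.comb_emb emb_KH_eq_iff std_poly_closed)
    then have eq: "D u z = D w z" if "z \<in> ?W" for z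
      using HQ_independent that unfolding HQ.comb_diff HQ.independent_def by fastforce
    show "u = w"
    proof (rule ccontr)
      assume ne: "u \<noteq> w"
      show False
      \<comment> \<open>At whichever of u and w is at least as long as the other, its own expansion
        has coefficient 1 and the other one has 0.\<close>
      proof (cases "len n u < len n w")
        case True
        then show False using eq[OF uw(2)] D[OF uw(1)] D[OF uw(2)] P_0[OF uw(1,2)] P_0[OF uw(2,2)] ne by auto
      next
        case False
        then show False using eq[OF uw(1)] D[OF uw(1)] D[OF uw(2)] P_0[OF uw(1,1)] P_0[OF uw(2,1)] ne by auto
      qed
    qed
  qed
  show ?thesis
  proof
    show "hecke_span 2 1 n (KL n ` ?N) \<subseteq> J_ideal 2 1 n"
    proof
      fix x assume "x \<in> hecke_span 2 1 n (KL n ` ?N)"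
      then obtain F c where F': "finite F" "F \<subseteq> KL n ` ?N"
        and x: "x = (\<Oplus>\<^bsub>HA n\<^esub> y \<in> F. hecke_scalar 2 1 n (c y) \<otimes>\<^bsub>HA n\<^esub> y)"
        unfolding hecke_span_def mem_Collect_eq by (elim exE conjE)
      have F: "finite F" "F \<subseteq> J_ideal 2 1 n"
        using F'(1) subset_trans[OF F'(2) image_subsetI[OF KL_J]] by simp_all
      show "x \<in> J_ideal 2 1 n"
        unfolding x using F
      proof (induction F rule: finite_induct)
        case (insert y F)
        then have y: "hecke_scalar 2 1 n (c y) \<otimes>\<^bsub>HA n\<^esub> y \<in> J_ideal 2 1 n"
          by (intro J.I_l_closed hs_closed) auto
        have "(\<lambda>y. hecke_scalar 2 1 n (c y) \<otimes>\<^bsub>HA n\<^esub> y) \<in> F \<rightarrow> carrier (HA n)"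
          using insert.prems J.Icarr hs_closed by auto
        then show ?case using insert y J.Icarr[OF y] J.a_closed[OF y] by simp
      qed (simp add: J.zero_closed)
    qed
    show "J_ideal 2 1 n \<subseteq> hecke_span 2 1 n (KL n ` ?N)"
    proof
      fix x assume x: "x \<in> J_ideal 2 1 n"
      obtain p where p: "p \<in> carrier (FA n)" "x = cls n p" by (rule HA_carrierE[OF J.Icarr[OF x]])
      have pJ: "p \<in> JI n" using p x by (simp add: JI_def)
      have "HQ.comb n (D y) - HQ.Tw n y \<in> HQ.aspan n (\<lambda>z. len n z < len n y)" if "y \<in> ?W" for y
        by (rule HQ.comb_unitriangular(2)[OF that D[OF that] P_0[OF that]])
      from HQ.triangular_span[OF this HQ.emb_aspan[OF p(1)]]
      obtain g where g: "emb (KH n) p = (\<Sum>y \<in> ?W. sc_h (g y) * HQ.comb n (D y))" by blast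
      \<comment> \<open>Lifting the expansion to a polynomial allows it to be read in the Hecke
        algebra and in the quotient with the same coefficients.\<close>
      define r where "r Y = (\<Sum>y \<in> Y. scalar (g y) * std_poly n (D y))" for Y
      have r_closed: "r Y \<in> carrier (FA n)" if "Y \<subseteq> ?W" for Y
        unfolding r_def using finite_subset[OF that finite_weylB]
        by (intro FA_sum_closed FA_closed(2) scalar_closed std_poly_closed)
      have "emb (KH n) p = emb (KH n) (r ?W)"
        unfolding g r_def by (simp add: emb_sum emb_hom emb_scalar HQ.comb_emb)
      then have cls_p: "cls n p = cls n (r ?W)" using p(1) r_closed by (simp add: emb_KH_eq_iff)
      have "emb (KJ n) (r ?W) = 0"
        using x p r_closed by (simp add: emb_KJ_eq_0 JI_def flip: cls_p)
      then have "(\<Sum>y \<in> ?W. sc_h (g y) * E y) = 0"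
        by (simp add: r_def emb_sum emb_hom emb_scalar E_emb)
      moreover have "(\<Sum>y \<in> ?W. sc_h (g y) * E y) = (\<Sum>y \<in> {y \<in> ?W. avoids y}. sc_h (g y) * E y)"
        by (rule sum.mono_neutral_right) (auto simp: finite_weylB E_0)
      ultimately have "(\<Sum>y \<in> {y \<in> ?W. avoids y}. sc_h (g y) * E y) = 0" by simp
      then have g_0: "g y = 0" if "y \<in> ?W" "avoids y" for y
        by (rule JQ.triangular_independent[OF JQ_independent, where Y = "{y \<in> ?W. avoids y}" and C = E and g = g, rotated 3])
           (use that in \<open>auto intro: JQ.aspan_avoids E_tri\<close>)
      have "r ?W = r ?N"
        unfolding r_def N by (rule sum.mono_neutral_right) (auto simp: finite_weylB g_0)
      have fN: "finite ?N" using finite_weylB by simp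
      have "x = cls n (r ?N)" using p(2) cls_p \<open>r ?W = r ?N\<close> by simp
      also have "\<dots> = (\<Oplus>\<^bsub>HA n\<^esub> w \<in> ?N. cls n (scalar (g w) * std_poly n (D w)))"
        unfolding r_def by (rule cls_sum[OF fN FA_closed(2)[OF scalar_closed std_poly_closed]])
      also have "\<dots> = (\<Oplus>\<^bsub>HA n\<^esub> w \<in> ?N. hecke_scalar 2 1 n (g (inv_into ?W (KL n) (KL n w))) \<otimes>\<^bsub>HA n\<^esub> KL n w)"
      proof (rule H.finsum_cong'[OF refl])
        fix w assume w: "w \<in> ?N"
        then show "cls n (scalar (g w) * std_poly n (D w)) =
            hecke_scalar 2 1 n (g (inv_into ?W (KL n) (KL n w))) \<otimes>\<^bsub>HA n\<^esub> KL n w"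
          by (simp only: inv_into_f_f[OF inj] mem_Collect_eq)
             (simp add: cls_hom scalar_closed std_poly_closed hecke_scalar_cls KL)
      qed (simp add: hs_closed KL_closed)
      also have "\<dots> = (\<Oplus>\<^bsub>HA n\<^esub> y \<in> KL n ` ?N. hecke_scalar 2 1 n (g (inv_into ?W (KL n) y)) \<otimes>\<^bsub>HA n\<^esub> y)"
        by (rule H.finsum_reindex[symmetric]) (auto intro: inj_on_subset[OF inj] KL_closed hs_closed)
      finally show "x \<in> hecke_span 2 1 n (KL n ` ?N)"
        unfolding hecke_span_def mem_Collect_eq using fN
        by (intro exI[of _ "KL n ` ?N"] exI[of _ "\<lambda>y. g (inv_into ?W (KL n) y)"] conjI finite_imageI subset_refl)
    qed
  qed
qed

end
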